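(* Let $(M,I,J,K,g_M)$ be a hyperkähler manifold, $(N,g_N)$ a Riemannian manifold, and $F:(M,g_M)\to(N,g_N)$ a h-anti-invariant submersion such that $(I,J,K)$ is a h-anti-invariant basis, i.e. $F$ is a Riemannian submersion with $R(\ker F_* )\subset(\ker F_* )^{\perp}$ for each $R\in\{I,J,K\}$. Then the following conditions are equivalent: a) the distribution $(\ker F_* )^{\perp}$ is integrable; b) $g_M(\mathcal{A}_X B_I Y-\mathcal{A}_Y B_I X, IV)=g_M(C_I Y, I\mathcal{A}_X V)-g_M(C_I X, I\mathcal{A}_Y V)$ for all $V\in\Gamma(\ker F_* )$ and $X,Y\in\Gamma((\ker F_* )^{\perp})$; c) $g_M(\mathcal{A}_X B_J Y-\mathcal{A}_Y B_J X, JV)=g_M(C_J Y, J\mathcal{A}_X V)-g_M(C_J X, J\mathcal{A}_Y V)$ for all $V\in\Gamma(\ker F_* )$ and $X,Y\in\Gamma((\ker F_* )^{\perp})$; d) $g_M(\mathcal{A}_X B_K Y-\mathcal{A}_Y B_K X, KV)=g_M(C_K Y, K\mathcal{A}_X V)-g_M(C_K X, K\mathcal{A}_Y V)$ for all $V\in\Gamma(\ker F_* )$ and $X,Y\in\Gamma((\ker F_* )^{\perp})$.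
   Context: A hyperkähler manifold $(M,I,J,K,g_M)$ is a $4m$-dimensional Riemannian manifold with endomorphism fields $I,J,K$ of $TM$ satisfying $I^2=J^2=K^2=-\mathrm{id}$, $IJ=-JI=K$, $JK=-KJ=I$, $KI=-IK=J$, $g_M(RX,RY)=g_M(X,Y)$ for $R\in\{I,J,K\}$, and $\nabla I=\nabla J=\nabla K=0$, where $\nabla$ is the Levi-Civita connection of $g_M$. A Riemannian submersion $F:(M,g_M)\to(N,g_N)$ is a smooth surjective submersion such that $(F_* )_p:(\ker (F_* )_p)^{\perp}\to T_{F(p)}N$ is a linear isometry for every $p\in M$. For a vector field $U$ on $M$ write $U=\mathcal{V}U+\mathcal{H}U$ with $\mathcal{V}U\in\Gamma(\ker F_* )$ and $\mathcal{H}U\in\Gamma((\ker F_* )^{\perp})$. The O'Neill tensor $\mathcal{A}$ is $$\mathcal{A}_U W=\mathcal{H}\nabla_{\mathcal{H}U}\mathcal{V}W+\mathcal{V}\nabla_{\mathcal{H}U}\mathcal{H}W .$$ For $X\in\Gamma((\ker F_* )^{\perp})$ and $R\in\{I,J,K\}$ write $RX=B_RX+C_RX$ with $B_RX\in\Gamma(\ker F_* )$ and $C_RX\in\Gamma((\ker F_* )^{\perp})$. *)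

theory Defs
  imports "HOL-Analysis.Analysis" "HOL-Library.Function_Algebras"
begin

text \<open>Pointwise scalar multiplication; addition on functions is already pointwise in
  Function_Algebras. Tangent vectors and vector fields are functions.\<close>

instantiation "fun" :: (type, real_vector) real_vector
begin
definition scaleR_fun :: "real \<Rightarrow> ('a \<Rightarrow> 'b) \<Rightarrow> 'a \<Rightarrow> 'b"
  where "scaleR_fun c f = (\<lambda>x. c *\<^sub>R f x)"
instance
  by standard (simp_all add: scaleR_fun_def plus_fun_def fun_eq_iff algebra_simps)
end


section \<open>Smooth maps between open sets of Euclidean spaces\<close>

primrec Ck_on :: "nat \<Rightarrow> ('e::euclidean_space \<Rightarrow> 'f::real_normed_vector) \<Rightarrow> 'e set \<Rightarrow> bool" where
  "Ck_on 0 f S \<longleftrightarrow> continuous_on S f"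
| "Ck_on (Suc k) f S \<longleftrightarrow>
     (\<forall>x\<in>S. f differentiable (at x)) \<and>
     (\<forall>v. Ck_on k (\<lambda>x. frechet_derivative f (at x) v) S)"

text \<open>Only used for open sets.\<close>

definition smooth_on :: "'e set \<Rightarrow> ('e::euclidean_space \<Rightarrow> 'f::real_normed_vector) \<Rightarrow> bool"
  where "smooth_on S f \<longleftrightarrow> (\<forall>k. Ck_on k f S)"


section \<open>Smooth manifolds\<close>

text \<open>A manifold consists of all points of a (Hausdorff, second countable) topological type
  together with an atlas, which need not be maximal. A chart is a pair of a domain and a
  coordinate map.\<close>

type_synonym ('a, 'e) chart = "'a set \<times> ('a \<Rightarrow> 'e)"

definition is_chart :: "('a::topological_space, 'e::euclidean_space) chart \<Rightarrow> bool" where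
  "is_chart c \<longleftrightarrow> (case c of (U, \<phi>) \<Rightarrow>
     open U \<and> open (\<phi> ` U) \<and> homeomorphism U (\<phi> ` U) \<phi> (inv_into U \<phi>))"

definition smooth_manifold ::
  "('a::{t2_space, second_countable_topology}, 'e::euclidean_space) chart set \<Rightarrow> bool" where
  "smooth_manifold A \<longleftrightarrow>
     (\<forall>c\<in>A. is_chart c) \<and> (\<Union>c\<in>A. fst c) = UNIV \<and>
     (\<forall>(U, \<phi>)\<in>A. \<forall>(V, \<psi>)\<in>A. smooth_on (\<phi> ` (U \<inter> V)) (\<psi> \<circ> inv_into U \<phi>))"

definition smooth_functions :: "('a, 'e::euclidean_space) chart set \<Rightarrow> ('a \<Rightarrow> real) set" where
  "smooth_functions A = {f. \<forall>(U, \<phi>)\<in>A. smooth_on (\<phi> ` U) (f \<circ> inv_into U \<phi>)}"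

definition smooth_map :: "('a::topological_space, 'e::euclidean_space) chart set \<Rightarrow>
    ('b::topological_space, 'f::euclidean_space) chart set \<Rightarrow> ('a \<Rightarrow> 'b) \<Rightarrow> bool" where
  "smooth_map A B F \<longleftrightarrow> continuous_on UNIV F \<and>
     (\<forall>(U, \<phi>)\<in>A. \<forall>(V, \<psi>)\<in>B.
        smooth_on (\<phi> ` (U \<inter> F -` V)) (\<psi> \<circ> F \<circ> inv_into U \<phi>))"


section \<open>Tangent vectors, differentials and vector fields\<close>

text \<open>Tangent vectors are derivations at a point of the algebra of smooth functions. Since a
  derivation is here a total function on all real functions, it is required to vanish on
  functions that are not smooth, so that equality of tangent vectors is equality of
  derivations.\<close>

type_synonym 'a tvec = "('a \<Rightarrow> real) \<Rightarrow> real"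
type_synonym 'a vfield = "'a \<Rightarrow> 'a tvec"

definition tangent_space :: "('a, 'e::euclidean_space) chart set \<Rightarrow> 'a \<Rightarrow> 'a tvec set" where
  "tangent_space A p = {v.
     (\<forall>f\<in>smooth_functions A. \<forall>h\<in>smooth_functions A. v (f + h) = v f + v h) \<and>
     (\<forall>c. \<forall>f\<in>smooth_functions A. v (c *\<^sub>R f) = c * v f) \<and>
     (\<forall>f\<in>smooth_functions A. \<forall>h\<in>smooth_functions A. v (f * h) = v f * h p + f p * v h) \<and>
     (\<forall>f. f \<notin> smooth_functions A \<longrightarrow> v f = 0)}"

definition differential ::
  "('b, 'f::euclidean_space) chart set \<Rightarrow> ('a \<Rightarrow> 'b) \<Rightarrow> 'a tvec \<Rightarrow> 'b tvec" where
  "differential B F v = (\<lambda>h. if h \<in> smooth_functions B then v (h \<circ> F) else 0)"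

definition vector_fields :: "('a, 'e::euclidean_space) chart set \<Rightarrow> 'a vfield set" where
  "vector_fields A = {X. (\<forall>p. X p \<in> tangent_space A p) \<and>
     (\<forall>f\<in>smooth_functions A. (\<lambda>p. X p f) \<in> smooth_functions A)}"

definition lie_bracket ::
  "('a, 'e::euclidean_space) chart set \<Rightarrow> 'a vfield \<Rightarrow> 'a vfield \<Rightarrow> 'a vfield" where
  "lie_bracket A X Y = (\<lambda>p f. if f \<in> smooth_functions A
     then X p (\<lambda>q. Y q f) - Y p (\<lambda>q. X q f) else 0)"

text \<open>Smooth global sections of a distribution (a family of subspaces of the tangent spaces).\<close>

definition sections ::
  "('a, 'e::euclidean_space) chart set \<Rightarrow> ('a \<Rightarrow> 'a tvec set) \<Rightarrow> 'a vfield set" where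
  "sections A D = {X \<in> vector_fields A. \<forall>p. X p \<in> D p}"

definition endomorphism_field ::
  "('a, 'e::euclidean_space) chart set \<Rightarrow> ('a \<Rightarrow> 'a tvec \<Rightarrow> 'a tvec) \<Rightarrow> bool" where
  "endomorphism_field A R \<longleftrightarrow>
     (\<forall>p. \<forall>v\<in>tangent_space A p. R p v \<in> tangent_space A p) \<and>
     (\<forall>p. \<forall>v\<in>tangent_space A p. \<forall>w\<in>tangent_space A p. R p (v + w) = R p v + R p w) \<and>
     (\<forall>p c. \<forall>v\<in>tangent_space A p. R p (c *\<^sub>R v) = c *\<^sub>R R p v) \<and>
     (\<forall>X\<in>vector_fields A. (\<lambda>p. R p (X p)) \<in> vector_fields A)"

definition app :: "('a \<Rightarrow> 'a tvec \<Rightarrow> 'a tvec) \<Rightarrow> 'a vfield \<Rightarrow> 'a vfield"  (infixr "\<bullet>\<^sub>v" 75)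
  where "R \<bullet>\<^sub>v X = (\<lambda>p. R p (X p))"


section \<open>Integrable distributions\<close>

text \<open>An integral manifold is an immersed submanifold whose tangent spaces are the given
  subspaces. It is described by a smooth injective immersion \<open>s\<close> of an open set of \<open>'k\<close>, so
  \<open>DIM('k)\<close> is necessarily the rank of the distribution along the image.
  \<open>param_differential A s u v\<close> is the differential of \<open>s\<close> at \<open>u\<close> applied to \<open>v\<close>.\<close>

definition param_differential :: "('a, 'e::euclidean_space) chart set \<Rightarrow>
    ('k::euclidean_space \<Rightarrow> 'a) \<Rightarrow> 'k \<Rightarrow> 'k \<Rightarrow> 'a tvec" where
  "param_differential A s u v = (\<lambda>f. if f \<in> smooth_functions A
     then frechet_derivative (f \<circ> s) (at u) v else 0)"

definition integral_manifold :: "('a::topological_space, 'e::euclidean_space) chart set \<Rightarrow>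
    ('a \<Rightarrow> 'a tvec set) \<Rightarrow> 'k::euclidean_space set \<Rightarrow> ('k \<Rightarrow> 'a) \<Rightarrow> bool" where
  "integral_manifold A D U s \<longleftrightarrow>
     open U \<and> inj_on s U \<and> continuous_on U s \<and>
     (\<forall>(V, \<psi>)\<in>A. smooth_on (U \<inter> s -` V) (\<psi> \<circ> s)) \<and>
     (\<forall>u\<in>U. inj (param_differential A s u) \<and> range (param_differential A s u) = D (s u))"

text \<open>A distribution of rank \<open>DIM('k)\<close> is integrable if there is an integral manifold through
  every point.\<close>

definition integrable_distribution :: "'k::euclidean_space itself \<Rightarrow>
    ('a::topological_space, 'e::euclidean_space) chart set \<Rightarrow> ('a \<Rightarrow> 'a tvec set) \<Rightarrow> bool" where
  "integrable_distribution _ A D \<longleftrightarrow>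
     (\<forall>p. \<exists>(U::'k set) s. integral_manifold A D U s \<and> p \<in> s ` U)"


section \<open>Riemannian metrics and the Levi-Civita connection\<close>

type_synonym 'a metric = "'a \<Rightarrow> 'a tvec \<Rightarrow> 'a tvec \<Rightarrow> real"
type_synonym 'a connection = "'a vfield \<Rightarrow> 'a vfield \<Rightarrow> 'a vfield"

definition riemannian_metric :: "('a, 'e::euclidean_space) chart set \<Rightarrow> 'a metric \<Rightarrow> bool" where
  "riemannian_metric A g \<longleftrightarrow>
     (\<forall>p. \<forall>v\<in>tangent_space A p. \<forall>w\<in>tangent_space A p. g p v w = g p w v) \<and>
     (\<forall>p. \<forall>u\<in>tangent_space A p. \<forall>v\<in>tangent_space A p. \<forall>w\<in>tangent_space A p.
        g p (u + v) w = g p u w + g p v w) \<and>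
     (\<forall>p c. \<forall>v\<in>tangent_space A p. \<forall>w\<in>tangent_space A p. g p (c *\<^sub>R v) w = c * g p v w) \<and>
     (\<forall>p. \<forall>v\<in>tangent_space A p. v \<noteq> 0 \<longrightarrow> g p v v > 0) \<and>
     (\<forall>X\<in>vector_fields A. \<forall>Y\<in>vector_fields A. (\<lambda>p. g p (X p) (Y p)) \<in> smooth_functions A)"

definition riemannian_manifold ::
  "('a::{t2_space, second_countable_topology}, 'e::euclidean_space) chart set \<Rightarrow>
    'a metric \<Rightarrow> bool" where
  "riemannian_manifold A g \<longleftrightarrow> smooth_manifold A \<and> riemannian_metric A g"

definition affine_connection ::
  "('a, 'e::euclidean_space) chart set \<Rightarrow> 'a connection \<Rightarrow> bool" where
  "affine_connection A nab \<longleftrightarrow>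
     (\<forall>X\<in>vector_fields A. \<forall>Y\<in>vector_fields A. nab X Y \<in> vector_fields A) \<and>
     (\<forall>X\<in>vector_fields A. \<forall>X'\<in>vector_fields A. \<forall>Y\<in>vector_fields A.
        nab (X + X') Y = nab X Y + nab X' Y) \<and>
     (\<forall>f\<in>smooth_functions A. \<forall>X\<in>vector_fields A. \<forall>Y\<in>vector_fields A.
        nab (\<lambda>p. f p *\<^sub>R X p) Y = (\<lambda>p. f p *\<^sub>R nab X Y p)) \<and>
     (\<forall>X\<in>vector_fields A. \<forall>Y\<in>vector_fields A. \<forall>Y'\<in>vector_fields A.
        nab X (Y + Y') = nab X Y + nab X Y') \<and>
     (\<forall>f\<in>smooth_functions A. \<forall>X\<in>vector_fields A. \<forall>Y\<in>vector_fields A.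
        nab X (\<lambda>p. f p *\<^sub>R Y p) = (\<lambda>p. X p f *\<^sub>R Y p + f p *\<^sub>R nab X Y p))"

definition levi_civita ::
  "('a, 'e::euclidean_space) chart set \<Rightarrow> 'a metric \<Rightarrow> 'a connection \<Rightarrow> bool" where
  "levi_civita A g nab \<longleftrightarrow> affine_connection A nab \<and>
     (\<forall>X\<in>vector_fields A. \<forall>Y\<in>vector_fields A. nab X Y - nab Y X = lie_bracket A X Y) \<and>
     (\<forall>X\<in>vector_fields A. \<forall>Y\<in>vector_fields A. \<forall>Z\<in>vector_fields A. \<forall>p.
        X p (\<lambda>q. g q (Y q) (Z q)) = g p (nab X Y p) (Z p) + g p (Y p) (nab X Z p))"

definition parallel_endomorphism :: "('a, 'e::euclidean_space) chart set \<Rightarrow> 'a connection \<Rightarrow>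
    ('a \<Rightarrow> 'a tvec \<Rightarrow> 'a tvec) \<Rightarrow> bool" where
  "parallel_endomorphism A nab R \<longleftrightarrow>
     (\<forall>X\<in>vector_fields A. \<forall>Y\<in>vector_fields A. nab X (R \<bullet>\<^sub>v Y) - R \<bullet>\<^sub>v nab X Y = 0)"


section \<open>Hyperkaehler manifolds\<close>

text \<open>The Levi-Civita connection \<open>nab\<close> of \<open>g\<close>, which is unique on smooth vector fields, is an
  explicit parameter.\<close>

definition hyperkaehler_manifold ::
  "('a::{t2_space, second_countable_topology}, 'e::euclidean_space) chart set \<Rightarrow> 'a metric \<Rightarrow>
    'a connection \<Rightarrow> ('a \<Rightarrow> 'a tvec \<Rightarrow> 'a tvec) \<Rightarrow> ('a \<Rightarrow> 'a tvec \<Rightarrow> 'a tvec) \<Rightarrow>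
    ('a \<Rightarrow> 'a tvec \<Rightarrow> 'a tvec) \<Rightarrow> bool" where
  "hyperkaehler_manifold A g nab I J K \<longleftrightarrow>
     riemannian_manifold A g \<and> (\<exists>m. DIM('e) = 4 * m) \<and> levi_civita A g nab \<and>
     (\<forall>R\<in>{I, J, K}. endomorphism_field A R) \<and>
     (\<forall>R\<in>{I, J, K}. \<forall>p. \<forall>v\<in>tangent_space A p. R p (R p v) = - v) \<and>
     (\<forall>p. \<forall>v\<in>tangent_space A p.
        I p (J p v) = K p v \<and> J p (I p v) = - K p v \<and>
        J p (K p v) = I p v \<and> K p (J p v) = - I p v \<and>
        K p (I p v) = J p v \<and> I p (K p v) = - J p v) \<and>
     (\<forall>R\<in>{I, J, K}. \<forall>p. \<forall>v\<in>tangent_space A p. \<forall>w\<in>tangent_space A p.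
        g p (R p v) (R p w) = g p v w) \<and>
     (\<forall>R\<in>{I, J, K}. parallel_endomorphism A nab R)"


section \<open>Riemannian submersions\<close>

definition kernel_distribution :: "('a, 'e::euclidean_space) chart set \<Rightarrow>
    ('b, 'f::euclidean_space) chart set \<Rightarrow> ('a \<Rightarrow> 'b) \<Rightarrow> 'a \<Rightarrow> 'a tvec set" where
  "kernel_distribution A B F p = {v \<in> tangent_space A p. differential B F v = 0}"

definition orthogonal_distribution :: "('a, 'e::euclidean_space) chart set \<Rightarrow> 'a metric \<Rightarrow>
    ('a \<Rightarrow> 'a tvec set) \<Rightarrow> 'a \<Rightarrow> 'a tvec set" where
  "orthogonal_distribution A g D p = {v \<in> tangent_space A p. \<forall>w\<in>D p. g p v w = 0}"

definition riemannian_submersion ::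
  "('a::topological_space, 'e::euclidean_space) chart set \<Rightarrow> 'a metric \<Rightarrow>
    ('b::topological_space, 'f::euclidean_space) chart set \<Rightarrow> 'b metric \<Rightarrow>
    ('a \<Rightarrow> 'b) \<Rightarrow> bool" where
  "riemannian_submersion A g B h F \<longleftrightarrow>
     smooth_map A B F \<and> surj F \<and>
     (\<forall>p. differential B F ` tangent_space A p = tangent_space B (F p)) \<and>
     (\<forall>p. let H = orthogonal_distribution A g (kernel_distribution A B F) p in
        bij_betw (differential B F) H (tangent_space B (F p)) \<and>
        (\<forall>v\<in>H. \<forall>w\<in>H. h (F p) (differential B F v) (differential B F w) = g p v w))"

definition h_anti_invariant_submersion ::
  "('a::topological_space, 'e::euclidean_space) chart set \<Rightarrow> 'a metric \<Rightarrow>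
    ('b::topological_space, 'f::euclidean_space) chart set \<Rightarrow> 'b metric \<Rightarrow>
    ('a \<Rightarrow> 'a tvec \<Rightarrow> 'a tvec) \<Rightarrow> ('a \<Rightarrow> 'a tvec \<Rightarrow> 'a tvec) \<Rightarrow> ('a \<Rightarrow> 'a tvec \<Rightarrow> 'a tvec) \<Rightarrow>
    ('a \<Rightarrow> 'b) \<Rightarrow> bool" where
  "h_anti_invariant_submersion A g B h I J K F \<longleftrightarrow>
     riemannian_submersion A g B h F \<and>
     (\<forall>R\<in>{I, J, K}. \<forall>p. R p ` kernel_distribution A B F p
        \<subseteq> orthogonal_distribution A g (kernel_distribution A B F) p)"


section \<open>Projections and the O'Neill tensor\<close>

text \<open>\<open>proj A g D\<close> is the projection onto \<open>D\<close> along its orthogonal complement and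
  \<open>coproj A g D\<close> the complementary one; for the kernel distribution \<open>D\<close> these are the vertical
  and horizontal parts.\<close>

definition proj :: "('a, 'e::euclidean_space) chart set \<Rightarrow> 'a metric \<Rightarrow>
    ('a \<Rightarrow> 'a tvec set) \<Rightarrow> 'a \<Rightarrow> 'a tvec \<Rightarrow> 'a tvec" where
  "proj A g D p v = (THE w. w \<in> D p \<and> v - w \<in> orthogonal_distribution A g D p)"

definition coproj :: "('a, 'e::euclidean_space) chart set \<Rightarrow> 'a metric \<Rightarrow>
    ('a \<Rightarrow> 'a tvec set) \<Rightarrow> 'a \<Rightarrow> 'a tvec \<Rightarrow> 'a tvec" where
  "coproj A g D p v = v - proj A g D p v"

definition oneill_A :: "('a, 'e::euclidean_space) chart set \<Rightarrow> 'a metric \<Rightarrow>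
    'a connection \<Rightarrow> ('a \<Rightarrow> 'a tvec set) \<Rightarrow> 'a vfield \<Rightarrow> 'a vfield \<Rightarrow> 'a vfield" where
  "oneill_A A g nab D U W =
     coproj A g D \<bullet>\<^sub>v nab (coproj A g D \<bullet>\<^sub>v U) (proj A g D \<bullet>\<^sub>v W) +
     proj A g D \<bullet>\<^sub>v nab (coproj A g D \<bullet>\<^sub>v U) (coproj A g D \<bullet>\<^sub>v W)"

end

theory Submission
  imports Defs
begin

text \<open>
  For \<open>R \<in> {I, J, K}\<close>, horizontal \<open>X, Y\<close> and vertical \<open>V\<close>, parallelism of \<open>R\<close> gives
  \<open>g([X,Y], V) = g(\<nabla>\<^sub>X RY - \<nabla>\<^sub>Y RX, RV)\<close>. Splitting \<open>RY = B\<^sub>R Y + C\<^sub>R Y\<close> and moving the derivative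
  off \<open>C\<^sub>R Y\<close>, which is orthogonal to \<open>RV\<close>, turns the right-hand side into the difference of the two
  sides of the condition for \<open>R\<close>. Hence each condition says that \<open>(ker F\<^sub>*)\<^sup>\<bottom>\<close> is involutive, and
  it remains to prove the theorem of Frobenius for this distribution. The submersion provides
  commuting horizontal lifts of coordinate fields of the base, which reduces Frobenius to a total
  differential equation \<open>Ds = \<Lambda>(s)\<close>; that equation is solved by a Picard iteration along rays.
\<close>

section \<open>Calculus of smooth maps\<close>

text \<open>Two features of the setting shape the proof. Tangent vectors are derivations of the
  algebra of global smooth functions, so local objects (chart coordinates, frames, lifts) must be
  cut off by bump functions before a vector can act on them, and Hadamard's lemma is what identifies
  derivations with coordinate vectors. Moreover, nothing says in advance that the vertical and
  horizontal projections exist or are smooth: \<open>proj\<close> is a definite description. Both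
  facts come from a local horizontal frame, obtained from the gradients of the functions
  \<open>y j \<circ> F\<close> by inverting their Gram matrix, which is positive definite because
  the differential of \<open>F\<close> is onto. The frame is dual to the differentials of these
  functions, so brackets of frame fields are vertical; involutivity makes them horizontal as well,
  hence zero. The orthogonality of \<open>C\<^sub>R Y\<close> and \<open>R V\<close> comes from
  \<open>g(R Y, R V) = g(Y, V) = 0\<close>, because \<open>B\<^sub>R Y\<close> is vertical and
  \<open>R V\<close> is horizontal.\<close>

lemma frechet_derivative_cong_open:
  assumes "open S" "x \<in> S" "\<And>y. y \<in> S \<Longrightarrow> f y = g y"
  shows "frechet_derivative f (at x) = frechet_derivative g (at x)"
proof -
  \<comment> \<open>\<open>frechet_derivative\<close> is a choice from the derivatives, so equality
    of the two predicates gives equality of the choices, even where neither function is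
    differentiable.\<close>
  have "(f has_derivative D) (at x) \<longleftrightarrow> (g has_derivative D) (at x)" for D
    using has_derivative_transform_within_open[of f D x UNIV S g]
      has_derivative_transform_within_open[of g D x UNIV S f] assms by auto
  then show ?thesis
    unfolding frechet_derivative_def by simp
qed

lemma differentiable_cong_open:
  assumes "open S" "x \<in> S" "\<And>y. y \<in> S \<Longrightarrow> f y = g y" "f differentiable (at x)"
  shows "g differentiable (at x)"
  using has_derivative_transform_within_open[of f _ x UNIV S g] assms
  unfolding differentiable_def by blast

lemma Ck_on_cong:
  assumes "open S" "\<And>x. x \<in> S \<Longrightarrow> f x = g x" "Ck_on k f S"
  shows "Ck_on k g S"
  using assms(2,3)
proof (induction k arbitrary: f g)
  case 0
  then show ?case
    by (metis Ck_on.simps(1) continuous_on_eq)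
next
  case (Suc k)
  have "Ck_on k (\<lambda>x. frechet_derivative g (at x) v) S" for v
  proof (rule Suc.IH)
    show "Ck_on k (\<lambda>x. frechet_derivative f (at x) v) S"
      using Suc.prems(2) by simp
    show "frechet_derivative f (at x) v = frechet_derivative g (at x) v" if "x \<in> S" for x
      using frechet_derivative_cong_open[OF assms(1) that, of f g] Suc.prems(1) by simp
  qed
  moreover have "g differentiable (at x)" if "x \<in> S" for x
    using differentiable_cong_open[OF assms(1) that, of f g] Suc.prems that by auto
  ultimately show ?case by simp
qed

lemma Ck_on_subset: "Ck_on k f S \<Longrightarrow> T \<subseteq> S \<Longrightarrow> Ck_on k f T"
  by (induction k arbitrary: f) (auto intro: continuous_on_subset)

lemma Ck_on_Suc_imp: "Ck_on (Suc k) f S \<Longrightarrow> Ck_on k f S"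
proof (induction k arbitrary: f)
  case 0
  then show ?case
    by (auto intro!: continuous_at_imp_continuous_on differentiable_imp_continuous_within)
next
  case (Suc k)
  have "Ck_on (Suc k) (\<lambda>x. frechet_derivative f (at x) v) S" for v
    using Suc.prems unfolding Ck_on.simps(2)[of "Suc k"] by blast
  then have "Ck_on k (\<lambda>x. frechet_derivative f (at x) v) S" for v
    by (rule Suc.IH)
  then show ?case
    using Suc.prems unfolding Ck_on.simps(2)[of k] Ck_on.simps(2)[of "Suc k"] by blast
qed

lemma Ck_on_imp_continuous_on: "Ck_on k f S \<Longrightarrow> continuous_on S f"
  by (induction k) (auto dest: Ck_on_Suc_imp simp del: Ck_on.simps(2))

lemma Ck_on_Union:
  assumes "\<And>i. i \<in> I \<Longrightarrow> open (S i)" "\<And>i. i \<in> I \<Longrightarrow> Ck_on k f (S i)"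
  shows "Ck_on k f (\<Union>i\<in>I. S i)"
  using assms(2)
proof (induction k arbitrary: f)
  case 0
  then show ?case using continuous_on_open_UN[of I S f] assms(1) by simp
qed auto

text \<open>Lets an explicit formula \<open>f'\<close> replace the choice-based
  \<open>frechet_derivative\<close>; the closure proofs below raise the order through this
  rule.\<close>

lemma Ck_on_SucI:
  assumes "open S" "\<And>x. x \<in> S \<Longrightarrow> (f has_derivative f' x) (at x)"
    "\<And>v. Ck_on k (\<lambda>x. f' x v) S"
  shows "Ck_on (Suc k) f S"
proof -
  have "frechet_derivative f (at x) = f' x" if "x \<in> S" for x
    using assms(2)[OF that] by (metis frechet_derivative_at)
  then have "Ck_on k (\<lambda>x. frechet_derivative f (at x) v) S" for v
    by (intro Ck_on_cong[OF assms(1) _ assms(3)]) simp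
  then show ?thesis
    using assms(2) by (auto simp: differentiable_def)
qed

lemma Ck_on_SucD:
  assumes "Ck_on (Suc k) f S" "x \<in> S"
  shows "(f has_derivative frechet_derivative f (at x)) (at x)"
  using assms by (simp add: frechet_derivative_works)

lemma Ck_on_const: "open S \<Longrightarrow> Ck_on k (\<lambda>x. c) S"
proof (induction k arbitrary: c)
  case (Suc k)
  show ?case
    by (rule Ck_on_SucI[where f' = "\<lambda>x v. 0"]) (use Suc in auto)
qed auto

lemma Ck_on_bounded_linear:
  assumes "open S" "bounded_linear f"
  shows "Ck_on k f S"
proof (cases k)
  case 0
  then show ?thesis using assms(2) by (simp add: linear_continuous_on)
next
  case (Suc k)
  show ?thesis unfolding Suc
    by (rule Ck_on_SucI[where f' = "\<lambda>x. f"])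
      (use assms in \<open>auto intro: bounded_linear_imp_has_derivative Ck_on_const\<close>)
qed

lemma Ck_on_add:
  assumes "open S" "Ck_on k f S" "Ck_on k g S"
  shows "Ck_on k (\<lambda>x. f x + g x) S"
  using assms(2,3)
proof (induction k arbitrary: f g)
  case 0
  then show ?case by (auto intro: continuous_intros)
next
  case (Suc k)
  show ?case
    using Suc.prems
    by (intro Ck_on_SucI[OF assms(1), where f' = "\<lambda>x v. frechet_derivative f (at x) v + frechet_derivative g (at x) v"]
        has_derivative_add Suc.IH) (auto simp: frechet_derivative_works)
qed

lemma Ck_on_bilinear:
  fixes prod (infixl "\<star>" 70)
  assumes "bounded_bilinear prod" "open S" "Ck_on k f S" "Ck_on k g S"
  shows "Ck_on k (\<lambda>x. f x \<star> g x) S"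
  using assms(3,4)
proof (induction k arbitrary: f g)
  case 0
  then show ?case by (auto intro!: bounded_bilinear.continuous_on[OF assms(1)])
next
  case (Suc k)
  have "Ck_on k (\<lambda>x. f x \<star> frechet_derivative g (at x) v
      + frechet_derivative f (at x) v \<star> g x) S" for v
    using Suc Ck_on_Suc_imp[OF Suc.prems(1)] Ck_on_Suc_imp[OF Suc.prems(2)]
    by (intro Ck_on_add[OF assms(2)] Suc.IH) auto
  then show ?case
    by (intro Ck_on_SucI[OF assms(2), where f' = "\<lambda>x v. f x \<star> frechet_derivative g (at x) v
      + frechet_derivative f (at x) v \<star> g x"] bounded_bilinear.FDERIV[OF assms(1)])
      (use Suc.prems in \<open>auto intro!: Ck_on_SucD simp del: Ck_on.simps\<close>)
qed

lemma Ck_on_sum: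
  assumes "open S" "finite B" "\<And>i. i \<in> B \<Longrightarrow> Ck_on k (f i) S"
  shows "Ck_on k (\<lambda>x. \<Sum>i\<in>B. f i x) S"
  using assms(2,3)
  by (induction B rule: finite_induct) (auto intro!: Ck_on_add Ck_on_const assms(1))

lemma Ck_on_compose:
  fixes f :: "'a::euclidean_space \<Rightarrow> 'b::real_normed_vector"
    and g :: "'c::euclidean_space \<Rightarrow> 'a"
  assumes "open S" "open T" "g ` S \<subseteq> T" "Ck_on k f T" "Ck_on k g S"
  shows "Ck_on k (\<lambda>x. f (g x)) S"
  using assms(4,5)
proof (induction k arbitrary: f)
  case 0
  then show ?case using assms(3) by (auto intro: continuous_on_compose2)
next
  case (Suc k)
  have der: "((\<lambda>x. f (g x)) has_derivative
      (\<lambda>v. frechet_derivative f (at (g x)) (frechet_derivative g (at x) v))) (at x)" if "x \<in> S" for x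
    using has_derivative_compose[OF Ck_on_SucD[OF Suc.prems(2) that], of f]
      Ck_on_SucD[OF Suc.prems(1), of "g x"] assms(3) that
    by auto
  have lin: "linear (frechet_derivative f (at (g x)))" if "x \<in> S" for x
    using Ck_on_SucD[OF Suc.prems(1), of "g x"] that assms(3) has_derivative_linear by blast
  \<comment> \<open>The derivative of \<open>f\<close> is applied to a vector that varies with
    \<open>x\<close>. Expanding this vector in \<open>Basis\<close> leaves products of scalar
    functions with partial derivatives of \<open>f\<close> composed with \<open>g\<close>, and the
    latter fall under the induction hypothesis.\<close>
  have *: "frechet_derivative f (at (g x)) (frechet_derivative g (at x) v) =
      (\<Sum>b\<in>Basis. (frechet_derivative g (at x) v \<bullet> b) *\<^sub>R frechet_derivative f (at (g x)) b)"
    if "x \<in> S" for x v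
    unfolding linear_sum[OF lin[OF that], symmetric] linear_scale[OF lin[OF that], symmetric]
    by (simp add: euclidean_representation)
  have "Ck_on k (\<lambda>x. \<Sum>b\<in>Basis. (frechet_derivative g (at x) v \<bullet> b) *\<^sub>R
      frechet_derivative f (at (g x)) b) S" for v
  proof (intro Ck_on_sum Ck_on_bilinear[OF bounded_bilinear_scaleR] assms(1) finite_Basis)
    fix b :: 'a assume "b \<in> Basis"
    show "Ck_on k (\<lambda>x. frechet_derivative g (at x) v \<bullet> b) S"
      using Suc.prems
      by (intro Ck_on_bilinear[OF bounded_bilinear_inner] assms(1) Ck_on_const) auto
    show "Ck_on k (\<lambda>x. frechet_derivative f (at (g x)) b) S"
      using Suc Ck_on_Suc_imp[OF Suc.prems(2)] by (intro Suc.IH) auto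
  qed
  then have "Ck_on k (\<lambda>x. frechet_derivative f (at (g x)) (frechet_derivative g (at x) v)) S" for v
    by (rule Ck_on_cong[OF assms(1), rotated]) (simp add: *)
  then show ?case using der by (intro Ck_on_SucI[OF assms(1)])
qed

text \<open>The derivative \<open>- f' / f^2\<close> is a product of \<open>f'\<close> with factors
  \<open>1 / f\<close>, all of one order less, so the induction closes on itself.\<close>

lemma Ck_on_inverse:
  fixes f :: "'a::euclidean_space \<Rightarrow> real"
  assumes "open S" "\<And>x. x \<in> S \<Longrightarrow> f x \<noteq> 0" "Ck_on k f S"
  shows "Ck_on k (\<lambda>x. inverse (f x)) S"
  using assms(3)
proof (induction k)
  case 0
  then show ?case using assms(2) by (auto intro!: continuous_intros)
next
  case (Suc k)
  have "Ck_on k (\<lambda>x. (- inverse (f x)) * (frechet_derivative f (at x) v * inverse (f x))) S" for v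
  proof (intro Ck_on_bilinear[OF bounded_bilinear_mult assms(1)])
    have inv: "Ck_on k (\<lambda>x. inverse (f x)) S"
      by (rule Suc.IH[OF Ck_on_Suc_imp[OF Suc.prems]])
    then show "Ck_on k (\<lambda>x. inverse (f x)) S" .
    show "Ck_on k (\<lambda>x. - inverse (f x)) S"
      using Ck_on_bilinear[OF bounded_bilinear_mult assms(1) Ck_on_const[OF assms(1)] inv, of "-1"]
      by simp
    show "Ck_on k (\<lambda>x. frechet_derivative f (at x) v) S"
      using Suc.prems by simp
  qed
  moreover have "((\<lambda>x. inverse (f x)) has_derivative
      (\<lambda>v. (- inverse (f x)) * (frechet_derivative f (at x) v * inverse (f x)))) (at x)" if "x \<in> S" for x
    using Deriv.has_derivative_inverse[OF assms(2)[OF that] Ck_on_SucD[OF Suc.prems that]]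
    by (simp add: mult.assoc)
  ultimately show ?case
    by (intro Ck_on_SucI[OF assms(1)])
qed

section \<open>Closure properties of infinitely differentiable maps\<close>

lemma smooth_on_cong: "open S \<Longrightarrow> (\<And>x. x \<in> S \<Longrightarrow> f x = g x) \<Longrightarrow> smooth_on S f \<Longrightarrow> smooth_on S g"
  unfolding smooth_on_def using Ck_on_cong[of S f g] by blast

lemma smooth_on_subset: "smooth_on S f \<Longrightarrow> T \<subseteq> S \<Longrightarrow> smooth_on T f"
  unfolding smooth_on_def using Ck_on_subset[of _ f S T] by blast

lemma smooth_on_Union:
  "(\<And>i. i \<in> I \<Longrightarrow> open (S i)) \<Longrightarrow> (\<And>i. i \<in> I \<Longrightarrow> smooth_on (S i) f) \<Longrightarrow> smooth_on (\<Union>i\<in>I. S i) f"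
  unfolding smooth_on_def by (simp add: Ck_on_Union)

lemma smooth_on_const: "open S \<Longrightarrow> smooth_on S (\<lambda>x. c)"
  unfolding smooth_on_def by (simp add: Ck_on_const)

lemma smooth_on_bounded_linear: "open S \<Longrightarrow> bounded_linear f \<Longrightarrow> smooth_on S f"
  unfolding smooth_on_def by (simp add: Ck_on_bounded_linear)

lemma smooth_on_add:
  "open S \<Longrightarrow> smooth_on S f \<Longrightarrow> smooth_on S g \<Longrightarrow> smooth_on S (\<lambda>x. f x + g x)"
  unfolding smooth_on_def by (simp add: Ck_on_add)

lemma smooth_on_bilinear:
  "bounded_bilinear pr \<Longrightarrow> open S \<Longrightarrow> smooth_on S f \<Longrightarrow> smooth_on S g
    \<Longrightarrow> smooth_on S (\<lambda>x. pr (f x) (g x))"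
  unfolding smooth_on_def by (simp add: Ck_on_bilinear)

lemma smooth_on_inverse:
  fixes f :: "'a::euclidean_space \<Rightarrow> real"
  shows "open S \<Longrightarrow> (\<And>x. x \<in> S \<Longrightarrow> f x \<noteq> 0) \<Longrightarrow> smooth_on S f \<Longrightarrow> smooth_on S (\<lambda>x. inverse (f x))"
  unfolding smooth_on_def by (simp add: Ck_on_inverse)

lemma smooth_on_compose:
  fixes f :: "'a::euclidean_space \<Rightarrow> 'b::real_normed_vector"
    and g :: "'c::euclidean_space \<Rightarrow> 'a"
  shows "open S \<Longrightarrow> open T \<Longrightarrow> g ` S \<subseteq> T \<Longrightarrow> smooth_on T f \<Longrightarrow> smooth_on S g
    \<Longrightarrow> smooth_on S (\<lambda>x. f (g x))"
  unfolding smooth_on_def using Ck_on_compose[of S T g _ f] by blast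

lemma smooth_on_has_derivative:
  assumes "smooth_on S f" "x \<in> S"
  shows "(f has_derivative frechet_derivative f (at x)) (at x)"
  using assms Ck_on_SucD unfolding smooth_on_def by blast

lemma smooth_on_frechet_derivative:
  "smooth_on S f \<Longrightarrow> smooth_on S (\<lambda>x. frechet_derivative f (at x) v)"
  unfolding smooth_on_def by (metis Ck_on.simps(2))

lemma smooth_on_imp_continuous_on: "smooth_on S f \<Longrightarrow> continuous_on S f"
  unfolding smooth_on_def by (metis Ck_on.simps(1))

lemma smooth_on_linear_frechet:
  "smooth_on S f \<Longrightarrow> x \<in> S \<Longrightarrow> linear (frechet_derivative f (at x))"
  using smooth_on_has_derivative has_derivative_linear by blast

lemma frechet_derivative_compose_smooth:
  assumes "smooth_on T f" "g x \<in> T" "(g has_derivative g') (at x)"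
  shows "frechet_derivative (\<lambda>x. f (g x)) (at x) v = frechet_derivative f (at (g x)) (g' v)"
  using has_derivative_compose[OF assms(3), of f] smooth_on_has_derivative[OF assms(1,2)]
  by (metis frechet_derivative_at)


subsection \<open>Bump functions\<close>

text \<open>The factor \<open>inverse t ^ m\<close> makes the family closed under differentiation.\<close>

definition flat_exp :: "nat \<Rightarrow> real \<Rightarrow> real" where
  "flat_exp m t = (if t > 0 then exp (- inverse t) * inverse t ^ m else 0)"

lemma flat_exp_has_derivative:
  "(flat_exp m has_real_derivative flat_exp (m+2) t - m * flat_exp (m+1) t) (at t)"
proof -
  consider "t > 0" | "t < 0" | "t = 0" by linarith
  then show ?thesis
  proof cases
    case 1
    have "((\<lambda>t. exp (- inverse t) * inverse t ^ m) has_real_derivative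
        flat_exp (m+2) t - m * flat_exp (m+1) t) (at t)"
    proof -
      \<comment> \<open>For \<open>m = 0\<close> the truncated exponent \<open>m - 1\<close> does no
        harm, because the factor \<open>m\<close> vanishes.\<close>
      have "real m * inverse t ^ (m - 1) * inverse t = real m * inverse t ^ m" for t :: real
        by (cases m) auto
      from this[of t] show ?thesis
        using 1 by (auto intro!: derivative_eq_intros simp: flat_exp_def algebra_simps power2_eq_square)
    qed
    then show ?thesis
      by (rule has_field_derivative_transform_within_open[of _ _ _ "{0<..}"]) (use 1 in \<open>auto simp: flat_exp_def\<close>)
  next
    case 2
    have "((\<lambda>t. 0) has_real_derivative flat_exp (m+2) t - m * flat_exp (m+1) t) (at t)"
      using 2 by (simp add: flat_exp_def)
    then show ?thesis
      by (rule has_field_derivative_transform_within_open[of _ _ _ "{..<0}"]) (use 2 in \<open>auto simp: flat_exp_def\<close>)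
  next
    case 3
    \<comment> \<open>With \<open>u = 1 / t\<close> this is the difference quotient at 0 from the
      right; the exponent \<open>m+1\<close> contains the extra division by
      \<open>t\<close>.\<close>
    have "((\<lambda>u. u ^ (m+1) / exp u) \<longlongrightarrow> (0::real)) at_top"
      by (rule tendsto_power_div_exp_0)
    then have "((\<lambda>t. inverse t ^ (m+1) / exp (inverse t)) \<longlongrightarrow> (0::real)) (at_right 0)"
      by (rule filterlim_compose[OF _ filterlim_inverse_at_top_right])
    then have r: "((\<lambda>t. flat_exp m t / t) \<longlongrightarrow> 0) (at_right 0)"
      by (rule Lim_transform_eventually)
        (auto simp: flat_exp_def exp_minus field_simps eventually_at_right_field intro: exI[of _ 1])
    have l: "((\<lambda>t. flat_exp m t / t) \<longlongrightarrow> 0) (at_left 0)"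
      by (rule tendsto_eventually) (auto simp: flat_exp_def eventually_at_left_field intro: exI[of _ "-1"])
    have "((\<lambda>t. flat_exp m t / t) \<longlongrightarrow> 0) (at 0)"
      using l r by (simp add: filterlim_split_at)
    then show ?thesis
      unfolding 3 by (simp add: has_field_derivative_iff flat_exp_def)
  qed
qed

lemma smooth_on_flat_exp: "smooth_on UNIV (flat_exp m)"
  unfolding smooth_on_def
proof
  fix k
  show "Ck_on k (flat_exp m) UNIV"
  proof (induction k arbitrary: m)
    case 0
    then show ?case
      by (auto intro!: continuous_at_imp_continuous_on DERIV_isCont flat_exp_has_derivative)
  next
    case (Suc k)
    have "Ck_on k (\<lambda>t. v * (flat_exp (m+2) t + (- real m) * flat_exp (m+1) t)) UNIV" for v
      by (intro Ck_on_bilinear[OF bounded_bilinear_mult] Ck_on_add Suc Ck_on_const) auto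
    then show ?case
      using flat_exp_has_derivative[of m]
      by (intro Ck_on_SucI[where f' = "\<lambda>t v. v * (flat_exp (m+2) t + (- real m) * flat_exp (m+1) t)"])
        (auto simp: has_field_derivative_def mult_commute_abs mult.commute)
  qed
qed

text \<open>The quotient \<open>a / (a + b)\<close> of flat functions: \<open>a\<close> is positive
  exactly inside radius \<open>R\<close>, \<open>b\<close> exactly outside radius \<open>r\<close>,
  and \<open>r < R\<close> prevents both from vanishing at the same point.\<close>

lemma smooth_bump:
  fixes z :: "'a::euclidean_space"
  assumes "0 < r" "r < R"
  obtains \<beta> :: "'a \<Rightarrow> real" where "smooth_on UNIV \<beta>"
    "\<And>x. x \<in> ball z r \<Longrightarrow> \<beta> x = 1" "\<And>x. x \<notin> ball z R \<Longrightarrow> \<beta> x = 0"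
proof -
  define n where "n = (\<lambda>x. (x - z) \<bullet> (x - z))"
  define a where "a = (\<lambda>x. flat_exp 0 (R\<^sup>2 + (-1) * n x))"
  define b where "b = (\<lambda>x. flat_exp 0 (n x + (- r\<^sup>2)))"
  have *: "n x = (dist z x)\<^sup>2" for x
    by (simp add: n_def dist_norm norm_minus_commute flip: power2_norm_eq_inner)
  have "r\<^sup>2 < R\<^sup>2" using assms by (intro power_strict_mono) auto
  then have pos: "a x + b x > 0" for x
  proof -
    have "flat_exp 0 t \<ge> 0" "t > 0 \<Longrightarrow> flat_exp 0 t > 0" for t
      by (auto simp: flat_exp_def)
    then show ?thesis
      using \<open>r\<^sup>2 < R\<^sup>2\<close> unfolding a_def b_def
      by (cases "n x < R\<^sup>2") (auto intro: add_pos_nonneg add_nonneg_pos)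
  qed
  have d: "smooth_on UNIV (\<lambda>x. x - z)"
    using smooth_on_add[OF _ smooth_on_bounded_linear[OF _ bounded_linear_ident]
        smooth_on_const[of _ "- z"]] by simp
  have sn: "smooth_on UNIV n"
    unfolding n_def by (intro smooth_on_bilinear[OF bounded_bilinear_inner] d) auto
  have sa: "smooth_on UNIV a" unfolding a_def
    by (intro smooth_on_compose[OF _ _ _ smooth_on_flat_exp] smooth_on_add sn smooth_on_const
        smooth_on_bilinear[OF bounded_bilinear_mult]) auto
  have sb: "smooth_on UNIV b" unfolding b_def
    by (intro smooth_on_compose[OF _ _ _ smooth_on_flat_exp] smooth_on_add sn smooth_on_const) auto
  show ?thesis
  proof
    show "smooth_on UNIV (\<lambda>x. a x * inverse (a x + b x))"
      by (intro smooth_on_bilinear[OF bounded_bilinear_mult] smooth_on_inverse smooth_on_add sa sb)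
        (use pos[THEN less_imp_neq] in auto)
    show "a x * inverse (a x + b x) = 1" if "x \<in> ball z r" for x
    proof -
      have "n x < r\<^sup>2" using that assms by (auto simp: * intro!: power_strict_mono)
      then have "b x = 0" by (simp add: b_def flat_exp_def)
      then show ?thesis using pos[of x] by simp
    qed
    show "a x * inverse (a x + b x) = 0" if "x \<notin> ball z R" for x
    proof -
      have "n x \<ge> R\<^sup>2" using that assms by (auto simp: * intro!: power_mono)
      then show ?thesis by (simp add: a_def flat_exp_def)
    qed
  qed
qed

subsection \<open>Symmetry of second derivatives and Hadamard's lemma\<close>

text \<open>One application of the mean value theorem in each direction. The second difference is
  symmetric in \<open>u\<close> and \<open>v\<close>, while the derivatives on the right are taken
  in a fixed order; comparing both orders yields the symmetry of second derivatives.\<close>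

lemma second_difference_mvt:
  fixes f :: "'a::euclidean_space \<Rightarrow> real"
  assumes S: "\<And>s t. s \<in> {0..1} \<Longrightarrow> t \<in> {0..1} \<Longrightarrow> x + s *\<^sub>R u + t *\<^sub>R v \<in> S"
    and f: "Ck_on 2 f S"
  obtains s t where "s \<in> {0..1}" "t \<in> {0..1}"
    "f (x + u + v) - f (x + u) - f (x + v) + f x =
      frechet_derivative (\<lambda>y. frechet_derivative f (at y) u) (at (x + s *\<^sub>R u + t *\<^sub>R v)) v"
proof -
  define f1 where "f1 = (\<lambda>y. frechet_derivative f (at y) u)"
  have d1: "(f has_derivative frechet_derivative f (at y)) (at y)" if "y \<in> S" for y
    using f that by (simp add: numeral_2_eq_2 frechet_derivative_works)
  have d2: "(f1 has_derivative frechet_derivative f1 (at y)) (at y)" if "y \<in> S" for y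
    using f that by (simp add: numeral_2_eq_2 frechet_derivative_works f1_def)
  have l1: "linear (frechet_derivative f (at y))" if "y \<in> S" for y
    using d1[OF that] has_derivative_linear by blast
  have l2: "linear (frechet_derivative f1 (at y))" if "y \<in> S" for y
    using d2[OF that] has_derivative_linear by blast
  have D1: "((\<lambda>s. f (x + s *\<^sub>R u + t *\<^sub>R v)) has_real_derivative f1 (x + s *\<^sub>R u + t *\<^sub>R v)) (at s)"
    if "s \<in> {0..1}" "t \<in> {0..1}" for s t
  proof -
    have "((\<lambda>s. x + s *\<^sub>R u + t *\<^sub>R v) has_derivative (\<lambda>h. h *\<^sub>R u)) (at s)"
      by (auto intro!: derivative_eq_intros)
    from has_derivative_compose[OF this d1[OF S[OF that]]] show ?thesis
      by (simp add: has_field_derivative_def f1_def linear_cmul[OF l1[OF S[OF that]]] mult_commute_abs)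
  qed
  have D2: "((\<lambda>t. f1 (x + s *\<^sub>R u + t *\<^sub>R v)) has_real_derivative
      frechet_derivative f1 (at (x + s *\<^sub>R u + t *\<^sub>R v)) v) (at t)"
    if "s \<in> {0..1}" "t \<in> {0..1}" for s t
  proof -
    have "((\<lambda>t. x + s *\<^sub>R u + t *\<^sub>R v) has_derivative (\<lambda>h. h *\<^sub>R v)) (at t)"
      by (auto intro!: derivative_eq_intros)
    from has_derivative_compose[OF this d2[OF S[OF that]]] show ?thesis
      by (simp add: has_field_derivative_def linear_cmul[OF l2[OF S[OF that]]] mult_commute_abs)
  qed
  obtain s where s: "0 < s" "s < 1"
    "f (x + u + v) - f (x + u) - (f (x + v) - f x) = f1 (x + s *\<^sub>R u + v) - f1 (x + s *\<^sub>R u)"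
    using MVT2[of 0 1 "\<lambda>s. f (x + s *\<^sub>R u + v) - f (x + s *\<^sub>R u)"
        "\<lambda>s. f1 (x + s *\<^sub>R u + v) - f1 (x + s *\<^sub>R u)"] DERIV_diff[OF D1[of _ 1] D1[of _ 0]]
    by auto
  obtain t where "0 < t" "t < 1"
    "f1 (x + s *\<^sub>R u + v) - f1 (x + s *\<^sub>R u) = frechet_derivative f1 (at (x + s *\<^sub>R u + t *\<^sub>R v)) v"
    using MVT2[of 0 1 "\<lambda>t. f1 (x + s *\<^sub>R u + t *\<^sub>R v)"
        "\<lambda>t. frechet_derivative f1 (at (x + s *\<^sub>R u + t *\<^sub>R v)) v"] D2[of s] s
    by auto
  with s show ?thesis
    by (intro that[of s t]) (auto simp: f1_def)
qed

lemma second_derivative_symmetric: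
  fixes f :: "'a::euclidean_space \<Rightarrow> real"
  assumes "open S" "x \<in> S" and f: "Ck_on 2 f S"
  shows "frechet_derivative (\<lambda>y. frechet_derivative f (at y) a) (at x) b =
    frechet_derivative (\<lambda>y. frechet_derivative f (at y) b) (at x) a"
proof -
  define D where "D = (\<lambda>u v y. frechet_derivative (\<lambda>y. frechet_derivative f (at y) u) (at y) v)"
  have cont: "continuous (at x) (D u v)" for u v
    using f assms(1,2) by (auto simp: D_def numeral_2_eq_2 continuous_on_eq_continuous_at)
  \<comment> \<open>Both mean values carry the same factor \<open>h * h\<close>, which later
    cancels.\<close>
  have hom: "D (h *\<^sub>R u) (h *\<^sub>R v) y = h * h * D u v y" if "y \<in> S" for h u v y
  proof -
    have l1: "linear (frechet_derivative f (at y))" if "y \<in> S" for y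
      using f that by (simp add: numeral_2_eq_2 linear_frechet_derivative)
    have "frechet_derivative (\<lambda>y. frechet_derivative f (at y) (h *\<^sub>R u)) (at y) =
        frechet_derivative (\<lambda>y. h * frechet_derivative f (at y) u) (at y)"
      by (rule frechet_derivative_cong_open[OF \<open>open S\<close> that]) (simp add: linear_cmul[OF l1])
    also have "\<dots> = (\<lambda>v. h * frechet_derivative (\<lambda>y. frechet_derivative f (at y) u) (at y) v)"
      by (rule frechet_derivative_at[symmetric])
        (use f that in \<open>auto simp: numeral_2_eq_2 frechet_derivative_works intro!: derivative_eq_intros\<close>)
    finally have "D (h *\<^sub>R u) (h *\<^sub>R v) y = h * D u (h *\<^sub>R v) y"
      by (simp add: D_def)
    moreover have "linear (\<lambda>v. D u v y)"
      unfolding D_def using f that by (simp add: numeral_2_eq_2 linear_frechet_derivative)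
    ultimately show ?thesis using linear_cmul[of "\<lambda>v. D u v y" h v] by simp
  qed
  have "\<bar>D a b x - D b a x\<bar> \<le> e" if "e > 0" for e
  proof -
    obtain d1 where d1: "d1 > 0" "\<And>y. dist y x < d1 \<Longrightarrow> dist (D a b y) (D a b x) < e/2"
      using cont[of a b] \<open>e > 0\<close> unfolding continuous_at_eps_delta by (auto dest: spec[of _ "e/2"])
    obtain d2 where d2: "d2 > 0" "\<And>y. dist y x < d2 \<Longrightarrow> dist (D b a y) (D b a x) < e/2"
      using cont[of b a] \<open>e > 0\<close> unfolding continuous_at_eps_delta by (auto dest: spec[of _ "e/2"])
    obtain d3 where d3: "d3 > 0" "ball x d3 \<subseteq> S"
      using assms(1,2) open_contains_ball by blast
    define d where "d = min d1 (min d2 d3)"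
    \<comment> \<open>Keeps the whole parallelogram spanned by \<open>h *\<^sub>R a\<close> and
      \<open>h *\<^sub>R b\<close> within distance \<open>d\<close> of \<open>x\<close>; the summand
      1 covers the case that both vectors vanish.\<close>
    define h where "h = d / (2 * (norm a + norm b + 1))"
    have "d > 0" using d1 d2 d3 by (simp add: d_def)
    have n: "norm a + norm b + 1 > 0" by (simp add: add_nonneg_pos)
    then have "h > 0" using \<open>d > 0\<close> by (simp add: h_def)
    have near: "dist (x + s *\<^sub>R h *\<^sub>R u + t *\<^sub>R h *\<^sub>R v) x < d"
      if "s \<in> {0..1}" "t \<in> {0..1}" "norm u + norm v = norm a + norm b" for s t u v
    proof -
      have "dist (x + s *\<^sub>R h *\<^sub>R u + t *\<^sub>R h *\<^sub>R v) x = norm (s *\<^sub>R h *\<^sub>R u + t *\<^sub>R h *\<^sub>R v)"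
        by (simp add: dist_norm algebra_simps)
      also have "\<dots> \<le> s * (h * norm u) + t * (h * norm v)"
        using norm_triangle_ineq[of "s *\<^sub>R h *\<^sub>R u" "t *\<^sub>R h *\<^sub>R v"] that \<open>h > 0\<close> by simp
      also have "\<dots> \<le> 1 * (h * norm u) + 1 * (h * norm v)"
        using that \<open>h > 0\<close> by (intro add_mono mult_right_mono) auto
      also have "\<dots> = h * (norm a + norm b)" unfolding that(3)[symmetric] by (simp add: algebra_simps)
      also have "\<dots> < h * (norm a + norm b + 1)" using \<open>h > 0\<close> by simp
      also have "\<dots> = d / 2"
      proof -
        have "d / (2 * c) * c = d / 2" if "c > 0" for c
          using that by simp
        from this[OF n] show ?thesis by (simp only: h_def)
      qed
      also have "\<dots> < d" using \<open>d > 0\<close> by simp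
      finally show ?thesis .
    qed
    have inS: "x + s *\<^sub>R h *\<^sub>R u + t *\<^sub>R h *\<^sub>R v \<in> S"
      if "s \<in> {0..1}" "t \<in> {0..1}" "norm u + norm v = norm a + norm b" for s t u v
      using near[OF that] d3 by (auto simp: d_def dist_commute)
    obtain s t where st: "s \<in> {0..1}" "t \<in> {0..1}"
      "f (x + h *\<^sub>R a + h *\<^sub>R b) - f (x + h *\<^sub>R a) - f (x + h *\<^sub>R b) + f x =
        D (h *\<^sub>R a) (h *\<^sub>R b) (x + s *\<^sub>R h *\<^sub>R a + t *\<^sub>R h *\<^sub>R b)"
      using second_difference_mvt[OF inS[of _ _ a b] f] unfolding D_def by auto
    obtain s' t' where st': "s' \<in> {0..1}" "t' \<in> {0..1}"
      "f (x + h *\<^sub>R b + h *\<^sub>R a) - f (x + h *\<^sub>R b) - f (x + h *\<^sub>R a) + f x =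
        D (h *\<^sub>R b) (h *\<^sub>R a) (x + s' *\<^sub>R h *\<^sub>R b + t' *\<^sub>R h *\<^sub>R a)"
      using second_difference_mvt[OF inS[of _ _ b a] f] unfolding D_def by auto
    have "h * h * D a b (x + s *\<^sub>R h *\<^sub>R a + t *\<^sub>R h *\<^sub>R b) = h * h * D b a (x + s' *\<^sub>R h *\<^sub>R b + t' *\<^sub>R h *\<^sub>R a)"
      using st st' inS[OF st(1,2), of a b] inS[OF st'(1,2), of b a] by (simp add: hom algebra_simps)
    then have "D a b (x + s *\<^sub>R h *\<^sub>R a + t *\<^sub>R h *\<^sub>R b) = D b a (x + s' *\<^sub>R h *\<^sub>R b + t' *\<^sub>R h *\<^sub>R a)"
      using \<open>h > 0\<close> by simp
    moreover have "dist (D a b (x + s *\<^sub>R h *\<^sub>R a + t *\<^sub>R h *\<^sub>R b)) (D a b x) < e/2"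
      using near[OF st(1,2), of a b] d1 by (auto simp: d_def)
    moreover have "dist (D b a (x + s' *\<^sub>R h *\<^sub>R b + t' *\<^sub>R h *\<^sub>R a)) (D b a x) < e/2"
      using near[OF st'(1,2), of b a] d2 by (auto simp: d_def)
    ultimately show ?thesis unfolding dist_real_def by linarith
  qed
  then have "\<bar>D a b x - D b a x\<bar> \<le> 0"
    using field_le_epsilon[of "\<bar>D a b x - D b a x\<bar>" 0] by simp
  then have "D a b x = D b a x" by simp
  then show ?thesis by (simp add: D_def)
qed

text \<open>Differentiation under the integral sign. The weight \<open>t ^ m\<close> makes the
  induction close, because the chain rule along the ray contributes one more factor
  \<open>t\<close>.\<close>

lemma Ck_on_integral_ray:
  fixes f :: "'a::euclidean_space \<Rightarrow> real"
  assumes "Ck_on k f (ball z0 r)"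
  shows "Ck_on k (\<lambda>z. integral {0..1} (\<lambda>t. t ^ m * f (z0 + t *\<^sub>R (z - z0)))) (ball z0 r)"
  using assms
proof (induction k arbitrary: f m)
  case (0 f)
  have ray: "z0 + t *\<^sub>R (z - z0) \<in> ball z0 r" if "z \<in> ball z0 r" "t \<in> {0..1}" for z t
    using that mult_left_le_one_le[of "norm (z - z0)" t] by (auto simp: dist_norm norm_minus_commute)
  have "continuous_on (ball z0 r \<times> {0..1}) (\<lambda>(z, t). t ^ m * f (z0 + t *\<^sub>R (z - z0)))"
    unfolding split_beta
    by (intro continuous_intros continuous_on_compose2[OF Ck_on_imp_continuous_on[OF 0]])
      (auto intro!: continuous_intros ray)
  then show ?case
    using integral_continuous_on_param[of "ball z0 r" 0 "1::real"] by simp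
next
  case (Suc k)
  have ray: "z0 + t *\<^sub>R (z - z0) \<in> ball z0 r" if "z \<in> ball z0 r" "t \<in> {0..1}" for z t
    using that mult_left_le_one_le[of "norm (z - z0)" t] by (auto simp: dist_norm norm_minus_commute)
  note cont = Ck_on_imp_continuous_on[OF Ck_on_Suc_imp[OF Suc.prems]]
  \<comment> \<open>\<open>leibniz_rule\<close> wants the derivative as a bounded linear map that
    depends continuously on its arguments; continuity is then checked on each vector
    separately.\<close>
  define f' where "f' = (\<lambda>y. Blinfun (frechet_derivative f (at y)))"
  have f': "blinfun_apply (f' y) = frechet_derivative f (at y)" if "y \<in> ball z0 r" for y
    unfolding f'_def
    by (rule bounded_linear_Blinfun_apply[OF has_derivative_bounded_linear[OF Ck_on_SucD[OF Suc.prems that]]])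
  have contf': "continuous_on (ball z0 r) f'"
  proof (rule continuous_on_blinfun_componentwise)
    fix i :: 'a
    have "continuous_on (ball z0 r) (\<lambda>y. frechet_derivative f (at y) i)"
      using Ck_on_imp_continuous_on[of k "\<lambda>y. frechet_derivative f (at y) i"] Suc.prems by simp
    then show "continuous_on (ball z0 r) (\<lambda>y. blinfun_apply (f' y) i)"
      by (rule continuous_on_eq) (simp add: f')
  qed
  define F' where "F' = (\<lambda>z t. t ^ (m + 1) *\<^sub>R f' (z0 + t *\<^sub>R (z - z0)))"
  have cont2: "continuous_on (ball z0 r \<times> {0..1}) (\<lambda>(z, t). F' z t)"
    unfolding split_beta F'_def
    by (intro continuous_intros continuous_on_compose2[OF contf'])
      (auto intro!: continuous_intros ray)
  have "((\<lambda>z. integral {0..1} (\<lambda>t. t ^ m * f (z0 + t *\<^sub>R (z - z0)))) has_derivative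
      integral {0..1} (F' z)) (at z)" if z: "z \<in> ball z0 r" for z
  proof -
    have "((\<lambda>z. integral (cbox 0 1) (\<lambda>t. t ^ m * f (z0 + t *\<^sub>R (z - z0)))) has_derivative
      integral (cbox 0 1) (F' z)) (at z within ball z0 r)"
    proof (rule leibniz_rule)
      fix z and t :: real assume zt: "z \<in> ball z0 r" "t \<in> cbox 0 1"
      have "((\<lambda>z. z0 + t *\<^sub>R (z - z0)) has_derivative (\<lambda>h. t *\<^sub>R h)) (at z within ball z0 r)"
        by (auto intro!: derivative_eq_intros)
      from has_derivative_compose[OF this Ck_on_SucD[OF Suc.prems ray]] zt
      have "((\<lambda>z. f (z0 + t *\<^sub>R (z - z0))) has_derivative
          (\<lambda>h. t *\<^sub>R f' (z0 + t *\<^sub>R (z - z0)) h)) (at z within ball z0 r)"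
        unfolding blinfun.scaleR_right[symmetric] by (subst f'[OF ray]) auto
      from has_derivative_mult_right[OF this, of "t ^ m"]
      show "((\<lambda>z. t ^ m * f (z0 + t *\<^sub>R (z - z0))) has_derivative blinfun_apply (F' z t))
          (at z within ball z0 r)"
        by (simp add: F'_def scaleR_blinfun.rep_eq algebra_simps)
    next
      fix z assume "z \<in> ball z0 r"
      then show "(\<lambda>t. t ^ m * f (z0 + t *\<^sub>R (z - z0))) integrable_on cbox 0 1"
        by (intro integrable_continuous continuous_intros continuous_on_compose2[OF cont])
          (auto intro!: continuous_intros ray)
    qed (use cont2 z in auto)
    then show ?thesis using z by (simp add: at_within_open[of z "ball z0 r"])
  qed
  moreover have "Ck_on k (\<lambda>z. blinfun_apply (integral {0..1} (F' z)) v) (ball z0 r)" for v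
  proof (rule Ck_on_cong)
    show "Ck_on k (\<lambda>z. integral {0..1} (\<lambda>t. t ^ (m + 1) * frechet_derivative f (at (z0 + t *\<^sub>R (z - z0))) v))
        (ball z0 r)"
      using Suc.prems by (intro Suc.IH) simp
    fix z assume z: "z \<in> ball z0 r"
    have "F' z integrable_on {0..1}"
      using z unfolding F'_def box_real(2)[symmetric]
      by (intro integrable_continuous continuous_intros continuous_on_compose2[OF contf'])
        (auto intro!: continuous_intros ray)
    then have "integral {0..1} (F' z) v = integral {0..1} (\<lambda>t. F' z t v)"
      by (rule blinfun_apply_integral)
    also have "\<dots> = integral {0..1} (\<lambda>t. t ^ (m + 1) * frechet_derivative f (at (z0 + t *\<^sub>R (z - z0))) v)"
      by (rule integral_cong) (simp add: F'_def scaleR_blinfun.rep_eq f'[OF ray[OF z]])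
    finally show "integral {0..1} (\<lambda>t. t ^ (m + 1) * frechet_derivative f (at (z0 + t *\<^sub>R (z - z0))) v) =
        integral {0..1} (F' z) v" by simp
  qed auto
  ultimately show ?case by (intro Ck_on_SucI) auto
qed

text \<open>The increment of \<open>f\<close> is the integral of its derivative along the segment
  from \<open>z0\<close> to \<open>z\<close>. The factor \<open>g b\<close> is the average of the
  partial derivative over that segment, hence smooth, and at \<open>z0\<close> it is the partial
  derivative itself.\<close>

lemma hadamard:
  fixes f :: "'a::euclidean_space \<Rightarrow> real"
  assumes "smooth_on (ball z0 r) f" "r > 0"
  obtains g where "\<And>b. b \<in> Basis \<Longrightarrow> smooth_on (ball z0 r) (g b)"
    "\<And>z. z \<in> ball z0 r \<Longrightarrow> f z = f z0 + (\<Sum>b\<in>Basis. ((z - z0) \<bullet> b) * g b z)"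
    "\<And>b. b \<in> Basis \<Longrightarrow> g b z0 = frechet_derivative f (at z0) b"
proof -
  \<comment> \<open>The factor \<open>t ^ 0\<close> only matches the shape of
    \<open>Ck_on_integral_ray\<close>.\<close>
  define g where "g = (\<lambda>b z. integral {0..1} (\<lambda>t. t ^ 0 * frechet_derivative f (at (z0 + t *\<^sub>R (z - z0))) b))"
  have ray: "z0 + t *\<^sub>R (z - z0) \<in> ball z0 r" if "z \<in> ball z0 r" "t \<in> {0..1}" for z t
    using that mult_left_le_one_le[of "norm (z - z0)" t] by (auto simp: dist_norm norm_minus_commute)
  have f': "smooth_on (ball z0 r) (\<lambda>z. frechet_derivative f (at z) b)" for b
    by (rule smooth_on_frechet_derivative[OF assms(1)])
  show ?thesis
  proof
    show "smooth_on (ball z0 r) (g b)" for b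
      unfolding smooth_on_def g_def
      by (intro allI Ck_on_integral_ray) (use f' in \<open>simp add: smooth_on_def\<close>)
    show "g b z0 = frechet_derivative f (at z0) b" for b
      by (simp add: g_def)
    fix z assume z: "z \<in> ball z0 r"
    have D: "((\<lambda>t. f (z0 + t *\<^sub>R (z - z0))) has_vector_derivative
        (\<Sum>b\<in>Basis. ((z - z0) \<bullet> b) * frechet_derivative f (at (z0 + t *\<^sub>R (z - z0))) b)) (at t within {0..1})"
      if t: "t \<in> {0..1}" for t
    proof -
      have "((\<lambda>t. z0 + t *\<^sub>R (z - z0)) has_derivative (\<lambda>h. h *\<^sub>R (z - z0))) (at t within {0..1})"
        by (auto intro!: derivative_eq_intros)
      from has_derivative_compose[OF this smooth_on_has_derivative[OF assms(1) ray[OF z t]]]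
      have 1: "((\<lambda>t. f (z0 + t *\<^sub>R (z - z0))) has_derivative
        (\<lambda>h. frechet_derivative f (at (z0 + t *\<^sub>R (z - z0))) (h *\<^sub>R (z - z0)))) (at t within {0..1})" .
      have lin: "linear (frechet_derivative f (at (z0 + t *\<^sub>R (z - z0))))"
        by (rule smooth_on_linear_frechet[OF assms(1) ray[OF z t]])
      have "frechet_derivative f (at (z0 + t *\<^sub>R (z - z0))) (z - z0) =
          (\<Sum>b\<in>Basis. ((z - z0) \<bullet> b) *\<^sub>R frechet_derivative f (at (z0 + t *\<^sub>R (z - z0))) b)"
        unfolding linear_cmul[OF lin, symmetric] linear_sum[OF lin, symmetric]
        by (simp add: euclidean_representation)
      then show ?thesis using 1
        by (simp add: has_vector_derivative_def linear_cmul[OF lin])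
    qed
    have int: "(\<lambda>t. frechet_derivative f (at (z0 + t *\<^sub>R (z - z0))) b) integrable_on {0..1}" for b
      unfolding box_real(2)[symmetric]
      by (intro integrable_continuous continuous_on_compose2[OF smooth_on_imp_continuous_on[OF f']])
        (use z in \<open>auto intro!: continuous_intros ray\<close>)
    have "((\<lambda>t. \<Sum>b\<in>Basis. ((z - z0) \<bullet> b) * frechet_derivative f (at (z0 + t *\<^sub>R (z - z0))) b)
        has_integral (f z - f z0)) {0..1}"
      using fundamental_theorem_of_calculus[OF _ D] by simp
    moreover have "((\<lambda>t. \<Sum>b\<in>Basis. ((z - z0) \<bullet> b) * frechet_derivative f (at (z0 + t *\<^sub>R (z - z0))) b)
        has_integral (\<Sum>b\<in>Basis. ((z - z0) \<bullet> b) * g b z)) {0..1}"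
      by (intro has_integral_sum has_integral_mult_right)
        (use int in \<open>auto simp: g_def intro: integrable_integral\<close>)
    ultimately have "f z - f z0 = (\<Sum>b\<in>Basis. ((z - z0) \<bullet> b) * g b z)"
      by (rule has_integral_unique)
    then show "f z = f z0 + (\<Sum>b\<in>Basis. ((z - z0) \<bullet> b) * g b z)"
      by simp
  qed
qed

subsection \<open>Total differential equations\<close>

lemma integral_norm_le_real:
  fixes f :: "real \<Rightarrow> 'x::banach"
  assumes "(f has_integral i) {0..1}" "\<And>t. t \<in> {0..1} \<Longrightarrow> norm (f t) \<le> b"
  shows "norm i \<le> b"
proof -
  have "0 \<le> b" by (rule order_trans[OF norm_ge_zero assms(2)[of 0]]) simp
  from has_integral_bound[OF this, of f i 0 1] show ?thesis using assms by auto
qed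

text \<open>The Picard iterates \<open>s\<^sub>n\<close> along rays have derivatives \<open>E\<^sub>n\<close>. The compatibility condition says
  that the defect \<open>E\<^sub>n - \<Lambda>(s\<^sub>n)\<close> contracts, so that the limit solves the full equation, with no
  recourse to differentiable dependence of ordinary differential equations on parameters.\<close>

locale picard_rays =
  fixes \<Lambda> :: "'e::euclidean_space \<Rightarrow> 'f::euclidean_space \<Rightarrow>\<^sub>L 'e"
    and D :: "'e \<Rightarrow> 'e \<Rightarrow>\<^sub>L 'f \<Rightarrow>\<^sub>L 'e"
    and z0 :: 'e and R C r :: real
  assumes der: "\<And>z. z \<in> cball z0 R \<Longrightarrow> (\<Lambda> has_derivative blinfun_apply (D z)) (at z)"
    and contD: "continuous_on (cball z0 R) D"
    and sym: "\<And>z v w. z \<in> cball z0 R \<Longrightarrow> D z (\<Lambda> z v) w = D z (\<Lambda> z w) v"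
    and bD: "\<And>z. z \<in> cball z0 R \<Longrightarrow> norm (D z) \<le> C"
    and b\<Lambda>: "\<And>z. z \<in> cball z0 R \<Longrightarrow> norm (\<Lambda> z) \<le> C"
    and R: "R > 0" and C: "C > 0" and r: "r > 0" and Cr8: "C * r \<le> 1 / 8" and CrR: "C * r \<le> R"
begin

abbreviation "B \<equiv> ball (0::'f) r"

text \<open>Along the ray through \<open>x\<close>, a solution of \<open>Ds = \<Lambda>(s)\<close>
  has derivative \<open>\<Lambda> (s (t *\<^sub>R x)) x\<close> in \<open>t\<close>. Integration
  over the unit interval gives this fixed-point equation.\<close>

definition picard :: "('f \<Rightarrow> 'e) \<Rightarrow> 'f \<Rightarrow> 'e" where
  "picard s x = z0 + integral {0..1} (\<lambda>t. \<Lambda> (s (t *\<^sub>R x)) x)"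

text \<open>The derivative in \<open>x\<close> of the integrand of \<open>picard\<close>, by the
  product and chain rules; the factor \<open>t\<close> comes from the inner argument
  \<open>t *\<^sub>R x\<close>.\<close>

definition integrand' :: "('f \<Rightarrow> 'e) \<Rightarrow> ('f \<Rightarrow> 'f \<Rightarrow>\<^sub>L 'e) \<Rightarrow> 'f \<Rightarrow> real \<Rightarrow> 'f \<Rightarrow>\<^sub>L 'e" where
  "integrand' s E x t = Blinfun (\<lambda>v. t *\<^sub>R D (s (t *\<^sub>R x)) (E (t *\<^sub>R x) v) x + \<Lambda> (s (t *\<^sub>R x)) v)"

definition picard' :: "('f \<Rightarrow> 'e) \<Rightarrow> ('f \<Rightarrow> 'f \<Rightarrow>\<^sub>L 'e) \<Rightarrow> 'f \<Rightarrow> 'f \<Rightarrow>\<^sub>L 'e" where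
  "picard' s E x = integral {0..1} (integrand' s E x)"

text \<open>Staying in the ball keeps \<open>\<Lambda>\<close> and \<open>D\<close> under control,
  and the continuity of the derivative \<open>E\<close> permits differentiation under the integral
  sign for the next iterate.\<close>

definition good :: "('f \<Rightarrow> 'e) \<Rightarrow> ('f \<Rightarrow> 'f \<Rightarrow>\<^sub>L 'e) \<Rightarrow> bool" where
  "good s E \<longleftrightarrow> (\<forall>x\<in>B. s x \<in> cball z0 R \<and> (s has_derivative blinfun_apply (E x)) (at x)) \<and>
    continuous_on B E"

lemma cont\<Lambda>: "continuous_on (cball z0 R) \<Lambda>"
  by (intro continuous_at_imp_continuous_on ballI has_derivative_continuous[OF der])

lemma \<Lambda>_lipschitz:
  assumes "a \<in> cball z0 R" "b \<in> cball z0 R"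
  shows "norm (\<Lambda> a - \<Lambda> b) \<le> C * norm (a - b)"
proof (rule differentiable_bound[of "cball z0 R" \<Lambda> "\<lambda>z. blinfun_apply (D z)"])
  show "(\<Lambda> has_derivative blinfun_apply (D x)) (at x within cball z0 R)" if "x \<in> cball z0 R" for x
    using der[OF that] by (rule has_derivative_at_withinI)
  show "onorm (blinfun_apply (D x)) \<le> C" if "x \<in> cball z0 R" for x
    using bD[OF that] by (simp add: norm_blinfun.rep_eq)
qed (use assms in auto)

lemma integrand'_apply:
  "integrand' s E x t v = t *\<^sub>R D (s (t *\<^sub>R x)) (E (t *\<^sub>R x) v) x + \<Lambda> (s (t *\<^sub>R x)) v"
proof -
  have "bounded_linear (\<lambda>v. t *\<^sub>R D (s (t *\<^sub>R x)) (E (t *\<^sub>R x) v) x + \<Lambda> (s (t *\<^sub>R x)) v)"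
    by (intro linear_conv_bounded_linear[THEN iffD1] linearI)
      (simp_all add: blinfun.add_right blinfun.add_left blinfun.scaleR_right blinfun.scaleR_left algebra_simps)
  then show ?thesis
    by (simp add: integrand'_def bounded_linear_Blinfun_apply)
qed

lemma rayB: "x \<in> B \<Longrightarrow> t \<in> {0..1} \<Longrightarrow> t *\<^sub>R x \<in> B"
  using mult_left_le_one_le[of "norm x" t] by auto

lemma good_cont: "good s E \<Longrightarrow> continuous_on B s"
  unfolding good_def
  by (intro continuous_at_imp_continuous_on ballI) (auto intro: has_derivative_continuous)

lemma cont_on_rays:
  assumes "good s E"
  shows "continuous_on (B \<times> {0..1}) (\<lambda>(x, t). integrand' s E x t)"
proof (rule continuous_on_blinfun_componentwise)
  fix i :: 'f
  have s: "continuous_on (B \<times> {0..1}) (\<lambda>p. s (snd p *\<^sub>R fst p))"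
    by (intro continuous_on_compose2[OF good_cont[OF assms]]) (auto intro!: continuous_intros rayB simp del: mem_ball mem_ball_0)
  have E: "continuous_on (B \<times> {0..1}) (\<lambda>p. E (snd p *\<^sub>R fst p))"
    by (rule continuous_on_compose2[of B E])
      (use assms in \<open>auto simp: good_def intro!: continuous_intros rayB simp del: mem_ball mem_ball_0\<close>)
  have "s (snd p *\<^sub>R fst p) \<in> cball z0 R" if "p \<in> B \<times> {0..1}" for p
    using assms rayB that unfolding good_def by auto
  then show "continuous_on (B \<times> {0..1}) (\<lambda>p. blinfun_apply (case p of (x, t) \<Rightarrow> integrand' s E x t) i)"
    unfolding split_beta integrand'_apply
    by (intro continuous_intros E continuous_on_compose2[OF contD s] continuous_on_compose2[OF cont\<Lambda> s]) auto
qed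

lemma cont_ray:
  assumes "good s E" "x \<in> B"
  shows "continuous_on {0..1} (\<lambda>t. s (t *\<^sub>R x))" "continuous_on {0..1} (\<lambda>t. \<Lambda> (s (t *\<^sub>R x)))"
    "continuous_on {0..1} (integrand' s E x)"
proof -
  show 1: "continuous_on {0..1} (\<lambda>t. s (t *\<^sub>R x))"
    by (intro continuous_on_compose2[OF good_cont[OF assms(1)]])
      (use assms(2) in \<open>auto intro!: continuous_intros rayB simp del: mem_ball mem_ball_0\<close>)
  show "continuous_on {0..1} (\<lambda>t. \<Lambda> (s (t *\<^sub>R x)))"
    by (intro continuous_on_compose2[OF cont\<Lambda> 1])
      (use assms rayB in \<open>auto simp: good_def simp del: mem_ball mem_ball_0 mem_cball\<close>)
  show "continuous_on {0..1} (integrand' s E x)"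
  proof -
    have "continuous_on {0..1} (Pair x :: real \<Rightarrow> _)" "Pair x ` {0..1::real} \<subseteq> B \<times> {0..1}"
      using assms(2) by (auto intro!: continuous_intros)
    from continuous_on_compose2[OF cont_on_rays[OF assms(1)] this] show ?thesis by simp
  qed
qed

lemma integrable_ray:
  assumes "good s E" "x \<in> B"
  shows "(\<lambda>t. \<Lambda> (s (t *\<^sub>R x)) x) integrable_on {0..1}" "integrand' s E x integrable_on {0..1}"
  using cont_ray[OF assms]
  by (auto intro!: integrable_continuous_real continuous_intros)

lemma ray_norm: "x \<in> B \<Longrightarrow> C * norm x \<le> C * r"
  using C by auto

lemma picard_has_derivative:
  assumes g: "good s E" and x: "x \<in> B"
  shows "(picard s has_derivative blinfun_apply (picard' s E x)) (at x)"
proof -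
  have "((\<lambda>x. integral (cbox 0 1) (\<lambda>t. \<Lambda> (s (t *\<^sub>R x)) x)) has_derivative
      integral (cbox 0 1) (integrand' s E x)) (at x within B)"
  proof (rule leibniz_rule)
    fix x and t :: real assume xt: "x \<in> B" "t \<in> cbox 0 1"
    then have tx: "t *\<^sub>R x \<in> B" by (intro rayB) auto
    have 0: "((\<lambda>x. t *\<^sub>R x) has_derivative (\<lambda>h. t *\<^sub>R h)) (at x)"
      by (auto intro!: derivative_eq_intros)
    have 1: "((\<lambda>x. s (t *\<^sub>R x)) has_derivative (\<lambda>h. E (t *\<^sub>R x) (t *\<^sub>R h))) (at x)"
      using has_derivative_compose[OF 0, of s "E (t *\<^sub>R x)"] g tx by (auto simp: good_def)
    have 2: "((\<lambda>x. \<Lambda> (s (t *\<^sub>R x))) has_derivative (\<lambda>h. D (s (t *\<^sub>R x)) (E (t *\<^sub>R x) (t *\<^sub>R h)))) (at x)"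
      using has_derivative_compose[OF 1 der] g tx by (auto simp: good_def)
    have "((\<lambda>x. \<Lambda> (s (t *\<^sub>R x)) x) has_derivative blinfun_apply (integrand' s E x t)) (at x)"
      by (rule has_derivative_eq_rhs[OF blinfun.FDERIV[OF 2 has_derivative_ident]])
        (auto simp: integrand'_apply fun_eq_iff blinfun.scaleR_right blinfun.scaleR_left)
    then show "((\<lambda>x. \<Lambda> (s (t *\<^sub>R x)) x) has_derivative blinfun_apply (integrand' s E x t)) (at x within B)"
      by (rule has_derivative_at_withinI)
  qed (use g x integrable_ray cont_on_rays in auto)
  then have "((\<lambda>x. integral {0..1} (\<lambda>t. \<Lambda> (s (t *\<^sub>R x)) x)) has_derivative picard' s E x) (at x)"
    using x by (simp add: at_within_open[of x B] picard'_def)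
  from has_derivative_add[OF has_derivative_const[of z0] this] show ?thesis
    by (simp add: picard_def[abs_def])
qed

text \<open>The iterate stays in the ball of radius \<open>R\<close> because the integral is bounded
  by \<open>C * norm x\<close>, and \<open>C * r \<le> R\<close>.\<close>

lemma good_picard:
  assumes g: "good s E"
  shows "good (picard s) (picard' s E)"
proof -
  have "picard s x \<in> cball z0 R" if x: "x \<in> B" for x
  proof -
    have "norm (integral {0..1} (\<lambda>t. \<Lambda> (s (t *\<^sub>R x)) x)) \<le> C * norm x"
    proof (rule integral_norm_le_real[OF integrable_integral[OF integrable_ray(1)[OF g x]]])
      fix t :: real assume "t \<in> {0..1}"
      then have "s (t *\<^sub>R x) \<in> cball z0 R" using g rayB[OF x] by (auto simp: good_def)
      then show "norm (\<Lambda> (s (t *\<^sub>R x)) x) \<le> C * norm x"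
        by (intro order_trans[OF norm_blinfun] mult_right_mono b\<Lambda>) auto
    qed
    then show ?thesis
      using ray_norm[OF x] CrR by (simp add: picard_def dist_norm)
  qed
  moreover have "continuous_on B (picard' s E)"
    unfolding picard'_def using integral_continuous_on_param[of B 0 "1::real" "integrand' s E"] cont_on_rays[OF g]
    by simp
  ultimately show ?thesis
    using picard_has_derivative[OF g] by (auto simp: good_def)
qed

text \<open>The factor 1/8 is the bound on \<open>C * r\<close>: Lipschitz constant of
  \<open>\<Lambda>\<close> times length of the ray.\<close>

lemma picard_contract:
  assumes g: "good s E" "good s' E'" and d: "\<And>x. x \<in> B \<Longrightarrow> norm (s x - s' x) \<le> d" and x: "x \<in> B"
  shows "norm (picard s x - picard s' x) \<le> d / 8"
proof -
  have "((\<lambda>t. \<Lambda> (s (t *\<^sub>R x)) x - \<Lambda> (s' (t *\<^sub>R x)) x) has_integral (picard s x - picard s' x)) {0..1}"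
    unfolding picard_def add_diff_cancel_left
    by (rule has_integral_diff[OF integrable_integral[OF integrable_ray(1)[OF g(1) x]]
        integrable_integral[OF integrable_ray(1)[OF g(2) x]]])
  then have "norm (picard s x - picard s' x) \<le> C * d * r"
  proof (rule integral_norm_le_real)
    fix t :: real assume t: "t \<in> {0..1}"
    have in_ball: "s (t *\<^sub>R x) \<in> cball z0 R" "s' (t *\<^sub>R x) \<in> cball z0 R"
      using g rayB[OF x t] by (auto simp: good_def)
    have d0: "0 \<le> d" using order_trans[OF norm_ge_zero d[OF x]] .
    have "norm (\<Lambda> (s (t *\<^sub>R x)) x - \<Lambda> (s' (t *\<^sub>R x)) x) \<le> norm (\<Lambda> (s (t *\<^sub>R x)) - \<Lambda> (s' (t *\<^sub>R x))) * norm x"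
      using norm_blinfun[of "\<Lambda> (s (t *\<^sub>R x)) - \<Lambda> (s' (t *\<^sub>R x))" x] by (simp add: blinfun.diff_left)
    also have "\<dots> \<le> (C * d) * r"
    proof (intro mult_mono)
      show "norm (\<Lambda> (s (t *\<^sub>R x)) - \<Lambda> (s' (t *\<^sub>R x))) \<le> C * d"
        using \<Lambda>_lipschitz[OF in_ball] d[OF rayB[OF x t]] C
        by (meson less_imp_le mult_left_mono order_trans)
    qed (use x C d0 in auto)
    finally show "norm (\<Lambda> (s (t *\<^sub>R x)) x - \<Lambda> (s' (t *\<^sub>R x)) x) \<le> C * d * r" .
  qed
  also have "\<dots> = C * r * d" by simp
  also have "\<dots> \<le> 1/8 * d"
    using Cr8 order_trans[OF norm_ge_zero d[OF x]] by (intro mult_right_mono) auto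
  finally show ?thesis by simp
qed

text \<open>The value \<open>\<Lambda> (s x) v\<close> is the integral over [0,1] of the
  \<open>t\<close>-derivative of \<open>t *\<^sub>R \<Lambda> (s (t *\<^sub>R x)) v\<close>, so it
  can be compared with \<open>picard'\<close> under one integral. By \<open>sym\<close> only the
  defect of \<open>E\<close> survives there, in two terms of size at most
  \<open>C * r * e * norm v\<close> each, which explains 2/8 = 1/4. The old \<open>s\<close> still
  stands inside \<open>\<Lambda>\<close>; passing to the next iterate is left to
  \<open>iter_defect\<close>.\<close>

lemma defect_contract:
  assumes g: "good s E" and e: "\<And>x. x \<in> B \<Longrightarrow> norm (E x - \<Lambda> (s x)) \<le> e" and x: "x \<in> B"
  shows "norm (picard' s E x - \<Lambda> (s x)) \<le> e / 4"
proof (rule norm_blinfun_bound)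
  have e0: "0 \<le> e" using order_trans[OF norm_ge_zero e[OF x]] .
  then show "0 \<le> e / 4" by simp
  fix v
  have "((\<lambda>t. t *\<^sub>R \<Lambda> (s (t *\<^sub>R x)) v) has_vector_derivative
      \<Lambda> (s (t *\<^sub>R x)) v + t *\<^sub>R D (s (t *\<^sub>R x)) (E (t *\<^sub>R x) x) v) (at t within {0..1})"
    if t: "t \<in> {0..1}" for t
  proof -
    have 0: "((\<lambda>t. t *\<^sub>R x) has_derivative (\<lambda>h. h *\<^sub>R x)) (at t)"
      by (auto intro!: derivative_eq_intros)
    have 1: "((\<lambda>t. s (t *\<^sub>R x)) has_derivative (\<lambda>h. E (t *\<^sub>R x) (h *\<^sub>R x))) (at t)"
      using has_derivative_compose[OF 0, of s "E (t *\<^sub>R x)"] g rayB[OF x t] by (auto simp: good_def)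
    have 2: "((\<lambda>t. \<Lambda> (s (t *\<^sub>R x))) has_derivative (\<lambda>h. D (s (t *\<^sub>R x)) (E (t *\<^sub>R x) (h *\<^sub>R x)))) (at t)"
      using has_derivative_compose[OF 1 der] g rayB[OF x t] by (auto simp: good_def)
    have "((\<lambda>t. t *\<^sub>R \<Lambda> (s (t *\<^sub>R x)) v) has_derivative
        (\<lambda>h. h *\<^sub>R (\<Lambda> (s (t *\<^sub>R x)) v + t *\<^sub>R D (s (t *\<^sub>R x)) (E (t *\<^sub>R x) x) v))) (at t)"
      by (rule has_derivative_eq_rhs[OF has_derivative_scaleR[OF has_derivative_ident
              blinfun.FDERIV[OF 2 has_derivative_const]]])
        (auto simp: fun_eq_iff blinfun.scaleR_right blinfun.scaleR_left algebra_simps blinfun.zero_right)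
    then show ?thesis
      unfolding has_vector_derivative_def by (rule has_derivative_at_withinI)
  qed
  from fundamental_theorem_of_calculus[OF zero_le_one this]
  have I1: "((\<lambda>t. \<Lambda> (s (t *\<^sub>R x)) v + t *\<^sub>R D (s (t *\<^sub>R x)) (E (t *\<^sub>R x) x) v) has_integral \<Lambda> (s x) v) {0..1}"
    by simp
  have I2: "((\<lambda>t. integrand' s E x t v) has_integral picard' s E x v) {0..1}"
    using has_integral_linear[OF integrable_integral[OF integrable_ray(2)[OF g x]]
        blinfun.bounded_linear_left[of v]]
    by (simp only: picard'_def o_def)
  have "norm (picard' s E x v - \<Lambda> (s x) v) \<le> 2 * (C * r) * e * norm v"
  proof (rule integral_norm_le_real[OF has_integral_diff[OF I2 I1]])
    fix t :: real assume t: "t \<in> {0..1}"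
    define y where "y = s (t *\<^sub>R x)"
    define \<delta> where "\<delta> = E (t *\<^sub>R x) - \<Lambda> y"
    have y: "y \<in> cball z0 R" using g rayB[OF x t] by (auto simp: good_def y_def)
    have E: "E (t *\<^sub>R x) w = \<Lambda> y w + \<delta> w" for w
      by (simp add: \<delta>_def blinfun.diff_left)
    have \<delta>: "norm \<delta> \<le> e" using e[OF rayB[OF x t]] by (simp add: \<delta>_def y_def)
    have bound: "norm (D y (\<delta> a) b) \<le> C * e * norm a * norm b" for a b
    proof -
      have "norm (D y (\<delta> a) b) \<le> norm (D y (\<delta> a)) * norm b" by (rule norm_blinfun)
      also have "\<dots> \<le> (C * (e * norm a)) * norm b"
        using \<delta> bD[OF y] C e0
        by (intro mult_right_mono order_trans[OF norm_blinfun] mult_mono) (auto intro!: mult_right_mono order_trans[OF norm_blinfun])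
      finally show ?thesis by (simp add: algebra_simps)
    qed
    \<comment> \<open>After \<open>E = \<Lambda> y + \<delta>\<close>, the compatibility condition
      cancels the two terms in which \<open>D\<close> is applied to values of
      \<open>\<Lambda>\<close>.\<close>
    have "integrand' s E x t v - (\<Lambda> (s (t *\<^sub>R x)) v + t *\<^sub>R D (s (t *\<^sub>R x)) (E (t *\<^sub>R x) x) v)
        = t *\<^sub>R (D y (\<delta> v) x - D y (\<delta> x) v)"
      unfolding integrand'_apply y_def[symmetric] E
      using sym[OF y, of v x] by (simp add: blinfun.add_right blinfun.add_left algebra_simps)
    also have "norm \<dots> \<le> 1 * (norm (D y (\<delta> v) x) + norm (D y (\<delta> x) v))"
      unfolding norm_scaleR using t by (intro mult_mono norm_triangle_ineq4) auto
    also have "\<dots> \<le> 2 * (C * norm x) * e * norm v"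
      using bound[of v x] bound[of x v] by (simp add: algebra_simps)
    also have "\<dots> \<le> 2 * (C * r) * e * norm v"
      using mult_right_mono[OF ray_norm[OF x], of "2 * e * norm v"] e0 by (simp add: mult_ac)
    finally show "norm (integrand' s E x t v - (\<Lambda> (s (t *\<^sub>R x)) v + t *\<^sub>R D (s (t *\<^sub>R x)) (E (t *\<^sub>R x) x) v))
      \<le> 2 * (C * r) * e * norm v" .
  qed
  also have "\<dots> \<le> 2 * (1/8) * e * norm v"
    using mult_right_mono[OF Cr8, of "2 * e * norm v"] e0 by (simp add: mult_ac)
  finally show "norm (blinfun_apply (picard' s E x - \<Lambda> (s x)) v) \<le> e / 4 * norm v"
    by (simp add: blinfun.diff_left)
qed

primrec iter :: "nat \<Rightarrow> ('f \<Rightarrow> 'e) \<times> ('f \<Rightarrow> 'f \<Rightarrow>\<^sub>L 'e)" where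
  "iter 0 = (\<lambda>x. z0, \<lambda>x. 0)"
| "iter (Suc n) = (picard (fst (iter n)), picard' (fst (iter n)) (snd (iter n)))"

abbreviation "S n \<equiv> fst (iter n)"
abbreviation "E n \<equiv> snd (iter n)"

lemma good_iter: "good (S n) (E n)"
proof (induction n)
  case 0
  then show ?case using R by (auto simp: good_def zero_blinfun.rep_eq)
next
  case (Suc n)
  then show ?case by (simp add: good_picard)
qed

lemma iter_step: "x \<in> B \<Longrightarrow> norm (S (Suc n) x - S n x) \<le> R * (1/8) ^ n"
proof (induction n arbitrary: x)
  case 0
  then show ?case
    using good_iter[of 1] by (auto simp: good_def dist_norm norm_minus_commute)
next
  case (Suc n)
  show ?case
    using picard_contract[OF good_iter good_iter Suc.IH Suc.prems] by simp
qed

text \<open>With \<open>A = 4 * C * R + C\<close>, the base case needs \<open>C \<le> A\<close>. The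
  step needs \<open>A / 4 + C * R \<le> A / 2\<close>, where \<open>A / 4\<close> comes from
  \<open>defect_contract\<close> and \<open>C * R\<close> from the change of the iterate. The ratio
  1/2 is slow enough to absorb both.\<close>

lemma iter_defect: "x \<in> B \<Longrightarrow> norm (E n x - \<Lambda> (S n x)) \<le> (4 * C * R + C) * (1/2) ^ n"
proof (induction n arbitrary: x)
  case 0
  have "0 \<le> 4 * C * R" using C R by simp
  with 0 show ?case using b\<Lambda>[of z0] R by simp
next
  case (Suc n)
  define A where "A = 4 * C * R + C"
  define P where "P = picard' (S n) (E n) x"
  have "norm (E (Suc n) x - \<Lambda> (S (Suc n) x)) = norm ((P - \<Lambda> (S n x)) + (\<Lambda> (S n x) - \<Lambda> (S (Suc n) x)))"
    by (simp add: P_def)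
  also have "\<dots> \<le> norm (P - \<Lambda> (S n x)) + norm (\<Lambda> (S n x) - \<Lambda> (S (Suc n) x))"
    by (rule norm_triangle_ineq)
  also have "\<dots> \<le> A * (1/2) ^ n / 4 + C * (R * (1/8) ^ n)"
  proof (rule add_mono)
    show "norm (P - \<Lambda> (S n x)) \<le> A * (1/2) ^ n / 4"
      unfolding P_def by (rule defect_contract[OF good_iter _ Suc.prems]) (use Suc.IH in \<open>simp only: A_def\<close>)
    have "norm (\<Lambda> (S n x) - \<Lambda> (S (Suc n) x)) \<le> C * norm (S n x - S (Suc n) x)"
      using good_iter[of n] good_iter[of "Suc n"] Suc.prems
      by (intro \<Lambda>_lipschitz) (auto simp: good_def simp del: iter.simps)
    also have "\<dots> \<le> C * (R * (1/8) ^ n)"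
      using iter_step[OF Suc.prems, of n] C by (intro mult_left_mono) (simp_all only: norm_minus_commute less_imp_le)
    finally show "norm (\<Lambda> (S n x) - \<Lambda> (S (Suc n) x)) \<le> C * (R * (1/8) ^ n)" .
  qed
  also have "C * (R * (1/8) ^ n) \<le> C * (R * (1/2) ^ n)"
    using C R by (intro mult_left_mono power_mono) auto
  also have "C * (R * (1/2) ^ n) \<le> A / 4 * (1/2) ^ n"
    using C by (simp add: A_def field_simps)
  finally show ?case by (simp add: A_def mult_ac)
qed

text \<open>The iterates converge uniformly, and since the defect tends to 0 uniformly, their
  derivatives converge uniformly to \<open>\<Lambda> (s x)\<close>. Hence the limit may be
  differentiated term by term.\<close>

lemma picard_solution:
  obtains s where "s 0 = z0" "\<And>x. x \<in> B \<Longrightarrow> s x \<in> cball z0 R"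
    "\<And>x. x \<in> B \<Longrightarrow> (s has_derivative blinfun_apply (\<Lambda> (s x))) (at x)"
proof -
  \<comment> \<open>The limit is written as a telescoping series so that the Weierstrass test
    applies to the bounds of \<open>iter_step\<close>.\<close>
  define s where "s = (\<lambda>x. suminf (\<lambda>i. S (Suc i) x - S i x) + z0)"
  have tele: "(\<Sum>i<n. S (Suc i) x - S i x) + z0 = S n x" for n x
    by (subst sum_lessThan_telescope) simp
  have "uniform_limit B (\<lambda>n x. \<Sum>i<n. S (Suc i) x - S i x) (\<lambda>x. suminf (\<lambda>i. S (Suc i) x - S i x)) sequentially"
    by (rule Weierstrass_m_test[OF iter_step]) (auto intro!: summable_mult summable_geometric)
  then have "uniform_limit B (\<lambda>n x. (\<Sum>i<n. S (Suc i) x - S i x) + z0) s sequentially"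
    unfolding s_def by (rule uniform_limit_add) (rule uniform_limit_const)
  then have ul: "uniform_limit B S s sequentially"
    by (simp only: tele)
  have lim: "(\<lambda>n. S n x) \<longlonglongrightarrow> s x" if "x \<in> B" for x
    by (rule tendsto_uniform_limitI[OF ul that])
  have sR: "s x \<in> cball z0 R" if "x \<in> B" for x
    by (rule Lim_in_closed_set[OF closed_cball _ _ lim[OF that]])
      (use good_iter that in \<open>auto simp: good_def\<close>)
  have "\<exists>g. \<forall>x\<in>B. (\<lambda>n. S n x) \<longlonglongrightarrow> g x \<and> (g has_derivative blinfun_apply (\<Lambda> (s x))) (at x within B)"
  proof (rule has_derivative_sequence[where f' = "\<lambda>n x. blinfun_apply (E n x)"])
    show "(S n has_derivative blinfun_apply (E n x)) (at x within B)" if "x \<in> B" for n x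
      using good_iter[of n] that by (auto simp: good_def intro: has_derivative_at_withinI)
    fix e :: real assume "e > 0"
    define A where "A = 4 * C * R + C"
    have "((\<lambda>n. A * (1/2) ^ n) \<longlonglongrightarrow> A * 0)"
      by (intro tendsto_mult_left LIMSEQ_power_zero) auto
    then have "\<forall>\<^sub>F n in sequentially. A * (1/2) ^ n < e / 2"
      using \<open>e > 0\<close> by (intro order_tendstoD(2)) auto
    moreover have "\<forall>\<^sub>F n in sequentially. \<forall>x\<in>B. dist (S n x) (s x) < e / (2 * C)"
      using ul \<open>e > 0\<close> C by (intro uniform_limitD) auto
    ultimately show "\<forall>\<^sub>F n in sequentially. \<forall>x\<in>B. \<forall>h. norm (E n x h - \<Lambda> (s x) h) \<le> e * norm h"
    proof eventually_elim
      case (elim n)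
      show ?case
      proof (intro ballI allI)
        fix x h assume x: "x \<in> B"
        have "norm (E n x - \<Lambda> (s x)) \<le> norm (E n x - \<Lambda> (S n x)) + norm (\<Lambda> (S n x) - \<Lambda> (s x))"
          using norm_triangle_ineq[of "E n x - \<Lambda> (S n x)" "\<Lambda> (S n x) - \<Lambda> (s x)"] by simp
        also have "\<dots> \<le> e / 2 + C * (e / (2 * C))"
        proof (rule add_mono)
          show "norm (E n x - \<Lambda> (S n x)) \<le> e / 2"
            using iter_defect[OF x, of n] elim(1) by (simp add: A_def)
          have "norm (\<Lambda> (S n x) - \<Lambda> (s x)) \<le> C * norm (S n x - s x)"
            using good_iter[of n] x sR[OF x] by (intro \<Lambda>_lipschitz) (auto simp: good_def)
          also have "\<dots> \<le> C * (e / (2 * C))"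
            using elim(2) x C by (intro mult_left_mono) (auto simp: dist_norm less_imp_le)
          finally show "norm (\<Lambda> (S n x) - \<Lambda> (s x)) \<le> C * (e / (2 * C))" .
        qed
        also have "\<dots> = e" using C by simp
        finally have "norm (E n x - \<Lambda> (s x)) \<le> e" .
        then show "norm (E n x h - \<Lambda> (s x) h) \<le> e * norm h"
          unfolding blinfun.diff_left[symmetric]
          by (intro order_trans[OF norm_blinfun] mult_right_mono) auto
      qed
    qed
  qed (use r lim[of 0] in auto)
  then obtain g where g: "\<And>x. x \<in> B \<Longrightarrow> (\<lambda>n. S n x) \<longlonglongrightarrow> g x"
    "\<And>x. x \<in> B \<Longrightarrow> (g has_derivative blinfun_apply (\<Lambda> (s x))) (at x within B)" by blast
  have gs: "g x = s x" if "x \<in> B" for x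
    using LIMSEQ_unique[OF g(1)[OF that] lim[OF that]] .
  have "S n 0 = z0" for n
    by (cases n) (simp_all add: picard_def blinfun.zero_right)
  then have "s 0 = z0"
    using lim[of 0] r by (simp add: LIMSEQ_const_iff)
  moreover have "(s has_derivative blinfun_apply (\<Lambda> (s x))) (at x)" if x: "x \<in> B" for x
    using has_derivative_transform_within_open[of g _ x UNIV B s] g(2)[OF x] gs x
    by (auto simp: at_within_open[of x B])
  ultimately show ?thesis using sR that by blast
qed

end

lemma total_differential_equation:
  fixes \<Lambda> :: "'e::euclidean_space \<Rightarrow> 'f::euclidean_space \<Rightarrow>\<^sub>L 'e"
  assumes "open S" "z0 \<in> S"
    and der: "\<And>z. z \<in> S \<Longrightarrow> (\<Lambda> has_derivative blinfun_apply (D z)) (at z)"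
    and cont: "continuous_on S D"
    and sym: "\<And>z v w. z \<in> S \<Longrightarrow> D z (\<Lambda> z v) w = D z (\<Lambda> z w) v"
  obtains s r where "r > 0" "s 0 = z0" "\<And>x. x \<in> ball 0 r \<Longrightarrow> s x \<in> S"
    "\<And>x. x \<in> ball 0 r \<Longrightarrow> (s has_derivative blinfun_apply (\<Lambda> (s x))) (at x)"
proof -
  obtain R where R: "R > 0" "cball z0 R \<subseteq> S"
    using assms(1,2) open_contains_cball by blast
  have "continuous_on (cball z0 R) \<Lambda>"
    using R(2) by (intro continuous_at_imp_continuous_on ballI has_derivative_continuous[OF der]) auto
  then have "bounded (D ` cball z0 R)" "bounded (\<Lambda> ` cball z0 R)"
    using continuous_on_subset[OF cont R(2)]
    by (auto intro!: compact_imp_bounded compact_continuous_image)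
  then obtain C1 C2 where C12: "\<And>z. z \<in> cball z0 R \<Longrightarrow> norm (D z) \<le> C1"
    "\<And>z. z \<in> cball z0 R \<Longrightarrow> norm (\<Lambda> z) \<le> C2"
    unfolding bounded_iff by blast
  \<comment> \<open>The entry 1 makes \<open>C\<close> positive. With \<open>r\<close> as below,
    \<open>C * r\<close> is one eighth of \<open>min 1 R\<close>, which meets both smallness
    conditions of \<open>picard_rays\<close>.\<close>
  define C where "C = max 1 (max C1 C2)"
  define r where "r = min 1 R / (8 * C)"
  have C: "C > 0" by (simp add: C_def)
  then have r: "r > 0" "C * r = min 1 R / 8" using R by (auto simp: r_def)
  note R_sub = R(2) and r_pos = r(1)
  interpret picard_rays \<Lambda> D z0 R C r
  proof
    show "norm (D z) \<le> C" "norm (\<Lambda> z) \<le> C" if "z \<in> cball z0 R" for z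
      using C12[OF that] by (auto simp: C_def)
    show "C * r \<le> 1 / 8" "C * r \<le> R" using r R by auto
    show "continuous_on (cball z0 R) D" by (rule continuous_on_subset[OF cont R(2)])
    show "(\<Lambda> has_derivative blinfun_apply (D z)) (at z)" if "z \<in> cball z0 R" for z
      using R(2) that by (intro der) auto
    show "D z (\<Lambda> z v) w = D z (\<Lambda> z w) v" if "z \<in> cball z0 R" for z v w
      using R(2) that by (intro sym) auto
  qed (fact R(1) C r(1))+
  obtain s where "s 0 = z0" "\<And>x. x \<in> B \<Longrightarrow> s x \<in> cball z0 R"
    "\<And>x. x \<in> B \<Longrightarrow> (s has_derivative blinfun_apply (\<Lambda> (s x))) (at x)"
    by (rule picard_solution) blast
  then show ?thesis
    using R_sub by (intro that[OF r_pos, of s]) auto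
qed

section \<open>Local analysis on a manifold\<close>

lemma sum_fun_apply: "(\<Sum>i\<in>I. v i) x = (\<Sum>i\<in>I. v i x)"
  by (induction I rule: infinite_finite_induct) auto

lemma scaleR_fun_apply: "(c *\<^sub>R f) x = c *\<^sub>R f x"
  by (simp add: scaleR_fun_def)

definition smooth_functions_on :: "('a::topological_space, 'e::euclidean_space) chart set \<Rightarrow> 'a set \<Rightarrow> ('a \<Rightarrow> real) set"
  where "smooth_functions_on A W = {f. \<forall>(U, \<phi>)\<in>A. smooth_on (\<phi> ` (U \<inter> W)) (f \<circ> inv_into U \<phi>)}"

lemma smooth_functions_eq: "smooth_functions A = smooth_functions_on A UNIV"
  by (simp add: smooth_functions_def smooth_functions_on_def)

text \<open>The image of \<open>w\<close> under the differential of the inverse chart, that is, the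
  coordinate vector with components of \<open>w\<close>. The value 0 on non-smooth functions follows
  the convention of \<open>tangent_space\<close>.\<close>

definition chart_vector :: "('a, 'e::euclidean_space) chart set \<Rightarrow> 'a set \<Rightarrow> ('a \<Rightarrow> 'e) \<Rightarrow> 'a \<Rightarrow> 'e \<Rightarrow> 'a tvec"
  where "chart_vector A U \<phi> p w = (\<lambda>f. if f \<in> smooth_functions A
    then frechet_derivative (f \<circ> inv_into U \<phi>) (at (\<phi> p)) w else 0)"

text \<open>Only the base point is restricted to \<open>W\<close>: the vectors still act on globally
  smooth functions, and values outside \<open>W\<close> are arbitrary.\<close>

definition vector_fields_on :: "('a::topological_space, 'e::euclidean_space) chart set \<Rightarrow> 'a set \<Rightarrow> 'a vfield set"
  where "vector_fields_on A W = {X. (\<forall>p\<in>W. X p \<in> tangent_space A p) \<and>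
     (\<forall>f\<in>smooth_functions A. (\<lambda>p. X p f) \<in> smooth_functions_on A W)}"

lemma vector_fields_eq: "vector_fields A = vector_fields_on A UNIV"
  by (simp add: vector_fields_def vector_fields_on_def smooth_functions_eq)

section \<open>Smooth functions, tangent vectors and vector fields on open subsets of a
  manifold\<close>

locale manifold =
  fixes A :: "('a::{t2_space, second_countable_topology}, 'e::euclidean_space) chart set"
  assumes smooth: "smooth_manifold A"
begin

abbreviation "SF \<equiv> smooth_functions A"
abbreviation "SFon \<equiv> smooth_functions_on A"
abbreviation "T \<equiv> tangent_space A"

context
  fixes U \<phi> assumes chart: "(U, \<phi>) \<in> A"
begin

lemma chart_homeo: "homeomorphism U (\<phi> ` U) \<phi> (inv_into U \<phi>)"
  and chart_open: "open U" and chart_open_image: "open (\<phi> ` U)"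
  using smooth chart unfolding smooth_manifold_def is_chart_def by fastforce+

lemma chart_inv: "p \<in> U \<Longrightarrow> inv_into U \<phi> (\<phi> p) = p"
  using chart_homeo unfolding homeomorphism_def by auto

lemma chart_inv_in: "z \<in> \<phi> ` (U \<inter> W) \<Longrightarrow> inv_into U \<phi> z \<in> U \<inter> W"
  and chart_inv_right: "z \<in> \<phi> ` (U \<inter> W) \<Longrightarrow> \<phi> (inv_into U \<phi> z) = z"
  using chart_inv by auto

lemma chart_image_open: "open W \<Longrightarrow> open (\<phi> ` (U \<inter> W))"
  using homeomorphism_imp_open_map[OF chart_homeo, of "U \<inter> W"] chart_open_image
  by (auto simp: openin_open_Int openin_open_eq)

lemma chart_inv_cont: "continuous_on (\<phi> ` U) (inv_into U \<phi>)"
  using chart_homeo unfolding homeomorphism_def by auto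

lemma chart_preimage_open: "open Z \<Longrightarrow> Z \<subseteq> \<phi> ` U \<Longrightarrow> open (inv_into U \<phi> ` Z)"
  using homeomorphism_imp_open_map[OF homeomorphism_symD[OF chart_homeo], of Z] chart_open
  by (auto simp: openin_open_eq chart_open_image)

end

lemma chart_transition: "(U, \<phi>) \<in> A \<Longrightarrow> (V, \<psi>) \<in> A \<Longrightarrow> smooth_on (\<phi> ` (U \<inter> V)) (\<psi> \<circ> inv_into U \<phi>)"
  using smooth unfolding smooth_manifold_def by fast

lemma chart_exists: obtains U \<phi> where "(U, \<phi>) \<in> A" "p \<in> U"
proof -
  have "p \<in> (\<Union>c\<in>A. fst c)" using smooth unfolding smooth_manifold_def by simp
  then show ?thesis using that by force
qed

lemma SFonD: "f \<in> SFon W \<Longrightarrow> (U, \<phi>) \<in> A \<Longrightarrow> smooth_on (\<phi> ` (U \<inter> W)) (f \<circ> inv_into U \<phi>)"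
  unfolding smooth_functions_on_def by auto

lemma SFonI: "(\<And>U \<phi>. (U, \<phi>) \<in> A \<Longrightarrow> smooth_on (\<phi> ` (U \<inter> W)) (f \<circ> inv_into U \<phi>)) \<Longrightarrow> f \<in> SFon W"
  unfolding smooth_functions_on_def by auto

lemma SFon_subset: "f \<in> SFon W \<Longrightarrow> W' \<subseteq> W \<Longrightarrow> f \<in> SFon W'"
  by (rule SFonI, rule smooth_on_subset[OF SFonD]) auto

lemma SF_imp_SFon: "f \<in> SF \<Longrightarrow> f \<in> SFon W"
  unfolding smooth_functions_eq by (erule SFon_subset) simp

lemma SFon_cong: "open W \<Longrightarrow> (\<And>q. q \<in> W \<Longrightarrow> f q = h q) \<Longrightarrow> f \<in> SFon W \<Longrightarrow> h \<in> SFon W"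
  by (rule SFonI, rule smooth_on_cong[OF chart_image_open _ SFonD]) (use chart_inv_in in auto)

lemma SFon_Union:
  assumes "\<And>i. i \<in> I \<Longrightarrow> open (W i)" "\<And>i. i \<in> I \<Longrightarrow> f \<in> SFon (W i)"
  shows "f \<in> SFon (\<Union>i\<in>I. W i)"
proof (rule SFonI)
  fix U \<phi> assume c: "(U, \<phi>) \<in> A"
  have "smooth_on (\<Union>i\<in>I. \<phi> ` (U \<inter> W i)) (f \<circ> inv_into U \<phi>)"
    by (intro smooth_on_Union chart_image_open[OF c] SFonD[OF _ c] assms)
  then show "smooth_on (\<phi> ` (U \<inter> (\<Union>i\<in>I. W i))) (f \<circ> inv_into U \<phi>)"
    by (simp only: image_UN Int_UN_distrib)
qed

lemma SFon_local:
  assumes "\<And>p. p \<in> W \<Longrightarrow> \<exists>W'. open W' \<and> p \<in> W' \<and> W' \<subseteq> W \<and> f \<in> SFon W'"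
  shows "f \<in> SFon W"
proof -
  obtain N where N: "\<And>p. p \<in> W \<Longrightarrow> open (N p) \<and> p \<in> N p \<and> N p \<subseteq> W \<and> f \<in> SFon (N p)"
    using assms by metis
  then have "f \<in> SFon (\<Union>p\<in>W. N p)" by (intro SFon_Union) auto
  moreover have "(\<Union>p\<in>W. N p) = W" using N by auto
  ultimately show ?thesis by simp
qed

lemma SFon_const: "open W \<Longrightarrow> (\<lambda>q. c) \<in> SFon W"
  by (rule SFonI) (simp add: o_def smooth_on_const chart_image_open)

lemma SFon_add:
  assumes "open W" "f \<in> SFon W" "h \<in> SFon W"
  shows "(\<lambda>q. f q + h q) \<in> SFon W"
proof (rule SFonI)
  fix U \<phi> assume c: "(U, \<phi>) \<in> A"
  from smooth_on_add[OF chart_image_open[OF c assms(1)] SFonD[OF assms(2) c] SFonD[OF assms(3) c]]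
  show "smooth_on (\<phi> ` (U \<inter> W)) ((\<lambda>q. f q + h q) \<circ> inv_into U \<phi>)"
    by (simp add: o_def)
qed

lemma SFon_mult:
  assumes "open W" "f \<in> SFon W" "h \<in> SFon W"
  shows "(\<lambda>q. f q * h q) \<in> SFon W"
proof (rule SFonI)
  fix U \<phi> assume c: "(U, \<phi>) \<in> A"
  from smooth_on_bilinear[OF bounded_bilinear_mult chart_image_open[OF c assms(1)] SFonD[OF assms(2) c] SFonD[OF assms(3) c]]
  show "smooth_on (\<phi> ` (U \<inter> W)) ((\<lambda>q. f q * h q) \<circ> inv_into U \<phi>)"
    by (simp add: o_def)
qed

lemma SFon_diff: "open W \<Longrightarrow> f \<in> SFon W \<Longrightarrow> h \<in> SFon W \<Longrightarrow> (\<lambda>q. f q - h q) \<in> SFon W"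
  using SFon_add[of W f "\<lambda>q. -1 * h q"] SFon_mult[OF _ SFon_const[of W "-1"], of h] by simp

lemma SFon_sum:
  assumes "open W" "finite I" "\<And>i. i \<in> I \<Longrightarrow> f i \<in> SFon W"
  shows "(\<lambda>q. \<Sum>i\<in>I. f i q) \<in> SFon W"
  using assms(2,3) by (induction I rule: finite_induct) (auto intro: SFon_const SFon_add assms(1))

lemma SFon_divide:
  assumes "open W" "f \<in> SFon W" "h \<in> SFon W" "\<And>q. q \<in> W \<Longrightarrow> h q \<noteq> 0"
  shows "(\<lambda>q. f q / h q) \<in> SFon W"
proof -
  have "(\<lambda>q. inverse (h q)) \<in> SFon W"
  proof (rule SFonI)
    fix U \<phi> assume c: "(U, \<phi>) \<in> A"
    have "smooth_on (\<phi> ` (U \<inter> W)) (\<lambda>z. inverse ((h \<circ> inv_into U \<phi>) z))"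
      by (intro smooth_on_inverse chart_image_open[OF c assms(1)] SFonD[OF assms(3) c])
        (use assms(4) chart_inv_in[OF c] in auto)
    then show "smooth_on (\<phi> ` (U \<inter> W)) ((\<lambda>q. inverse (h q)) \<circ> inv_into U \<phi>)"
      by (simp add: o_def)
  qed
  from SFon_mult[OF assms(1,2) this] show ?thesis by (simp add: field_class.field_divide_inverse)
qed

lemmas SF_const = SFon_const[OF open_UNIV, folded smooth_functions_eq]
  and SF_add = SFon_add[OF open_UNIV, folded smooth_functions_eq]
  and SF_mult = SFon_mult[OF open_UNIV, folded smooth_functions_eq]
  and SF_diff = SFon_diff[OF open_UNIV, folded smooth_functions_eq]
  and SF_sum = SFon_sum[OF open_UNIV, folded smooth_functions_eq]

lemma SF_chartD: "f \<in> SF \<Longrightarrow> (U, \<phi>) \<in> A \<Longrightarrow> smooth_on (\<phi> ` U) (f \<circ> inv_into U \<phi>)"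
  unfolding smooth_functions_def by auto

text \<open>One chart around \<open>W\<close> suffices, because the transition maps to all other
  charts are smooth.\<close>

lemma SFon_chartI:
  assumes c: "(U, \<phi>) \<in> A" and W: "open W" "W \<subseteq> U" and s: "smooth_on (\<phi> ` W) (f \<circ> inv_into U \<phi>)"
  shows "f \<in> SFon W"
proof (rule SFonI)
  fix V \<psi> assume c': "(V, \<psi>) \<in> A"
  have UW: "U \<inter> W = W" using W by auto
  have op: "open (\<psi> ` (V \<inter> W))" "open (\<phi> ` W)"
    using chart_image_open[OF c' W(1)] chart_image_open[OF c W(1)] UW by auto
  have "smooth_on (\<psi> ` (V \<inter> W)) (\<lambda>z. (f \<circ> inv_into U \<phi>) ((\<phi> \<circ> inv_into V \<psi>) z))"
  proof (rule smooth_on_compose[OF op _ s])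
    show "(\<phi> \<circ> inv_into V \<psi>) ` \<psi> ` (V \<inter> W) \<subseteq> \<phi> ` W"
      using chart_inv[OF c'] by auto
    show "smooth_on (\<psi> ` (V \<inter> W)) (\<phi> \<circ> inv_into V \<psi>)"
      by (rule smooth_on_subset[OF chart_transition[OF c' c]]) (use W in auto)
  qed
  then show "smooth_on (\<psi> ` (V \<inter> W)) (f \<circ> inv_into V \<psi>)"
    by (rule smooth_on_cong[OF op(1), rotated])
      (use chart_inv[OF c'] chart_inv[OF c] W in \<open>auto simp: subset_iff\<close>)
qed

lemma smooth_on_chart_coord:
  assumes c: "(U, \<phi>) \<in> A" and "open Z" "\<phi> ` U \<subseteq> Z" "smooth_on Z f"
  shows "(\<lambda>q. f (\<phi> q)) \<in> SFon U"
proof (rule SFon_chartI[OF c chart_open[OF c] order_refl])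
  show "smooth_on (\<phi> ` U) ((\<lambda>q. f (\<phi> q)) \<circ> inv_into U \<phi>)"
    by (rule smooth_on_cong[OF chart_open_image[OF c] _ smooth_on_subset[OF assms(4,3)]])
      (use chart_inv[OF c] in auto)
qed


subsection \<open>Cut-off and extension\<close>

text \<open>Vanishing outside a closed \<open>K\<close> within \<open>W\<close>, and not merely
  outside \<open>W\<close>, makes an extension by zero smooth: it is smooth on \<open>W\<close> and
  on the complement of \<open>K\<close>, and these open sets cover the manifold.\<close>

definition cutoff :: "'a \<Rightarrow> 'a set \<Rightarrow> ('a \<Rightarrow> real) \<Rightarrow> 'a set \<Rightarrow> bool" where
  "cutoff p W \<eta> W' \<longleftrightarrow> \<eta> \<in> SF \<and> open W' \<and> p \<in> W' \<and> W' \<subseteq> W \<and> (\<forall>q\<in>W'. \<eta> q = 1) \<and>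
    (\<exists>K. closed K \<and> K \<subseteq> W \<and> (\<forall>q. q \<notin> K \<longrightarrow> \<eta> q = 0))"

lemma cutoff_exists:
  assumes "open W" "p \<in> W"
  obtains \<eta> W' where "cutoff p W \<eta> W'"
proof -
  obtain U \<phi> where c: "(U, \<phi>) \<in> A" and p: "p \<in> U" by (rule chart_exists)
  have "\<phi> p \<in> \<phi> ` (U \<inter> W)" using p assms by auto
  then obtain R where R: "R > 0" "cball (\<phi> p) R \<subseteq> \<phi> ` (U \<inter> W)"
    using chart_image_open[OF c assms(1)] open_contains_cball by blast
  obtain \<beta> where \<beta>: "smooth_on UNIV \<beta>" "\<And>x. x \<in> ball (\<phi> p) (R/2) \<Longrightarrow> \<beta> x = 1"
    "\<And>x. x \<notin> ball (\<phi> p) R \<Longrightarrow> \<beta> x = (0::real)"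
    using smooth_bump[of "R/2" R] R by auto
  define \<eta> where "\<eta> q = (if q \<in> U then \<beta> (\<phi> q) else 0)" for q
  define K where "K = inv_into U \<phi> ` cball (\<phi> p) R"
  define W' where "W' = inv_into U \<phi> ` ball (\<phi> p) (R/2)"
  have sub: "cball (\<phi> p) R \<subseteq> \<phi> ` U" using R(2) by auto
  \<comment> \<open>Closedness of \<open>K\<close> in the whole manifold comes from compactness and
    the Hausdorff property; a closed ball in the chart alone would not give it.\<close>
  have "compact K"
    unfolding K_def by (rule compact_continuous_image[OF continuous_on_subset[OF chart_inv_cont[OF c] sub]]) simp
  then have K: "closed K" by (rule compact_imp_closed)
  have KW: "K \<subseteq> U \<inter> W" 
    unfolding K_def by (intro image_subsetI chart_inv_in[OF c] subsetD[OF R(2)])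
  have out: "\<eta> q = 0" if "q \<notin> K" for q
  proof (cases "q \<in> U")
    case True
    have "\<phi> q \<notin> cball (\<phi> p) R"
    proof
      assume "\<phi> q \<in> cball (\<phi> p) R"
      then have "inv_into U \<phi> (\<phi> q) \<in> K" unfolding K_def by (rule imageI)
      then show False using that chart_inv[OF c True] by simp
    qed
    then show ?thesis using \<beta>(3)[of "\<phi> q"] by (simp add: \<eta>_def)
  qed (simp add: \<eta>_def)
  have "\<eta> \<in> SFon U"
    by (rule SFon_cong[OF chart_open[OF c] _ smooth_on_chart_coord[OF c open_UNIV _ \<beta>(1)]])
      (auto simp: \<eta>_def)
  moreover have "\<eta> \<in> SFon (- K)"
    by (rule SFon_cong[OF _ _ SFon_const[of _ 0]]) (use K out in auto)
  ultimately have "\<eta> \<in> SFon (\<Union>i\<in>{U, - K}. i)"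
    using chart_open[OF c] K by (intro SFon_Union) auto
  moreover have "(\<Union>i\<in>{U, - K}. i) = UNIV" using KW by auto
  ultimately have "\<eta> \<in> SF" by (simp add: smooth_functions_eq)
  moreover have "open W'"
    unfolding W'_def using sub R(1) by (intro chart_preimage_open[OF c]) auto
  moreover have "p \<in> W'" unfolding W'_def
    using R(1) by (intro image_eqI[where x = "\<phi> p"]) (auto simp: chart_inv[OF c p])
  moreover have "W' \<subseteq> K" unfolding W'_def K_def using R(1) by (intro image_mono) auto
  moreover have "\<eta> q = 1" if q: "q \<in> W'" for q
  proof -
    obtain z where z: "z \<in> ball (\<phi> p) (R/2)" "q = inv_into U \<phi> z" using q unfolding W'_def by blast
    then have "z \<in> \<phi> ` (U \<inter> UNIV)" using sub R(1) by auto
    from chart_inv_in[OF c this] chart_inv_right[OF c this] have "q \<in> U" "\<phi> q = z"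
      by (simp_all add: z(2))
    then show ?thesis using \<beta>(2) z(1) by (simp add: \<eta>_def)
  qed
  ultimately have "cutoff p W \<eta> W'"
    unfolding cutoff_def using K KW out by blast
  then show ?thesis by (rule that)
qed

lemma cutoff_extend:
  assumes "cutoff p W \<eta> W'" "open W" "f \<in> SFon W"
  shows "(\<lambda>q. if q \<in> W then \<eta> q * f q else 0) \<in> SF"
proof -
  obtain K where K: "closed K" "K \<subseteq> W" "\<And>q. q \<notin> K \<Longrightarrow> \<eta> q = 0"
    using assms(1) unfolding cutoff_def by blast
  have "\<eta> \<in> SFon W" using assms(1) SF_imp_SFon unfolding cutoff_def by blast
  from SFon_mult[OF assms(2) this assms(3)] have "(\<lambda>q. if q \<in> W then \<eta> q * f q else 0) \<in> SFon W"
    by (rule SFon_cong[OF assms(2), rotated]) auto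
  moreover have "(\<lambda>q. if q \<in> W then \<eta> q * f q else 0) \<in> SFon (- K)"
    by (rule SFon_cong[OF _ _ SFon_const[of _ 0]]) (use K in auto)
  ultimately have "(\<lambda>q. if q \<in> W then \<eta> q * f q else 0) \<in> SFon (\<Union>i\<in>{W, - K}. i)"
    using assms(2) K(1) by (intro SFon_Union) auto
  moreover have "(\<Union>i\<in>{W, - K}. i) = UNIV" using K(2) by auto
  ultimately show ?thesis by (simp add: smooth_functions_eq)
qed

subsection \<open>Tangent vectors\<close>

context
  fixes v p assumes v: "v \<in> T p"
begin

lemma tangent_add: "f \<in> SF \<Longrightarrow> h \<in> SF \<Longrightarrow> v (\<lambda>q. f q + h q) = v f + v h"
  using v unfolding tangent_space_def plus_fun_def by blast

lemma tangent_cmult: "f \<in> SF \<Longrightarrow> v (\<lambda>q. c * f q) = c * v f"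
  using v unfolding tangent_space_def scaleR_fun_def real_scaleR_def by blast

lemma tangent_mult: "f \<in> SF \<Longrightarrow> h \<in> SF \<Longrightarrow> v (\<lambda>q. f q * h q) = v f * h p + f p * v h"
  using v unfolding tangent_space_def times_fun_def by blast

lemma tangent_outside: "f \<notin> SF \<Longrightarrow> v f = 0"
  using v unfolding tangent_space_def by blast

lemma tangent_const: "v (\<lambda>q. c) = 0"
proof -
  have "v (\<lambda>q. 1 * 1) = v (\<lambda>q. 1) * 1 + 1 * v (\<lambda>q. 1)"
    by (rule tangent_mult) (rule SF_const)+
  then have "v (\<lambda>q. 1) = 0" by simp
  then show ?thesis using tangent_cmult[OF SF_const[of 1], of c] by simp
qed

lemma tangent_diff: "f \<in> SF \<Longrightarrow> h \<in> SF \<Longrightarrow> v (\<lambda>q. f q - h q) = v f - v h"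
  using tangent_add[of f "\<lambda>q. -1 * h q"] tangent_cmult[of h "-1"] SF_mult[OF SF_const, of h "-1"] by simp

lemma tangent_sum:
  "finite I \<Longrightarrow> (\<And>i. i \<in> I \<Longrightarrow> f i \<in> SF) \<Longrightarrow> v (\<lambda>q. \<Sum>i\<in>I. f i q) = (\<Sum>i\<in>I. v (f i))"
  by (induction I rule: finite_induct) (auto simp: tangent_const tangent_add SF_sum)

text \<open>If \<open>\<eta>\<close> is a cut-off at \<open>p\<close>, then
  \<open>(f - h) * \<eta>\<close> vanishes identically. The Leibniz rule at \<open>p\<close>, with
  \<open>f p = h p\<close> and \<open>\<eta> p = 1\<close>, turns this into
  \<open>v f - v h = 0\<close>.\<close>

lemma tangent_local:
  assumes "f \<in> SF" "h \<in> SF" "open W" "p \<in> W" "\<And>q. q \<in> W \<Longrightarrow> f q = h q"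
  shows "v f = v h"
proof -
  obtain \<eta> W' where c: "cutoff p W \<eta> W'" using cutoff_exists assms by blast
  have \<eta>: "\<eta> \<in> SF" "\<eta> p = 1" using c unfolding cutoff_def by auto
  have "(f q - h q) * \<eta> q = 0" for q
    using c assms(5)[of q] unfolding cutoff_def by (cases "q \<in> W") auto
  then have "(\<lambda>q. (f q - h q) * \<eta> q) = (\<lambda>q. 0)" by (rule ext)
  then have "v (\<lambda>q. (f q - h q) * \<eta> q) = 0" using tangent_const[of 0] by simp
  then show ?thesis
    using tangent_mult[OF SF_diff[OF assms(1,2)] \<eta>(1)] assms(4,5) \<eta>(2) tangent_diff[OF assms(1,2)]
    by simp
qed

end

lemma tangentI:
  assumes "\<And>f h. f \<in> SF \<Longrightarrow> h \<in> SF \<Longrightarrow> v (\<lambda>q. f q + h q) = v f + v h"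
    "\<And>c f. f \<in> SF \<Longrightarrow> v (\<lambda>q. c * f q) = c * v f"
    "\<And>f h. f \<in> SF \<Longrightarrow> h \<in> SF \<Longrightarrow> v (\<lambda>q. f q * h q) = v f * h p + f p * v h"
    "\<And>f. f \<notin> SF \<Longrightarrow> v f = 0"
  shows "v \<in> T p"
  using assms unfolding tangent_space_def plus_fun_def times_fun_def scaleR_fun_def real_scaleR_def
  by blast

lemma tangent_space_add: "v \<in> T p \<Longrightarrow> w \<in> T p \<Longrightarrow> v + w \<in> T p"
  by (rule tangentI) (simp_all add: tangent_add tangent_cmult tangent_mult tangent_outside algebra_simps)

lemma tangent_space_scaleR: "v \<in> T p \<Longrightarrow> c *\<^sub>R v \<in> T p"
  by (rule tangentI) (simp_all add: tangent_add tangent_cmult tangent_mult tangent_outside scaleR_fun_def algebra_simps)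

lemma tangent_space_0: "0 \<in> T p"
  by (rule tangentI) simp_all

lemma tangent_space_diff: "v \<in> T p \<Longrightarrow> w \<in> T p \<Longrightarrow> v - w \<in> T p"
  using tangent_space_add[OF _ tangent_space_scaleR[of w p "-1"], of v] by simp

lemma tangent_space_sum: "(\<And>i. i \<in> I \<Longrightarrow> v i \<in> T p) \<Longrightarrow> (\<Sum>i\<in>I. v i) \<in> T p"
  by (induction I rule: infinite_finite_induct) (auto intro: tangent_space_0 tangent_space_add)

context
  fixes U \<phi> assumes c: "(U, \<phi>) \<in> A"
begin

lemma SF_chart_derivative:
  assumes "f \<in> SF" "p \<in> U"
  shows "(f \<circ> inv_into U \<phi> has_derivative frechet_derivative (f \<circ> inv_into U \<phi>) (at (\<phi> p))) (at (\<phi> p))"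
  by (rule smooth_on_has_derivative[OF SF_chartD[OF assms(1) c]]) (use assms in auto)

lemma chart_vector_tangent:
  assumes p: "p \<in> U"
  shows "chart_vector A U \<phi> p w \<in> T p"
proof (rule tangentI)
  note D = SF_chart_derivative[OF _ p]
  fix f assume f: "f \<in> SF"
  show "chart_vector A U \<phi> p w (\<lambda>q. k * f q) = k * chart_vector A U \<phi> p w f" for k
    using fun_cong[OF frechet_derivative_at[OF has_derivative_mult_right[OF D[OF f], of k]], of w]
      f SF_mult[OF SF_const f, of k]
    by (simp add: chart_vector_def o_def)
  fix h assume h: "h \<in> SF"
  show "chart_vector A U \<phi> p w (\<lambda>q. f q + h q) = chart_vector A U \<phi> p w f + chart_vector A U \<phi> p w h"
    using fun_cong[OF frechet_derivative_at[OF has_derivative_add[OF D[OF f] D[OF h]]], of w]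
      f h SF_add[OF f h]
    by (simp add: chart_vector_def o_def)
  show "chart_vector A U \<phi> p w (\<lambda>q. f q * h q) = chart_vector A U \<phi> p w f * h p + f p * chart_vector A U \<phi> p w h"
    using fun_cong[OF frechet_derivative_at[OF has_derivative_mult[OF D[OF f] D[OF h]]], of w]
      f h SF_mult[OF f h]
    by (simp add: chart_vector_def o_def chart_inv[OF c p])
qed (simp add: chart_vector_def)

lemma linear_chart_vector: "p \<in> U \<Longrightarrow> linear (chart_vector A U \<phi> p)"
proof (rule linearI)
  fix w w' k assume p: "p \<in> U"
  have lin: "f \<in> SF \<Longrightarrow> linear (frechet_derivative (f \<circ> inv_into U \<phi>) (at (\<phi> p)))" for f
    using SF_chart_derivative[OF _ p] has_derivative_linear by blast
  show "chart_vector A U \<phi> p (w + w') = chart_vector A U \<phi> p w + chart_vector A U \<phi> p w'"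
    by (rule ext) (simp add: chart_vector_def linear_add[OF lin])
  show "chart_vector A U \<phi> p (k *\<^sub>R w) = k *\<^sub>R chart_vector A U \<phi> p w"
    by (rule ext) (simp add: chart_vector_def scaleR_fun_def linear_cmul[OF lin])
qed

lemma chart_vector_field: "(\<lambda>q. chart_vector A U \<phi> q w) \<in> vector_fields_on A U"
  unfolding vector_fields_on_def
proof (intro CollectI conjI ballI)
  fix f assume f: "f \<in> SF"
  show "(\<lambda>q. chart_vector A U \<phi> q w f) \<in> SFon U"
    using f smooth_on_chart_coord[OF c chart_open_image[OF c] order_refl
        smooth_on_frechet_derivative[OF SF_chartD[OF f c]]]
    by (simp add: chart_vector_def)
qed (rule chart_vector_tangent)

text \<open>Derivations cannot be applied to \<open>\<phi>\<close>, which is significant only on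
  \<open>U\<close>; these global functions replace the coordinates near \<open>p\<close>.\<close>

lemma chart_coordinates:
  assumes p: "p \<in> U"
  obtains x W where "open W" "p \<in> W" "W \<subseteq> U" "\<And>b. x b \<in> SF" "\<And>b q. q \<in> W \<Longrightarrow> x b q = \<phi> q \<bullet> b"
proof -
  obtain \<eta> W where \<eta>: "cutoff p U \<eta> W" using cutoff_exists[OF chart_open[OF c] p] by blast
  have "(\<lambda>q. \<phi> q \<bullet> b) \<in> SFon U" for b
    by (rule smooth_on_chart_coord[OF c open_UNIV subset_UNIV
          smooth_on_bounded_linear[OF open_UNIV bounded_linear_inner_left]])
  then have "(\<lambda>q. if q \<in> U then \<eta> q * (\<phi> q \<bullet> b) else 0) \<in> SF" for b
    by (rule cutoff_extend[OF \<eta> chart_open[OF c]])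
  then show ?thesis
    by (intro that[of W "\<lambda>b q. if q \<in> U then \<eta> q * (\<phi> q \<bullet> b) else 0"])
      (use \<eta> in \<open>auto simp: cutoff_def subset_iff\<close>)
qed

text \<open>Near \<open>p\<close>, Hadamard's lemma writes \<open>f\<close> as \<open>f p\<close>
  plus the sum of \<open>(x b - x b p) * G b\<close>. The Leibniz rule leaves only
  \<open>v (x b) * G b p\<close>, and \<open>G b p\<close> is the partial derivative of
  \<open>f\<close>. So a derivation is determined by its values on coordinates.\<close>

lemma tangent_chart_expansion:
  assumes p: "p \<in> W" "open W" "W \<subseteq> U" and v: "v \<in> T p"
    and x: "\<And>b. b \<in> Basis \<Longrightarrow> x b \<in> SF" "\<And>b q. b \<in> Basis \<Longrightarrow> q \<in> W \<Longrightarrow> x b q = \<phi> q \<bullet> b"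
  shows "v = chart_vector A U \<phi> p (\<Sum>b\<in>Basis. v (x b) *\<^sub>R b)"
proof
  fix f
  have pU: "p \<in> U" using p by auto
  show "v f = chart_vector A U \<phi> p (\<Sum>b\<in>Basis. v (x b) *\<^sub>R b) f"
  proof (cases "f \<in> SF")
    case f: True
    have "\<phi> p \<in> \<phi> ` (U \<inter> W)" using p by auto
    then obtain r where r: "r > 0" "ball (\<phi> p) r \<subseteq> \<phi> ` (U \<inter> W)"
      using chart_image_open[OF c p(2)] open_contains_ball by blast
    have sub: "ball (\<phi> p) r \<subseteq> \<phi> ` U" using r by auto
    define W1 where "W1 = inv_into U \<phi> ` ball (\<phi> p) r"
    have \<phi>inv: "\<phi> (inv_into U \<phi> z) = z" "inv_into U \<phi> z \<in> U" "inv_into U \<phi> z \<in> W"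
      if "z \<in> ball (\<phi> p) r" for z
      using chart_inv_in[OF c subsetD[OF r(2) that]] chart_inv_right[OF c subsetD[OF r(2) that]] by auto
    have W1: "open W1" "W1 \<subseteq> W" "p \<in> W1"
      unfolding W1_def using \<phi>inv r(1) chart_inv[OF c pU]
      by (auto intro!: chart_preimage_open[OF c open_ball sub] image_eqI[where x = "\<phi> p"] simp del: mem_ball simp: centre_in_ball)
    have \<phi>W1: "\<phi> ` W1 = ball (\<phi> p) r"
      unfolding W1_def image_image using \<phi>inv(1) by (simp del: mem_ball cong: image_cong)
    obtain g where g: "\<And>b. b \<in> Basis \<Longrightarrow> smooth_on (ball (\<phi> p) r) (g b)"
      "\<And>z. z \<in> ball (\<phi> p) r \<Longrightarrow> (f \<circ> inv_into U \<phi>) z = (f \<circ> inv_into U \<phi>) (\<phi> p) +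
        (\<Sum>b\<in>Basis. ((z - \<phi> p) \<bullet> b) * g b z)"
      "\<And>b. b \<in> Basis \<Longrightarrow> g b (\<phi> p) = frechet_derivative (f \<circ> inv_into U \<phi>) (at (\<phi> p)) b"
      by (rule hadamard[OF smooth_on_subset[OF SF_chartD[OF f c] sub] r(1)]) blast
    have gSF: "(\<lambda>q. g b (\<phi> q)) \<in> SFon W1" if "b \<in> Basis" for b
    proof (rule SFon_chartI[OF c W1(1)])
      show "smooth_on (\<phi> ` W1) ((\<lambda>q. g b (\<phi> q)) \<circ> inv_into U \<phi>)"
        unfolding \<phi>W1 by (rule smooth_on_cong[OF open_ball _ g(1)[OF that]])
          (use \<phi>inv in \<open>auto simp del: mem_ball\<close>)
    qed (use W1 p in auto)
    obtain \<eta> W2 where \<eta>: "cutoff p W1 \<eta> W2" using cutoff_exists[OF W1(1,3)] by blast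
    \<comment> \<open>The Hadamard factors exist only on the coordinate ball; their cut-offs are
      global and leave the expansion intact on \<open>W2\<close>.\<close>
    define G where "G b q = (if q \<in> W1 then \<eta> q * g b (\<phi> q) else 0)" for b q
    have G: "G b \<in> SF" if "b \<in> Basis" for b
      using cutoff_extend[OF \<eta> W1(1) gSF[OF that]] by (simp add: G_def[abs_def])
    have W2: "open W2" "p \<in> W2" "W2 \<subseteq> W1" "\<And>q. q \<in> W2 \<Longrightarrow> \<eta> q = 1"
      using \<eta> unfolding cutoff_def by auto
    define h where "h = (\<lambda>q. f p + (\<Sum>b\<in>Basis. (x b q - x b p) * G b q))"
    have summand: "(\<lambda>q. (x b q - x b p) * G b q) \<in> SF" if "b \<in> Basis" for b
      by (intro SF_mult SF_diff SF_const G x that)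
    have "v f = v h"
    proof (rule tangent_local[OF v f _ W2(1,2)])
      show "h \<in> SF" unfolding h_def by (intro SF_add SF_const SF_sum summand) auto
      fix q assume q: "q \<in> W2"
      then have qW: "q \<in> W1" "q \<in> W" "q \<in> U" using W2(3) W1(2) p(3) by auto
      then have \<phi>q: "\<phi> q \<in> ball (\<phi> p) r" unfolding \<phi>W1[symmetric] by blast
      show "f q = h q"
        using g(2)[OF \<phi>q] x(2) qW p(1) W2(4)[OF q]
        by (simp add: h_def G_def chart_inv[OF c] pU inner_diff_left)
    qed
    also have "v h = v (\<lambda>q. f p) + v (\<lambda>q. \<Sum>b\<in>Basis. (x b q - x b p) * G b q)"
      unfolding h_def by (intro tangent_add[OF v] SF_const SF_sum summand) auto
    also have "\<dots> = (\<Sum>b\<in>Basis. v (\<lambda>q. (x b q - x b p) * G b q))"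
      using summand by (simp add: tangent_const[OF v] tangent_sum[OF v])
    also have "\<dots> = (\<Sum>b\<in>Basis. v (x b) * frechet_derivative (f \<circ> inv_into U \<phi>) (at (\<phi> p)) b)"
    proof (rule sum.cong[OF refl])
      fix b :: 'e assume b: "b \<in> Basis"
      have "v (\<lambda>q. (x b q - x b p) * G b q) = v (\<lambda>q. x b q - x b p) * G b p + (x b p - x b p) * v (G b)"
        by (intro tangent_mult[OF v] SF_diff SF_const G x b)
      also have "v (\<lambda>q. x b q - x b p) = v (x b)"
        using tangent_diff[OF v x(1)[OF b] SF_const] tangent_const[OF v] by simp
      also have "G b p = frechet_derivative (f \<circ> inv_into U \<phi>) (at (\<phi> p)) b"
        using W2 W1 g(3)[OF b] by (simp add: G_def)
      finally show "v (\<lambda>q. (x b q - x b p) * G b q) = v (x b) * frechet_derivative (f \<circ> inv_into U \<phi>) (at (\<phi> p)) b"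
        by simp
    qed
    also have "\<dots> = frechet_derivative (f \<circ> inv_into U \<phi>) (at (\<phi> p)) (\<Sum>b\<in>Basis. v (x b) *\<^sub>R b)"
      using has_derivative_linear[OF SF_chart_derivative[OF f pU]]
      by (simp add: linear_sum linear_cmul)
    finally show ?thesis using f by (simp add: chart_vector_def)
  qed (simp add: tangent_outside[OF v] chart_vector_def)
qed

end

lemma chart_vector_coordinate:
  assumes c: "(U, \<phi>) \<in> A" and p: "p \<in> W" "open W" "W \<subseteq> U" and "x \<in> SF" "\<And>q. q \<in> W \<Longrightarrow> x q = \<phi> q \<bullet> b"
  shows "chart_vector A U \<phi> p w x = w \<bullet> b"
proof -
  have UW: "U \<inter> W = W" using p by auto
  have "frechet_derivative (x \<circ> inv_into U \<phi>) (at (\<phi> p)) = frechet_derivative (\<lambda>z. z \<bullet> b) (at (\<phi> p))"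
    by (rule frechet_derivative_cong_open[OF chart_image_open[OF c p(2)]])
      (use p assms(6) chart_inv[OF c] in auto)
  also have "\<dots> = (\<lambda>z. z \<bullet> b)"
    by (rule frechet_derivative_at[symmetric]) (auto intro!: derivative_eq_intros)
  finally show ?thesis using assms(5) by (simp add: chart_vector_def)
qed


lemma chart_vector_sum:
  assumes "(U, \<phi>) \<in> A" "p \<in> U"
  shows "chart_vector A U \<phi> p (\<Sum>b\<in>Basis. c b *\<^sub>R b) = (\<Sum>b\<in>Basis. c b *\<^sub>R chart_vector A U \<phi> p b)"
  using linear_chart_vector[OF assms] by (simp add: linear_sum linear_cmul)

lemma chart_frame:
  assumes "(U, \<phi>) \<in> A" "p \<in> U" "v \<in> T p"
  obtains c where "v = (\<Sum>b\<in>Basis. c b *\<^sub>R chart_vector A U \<phi> p b)"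
proof -
  obtain x W where x: "open W" "p \<in> W" "W \<subseteq> U" "\<And>b. x b \<in> SF" "\<And>b q. q \<in> W \<Longrightarrow> x b q = \<phi> q \<bullet> b"
    by (rule chart_coordinates[OF assms(1,2)]) (rule that)
  have "v = chart_vector A U \<phi> p (\<Sum>b\<in>Basis. v (x b) *\<^sub>R b)"
    by (rule tangent_chart_expansion[OF assms(1) x(2,1,3) assms(3)]) (use x in auto)
  then show ?thesis unfolding chart_vector_sum[OF assms(1,2)] by (rule that)
qed

lemma chart_vector_eq_0:
  assumes "(U, \<phi>) \<in> A" "p \<in> U" "chart_vector A U \<phi> p w = 0"
  shows "w = 0"
proof (rule euclidean_eqI)
  fix b :: 'e
  obtain x W where x: "open W" "p \<in> W" "W \<subseteq> U" "\<And>b. x b \<in> SF" "\<And>b q. q \<in> W \<Longrightarrow> x b q = \<phi> q \<bullet> b"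
    by (rule chart_coordinates[OF assms(1,2)]) (rule that)
  have "chart_vector A U \<phi> p w (x b) = w \<bullet> b"
    by (rule chart_vector_coordinate[OF assms(1) x(2,1,3,4,5)])
  then show "w \<bullet> b = 0 \<bullet> b" using assms(3) by simp
qed


subsection \<open>Local vector fields\<close>

lemma vf_on_subset: "X \<in> vector_fields_on A W \<Longrightarrow> W' \<subseteq> W \<Longrightarrow> X \<in> vector_fields_on A W'"
  unfolding vector_fields_on_def using SFon_subset by blast

lemma vf_on_tangent: "X \<in> vector_fields_on A W \<Longrightarrow> p \<in> W \<Longrightarrow> X p \<in> T p"
  and vf_on_apply: "X \<in> vector_fields_on A W \<Longrightarrow> f \<in> SF \<Longrightarrow> (\<lambda>p. X p f) \<in> SFon W"
  unfolding vector_fields_on_def by auto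

lemma vf_tangent: "X \<in> vector_fields A \<Longrightarrow> X p \<in> T p"
  and vf_apply: "X \<in> vector_fields A \<Longrightarrow> f \<in> SF \<Longrightarrow> (\<lambda>p. X p f) \<in> SF"
  unfolding vector_fields_def by auto

lemma vf_imp_vf_on: "X \<in> vector_fields A \<Longrightarrow> X \<in> vector_fields_on A W"
  unfolding vector_fields_eq by (erule vf_on_subset) simp

lemma vf_on_sum_scaleR:
  assumes "open W" "finite I" "\<And>i. i \<in> I \<Longrightarrow> u i \<in> SFon W" "\<And>i. i \<in> I \<Longrightarrow> X i \<in> vector_fields_on A W"
  shows "(\<lambda>q. \<Sum>i\<in>I. u i q *\<^sub>R X i q) \<in> vector_fields_on A W"
  unfolding vector_fields_on_def
proof (intro CollectI conjI ballI)
  show "(\<Sum>i\<in>I. u i q *\<^sub>R X i q) \<in> T q" if "q \<in> W" for q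
    using vf_on_tangent[OF assms(4) that] by (intro tangent_space_sum tangent_space_scaleR)
  fix f assume "f \<in> SF"
  then have "(\<lambda>q. \<Sum>i\<in>I. u i q * X i q f) \<in> SFon W"
    by (intro SFon_sum SFon_mult assms vf_on_apply)
  then show "(\<lambda>q. (\<Sum>i\<in>I. u i q *\<^sub>R X i q) f) \<in> SFon W"
    by (simp add: sum_fun_apply scaleR_fun_def)
qed

lemma vf_on_cong:
  "open W \<Longrightarrow> X \<in> vector_fields_on A W \<Longrightarrow> (\<And>q. q \<in> W \<Longrightarrow> X q = Y q) \<Longrightarrow> Y \<in> vector_fields_on A W"
  unfolding vector_fields_on_def by (auto intro: SFon_cong[of W "\<lambda>q. X q f" for f])

lemma vf_diff: "X \<in> vector_fields A \<Longrightarrow> Y \<in> vector_fields A \<Longrightarrow> X - Y \<in> vector_fields A"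
  unfolding vector_fields_def by (auto intro: tangent_space_diff SF_diff)

lemma vf_0: "0 \<in> vector_fields A"
  unfolding vector_fields_def by (auto intro: tangent_space_0 SF_const)

lemma vf_local:
  assumes "\<And>p. \<exists>W'. open W' \<and> p \<in> W' \<and> X \<in> vector_fields_on A W'"
  shows "X \<in> vector_fields A"
  unfolding vector_fields_def smooth_functions_eq
proof (intro CollectI conjI allI ballI)
  show "X p \<in> T p" for p using assms[of p] vf_on_tangent by blast
  fix f assume "f \<in> SFon UNIV"
  then show "(\<lambda>p. X p f) \<in> SFon UNIV"
    using assms vf_on_apply[of X _ f] by (intro SFon_local) (auto simp: smooth_functions_eq)
qed

lemma vf_on_cutoff:
  assumes "cutoff p W \<eta> W'" "open W" "X \<in> vector_fields_on A W"
  shows "(\<lambda>q. if q \<in> W then \<eta> q *\<^sub>R X q else 0) \<in> vector_fields A"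
  unfolding vector_fields_def
proof (intro CollectI conjI allI ballI)
  show "(if q \<in> W then \<eta> q *\<^sub>R X q else 0) \<in> T q" for q
    using vf_on_tangent[OF assms(3)] by (auto intro: tangent_space_scaleR tangent_space_0)
  fix f assume f: "f \<in> SF"
  have "(\<lambda>q. (if q \<in> W then \<eta> q *\<^sub>R X q else 0) f) = (\<lambda>q. if q \<in> W then \<eta> q * X q f else 0)"
    by (auto simp: fun_eq_iff scaleR_fun_def)
  then show "(\<lambda>q. (if q \<in> W then \<eta> q *\<^sub>R X q else 0) f) \<in> SF"
    using cutoff_extend[OF assms(1,2) vf_on_apply[OF assms(3) f]] by simp
qed

lemma vf_on_extend:
  assumes "open W" "p \<in> W" "X \<in> vector_fields_on A W"
  obtains X' W' where "X' \<in> vector_fields A" "open W'" "p \<in> W'" "W' \<subseteq> W" "\<And>q. q \<in> W' \<Longrightarrow> X' q = X q"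
proof -
  obtain \<eta> W' where c: "cutoff p W \<eta> W'" using cutoff_exists assms by blast
  show ?thesis
    by (rule that[OF vf_on_cutoff[OF c assms(1,3)], of W'])
      (use c in \<open>auto simp: cutoff_def subset_iff\<close>)
qed

text \<open>The extension has constant coefficients in a chart and is then cut off.\<close>

lemma tangent_extend:
  assumes "v \<in> T p"
  obtains X where "X \<in> vector_fields A" "X p = v"
proof -
  obtain U \<phi> where c: "(U, \<phi>) \<in> A" and p: "p \<in> U" by (rule chart_exists)
  obtain x W where x: "open W" "p \<in> W" "W \<subseteq> U" "\<And>b. x b \<in> SF" "\<And>b q. q \<in> W \<Longrightarrow> x b q = \<phi> q \<bullet> b"
    by (rule chart_coordinates[OF c p]) (rule that)
  define w where "w = (\<Sum>b\<in>Basis. v (x b) *\<^sub>R b)"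
  have v: "v = chart_vector A U \<phi> p w"
    unfolding w_def by (rule tangent_chart_expansion[OF c x(2,1,3) assms]) (use x in auto)
  obtain X W' where "X \<in> vector_fields A" "open W'" "p \<in> W'" "W' \<subseteq> U"
    "\<And>q. q \<in> W' \<Longrightarrow> X q = chart_vector A U \<phi> q w"
    by (rule vf_on_extend[OF chart_open[OF c] p chart_vector_field[OF c, of w]]) (rule that)
  then show ?thesis using that v by simp
qed


subsection \<open>Smooth solutions of positive definite systems\<close>

text \<open>Gaussian elimination with coefficients in the ring of smooth functions. Positivity on
  the indicator of \<open>n\<close> makes the pivot \<open>G n n\<close> nonvanishing, so divisions
  stay smooth, and the reduced system is again positive definite.\<close>

lemma posdef_solve:
  assumes "finite I" "open W"
    and "\<And>i j. i \<in> I \<Longrightarrow> j \<in> I \<Longrightarrow> G i j \<in> SFon W" "\<And>i. i \<in> I \<Longrightarrow> b i \<in> SFon W"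
    and "\<And>q c. q \<in> W \<Longrightarrow> \<exists>i\<in>I. c i \<noteq> 0 \<Longrightarrow> (\<Sum>i\<in>I. \<Sum>j\<in>I. c i * c j * G i j q) > 0"
  shows "\<exists>u. (\<forall>i\<in>I. u i \<in> SFon W) \<and> (\<forall>q\<in>W. \<forall>i\<in>I. (\<Sum>j\<in>I. G i j q * u j q) = b i q)"
  using assms(1,3-)
proof (induction I arbitrary: G b rule: finite_induct)
  case empty
  then show ?case by simp
next
  case (insert n I)
  note G = insert.prems(1) and b = insert.prems(2)
  have pos: "G n n q > 0" if "q \<in> W" for q
  proof -
    have "(\<Sum>i\<in>insert n I. \<Sum>j\<in>insert n I. (if i = n then 1 else 0) * (if j = n then 1 else 0) * G i j q) > 0"
      by (rule insert.prems(3)[OF that]) auto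
    also have "(\<Sum>i\<in>insert n I. \<Sum>j\<in>insert n I. (if i = n then 1 else 0) * (if j = n then 1 else 0) * G i j q) = G n n q"
      using insert.hyps by (simp add: if_distrib[of "\<lambda>x. x * _"] sum.neutral cong: if_cong)
    finally show ?thesis .
  qed
  then have nz: "q \<in> W \<Longrightarrow> G n n q \<noteq> 0" for q by force
  \<comment> \<open>The Schur complement of the pivot, with the right-hand side reduced in the same
    way.\<close>
  define G' where "G' i j q = G i j q - G i n q * G n j q / G n n q" for i j q
  define b' where "b' i q = b i q - G i n q * b n q / G n n q" for i q
  have "\<exists>u. (\<forall>i\<in>I. u i \<in> SFon W) \<and> (\<forall>q\<in>W. \<forall>i\<in>I. (\<Sum>j\<in>I. G' i j q * u j q) = b' i q)"
  proof (rule insert.IH)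
    show "G' i j \<in> SFon W" if "i \<in> I" "j \<in> I" for i j
      unfolding G'_def[abs_def] using that nz
      by (intro SFon_diff SFon_divide SFon_mult G assms(2)) auto
    show "b' i \<in> SFon W" if "i \<in> I" for i
      unfolding b'_def[abs_def] using that nz
      by (intro SFon_diff SFon_divide SFon_mult G b assms(2)) auto
    fix q c assume q: "q \<in> W" and c: "\<exists>i\<in>I. c i \<noteq> (0::real)"
    define s where "s = (\<Sum>j\<in>I. G n j q * c j)"
    define t where "t = (\<Sum>i\<in>I. G i n q * c i)"
    \<comment> \<open>Completing the square: this component at \<open>n\<close> makes the form of
      \<open>G\<close> at \<open>c'\<close> equal to the form of \<open>G'\<close> at
      \<open>c\<close>.\<close>
    define c' where "c' = c(n := - s / G n n q)"
    have c': "c' i = c i" if "i \<in> I" for i using that insert.hyps by (auto simp: c'_def)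
    have "0 < (\<Sum>i\<in>insert n I. \<Sum>j\<in>insert n I. c' i * c' j * G i j q)"
      by (rule insert.prems(3)[OF q]) (use c c' in auto)
    also have "\<dots> = c' n * (c' n * G n n q + (\<Sum>j\<in>I. c' j * G n j q)) +
        c' n * (\<Sum>i\<in>I. c' i * G i n q) + (\<Sum>i\<in>I. \<Sum>j\<in>I. c' i * c' j * G i j q)"
      using insert.hyps by (simp add: sum.distrib sum_distrib_left algebra_simps)
    also have "(\<Sum>j\<in>I. c' j * G n j q) = s" unfolding s_def by (rule sum.cong) (auto simp: c')
    also have "(\<Sum>i\<in>I. c' i * G i n q) = t" unfolding t_def by (rule sum.cong) (auto simp: c')
    also have "c' n * G n n q + s = 0" using nz[OF q] by (simp add: c'_def)
    also have "c' n * t = - (\<Sum>i\<in>I. \<Sum>j\<in>I. c i * c j * (G i n q * G n j q / G n n q))"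
    proof -
      have "(\<Sum>i\<in>I. \<Sum>j\<in>I. c i * c j * (G i n q * G n j q / G n n q)) = t * s / G n n q"
        unfolding t_def s_def sum_product sum_divide_distrib by (intro sum.cong refl) (simp add: mult_ac)
      then show ?thesis by (simp add: c'_def)
    qed
    also have "(\<Sum>i\<in>I. \<Sum>j\<in>I. c' i * c' j * G i j q) = (\<Sum>i\<in>I. \<Sum>j\<in>I. c i * c j * G i j q)"
      by (intro sum.cong refl) (auto simp: c')
    finally show "(\<Sum>i\<in>I. \<Sum>j\<in>I. c i * c j * G' i j q) > 0"
      by (simp add: G'_def right_diff_distrib sum_subtractf)
  qed
  then obtain u where u: "\<And>i. i \<in> I \<Longrightarrow> u i \<in> SFon W"
    "\<And>q i. q \<in> W \<Longrightarrow> i \<in> I \<Longrightarrow> (\<Sum>j\<in>I. G' i j q * u j q) = b' i q" by blast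
  define s where "s q = (\<Sum>j\<in>I. G n j q * u j q)" for q
  \<comment> \<open>Back substitution: row \<open>n\<close> determines the eliminated unknown from
    the others.\<close>
  define u' where "u' = u(n := (\<lambda>q. (b n q - s q) / G n n q))"
  have u': "u' i = u i" if "i \<in> I" for i using that insert.hyps by (auto simp: u'_def)
  have sSF: "s \<in> SFon W" unfolding s_def[abs_def]
    by (intro SFon_sum SFon_mult assms(2) insert.hyps G u) auto
  have "u' i \<in> SFon W" if "i \<in> insert n I" for i
  proof (cases "i = n")
    case True
    then show ?thesis unfolding u'_def
      using nz by (auto intro!: SFon_divide SFon_diff assms(2) sSF b G)
  qed (use that u u' in auto)
  moreover have "(\<Sum>j\<in>insert n I. G i j q * u' j q) = b i q" if q: "q \<in> W" and i: "i \<in> insert n I" for q i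
  proof -
    have sum: "(\<Sum>j\<in>insert n I. G i j q * u' j q) = G i n q * ((b n q - s q) / G n n q) + (\<Sum>j\<in>I. G i j q * u j q)" for i
    proof -
      have "(\<Sum>j\<in>I. G i j q * u' j q) = (\<Sum>j\<in>I. G i j q * u j q)"
        by (rule sum.cong) (auto simp: u')
      then show ?thesis using insert.hyps by (simp add: u'_def)
    qed
    show ?thesis
    proof (cases "i = n")
      case True
      then show ?thesis unfolding sum using nz[OF q] by (simp add: s_def)
    next
      case False
      then have "i \<in> I" using i by simp
      from u(2)[OF q this] have "(\<Sum>j\<in>I. G i j q * u j q) = b' i q + G i n q * s q / G n n q"
        by (simp add: G'_def s_def left_diff_distrib sum_subtractf sum_distrib_left sum_divide_distrib algebra_simps)
      then show ?thesis unfolding sum b'_def using nz[OF q] by (simp add: field_simps)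
    qed
  qed
  ultimately show ?case by blast
qed

end

section \<open>Riemannian metrics and horizontal frames\<close>

locale riemannian = manifold A
  for A :: "('a::{t2_space, second_countable_topology}, 'e::euclidean_space) chart set" +
  fixes g :: "'a metric"
  assumes metric: "riemannian_metric A g"
begin

lemma g_sym: "v \<in> T p \<Longrightarrow> w \<in> T p \<Longrightarrow> g p v w = g p w v"
  and g_add_left: "u \<in> T p \<Longrightarrow> v \<in> T p \<Longrightarrow> w \<in> T p \<Longrightarrow> g p (u + v) w = g p u w + g p v w"
  and g_scale_left: "v \<in> T p \<Longrightarrow> w \<in> T p \<Longrightarrow> g p (c *\<^sub>R v) w = c * g p v w"
  and g_pos: "v \<in> T p \<Longrightarrow> v \<noteq> 0 \<Longrightarrow> g p v v > 0"
  and g_smooth: "X \<in> vector_fields A \<Longrightarrow> Y \<in> vector_fields A \<Longrightarrow> (\<lambda>p. g p (X p) (Y p)) \<in> SF"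
  using metric unfolding riemannian_metric_def by blast+

lemma g_add_right: "u \<in> T p \<Longrightarrow> v \<in> T p \<Longrightarrow> w \<in> T p \<Longrightarrow> g p w (u + v) = g p w u + g p w v"
  using g_sym[of w p "u + v"] by (simp add: g_add_left g_sym[of w] tangent_space_add)

lemma g_scale_right: "v \<in> T p \<Longrightarrow> w \<in> T p \<Longrightarrow> g p w (c *\<^sub>R v) = c * g p w v"
  using g_sym[of w p "c *\<^sub>R v"] by (simp add: g_scale_left g_sym[of w] tangent_space_scaleR)

lemma g_zero_left: "w \<in> T p \<Longrightarrow> g p 0 w = 0"
  using g_scale_left[of w p w 0] by simp

lemma g_zero_right: "w \<in> T p \<Longrightarrow> g p w 0 = 0"
  using g_scale_right[of w p w 0] by simp

lemma g_diff_left: "u \<in> T p \<Longrightarrow> v \<in> T p \<Longrightarrow> w \<in> T p \<Longrightarrow> g p (u - v) w = g p u w - g p v w"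
  using g_add_left[of u p "-1 *\<^sub>R v" w] g_scale_left[of v p w "-1"] tangent_space_scaleR[of v p "-1"] by simp

lemma g_diff_right: "u \<in> T p \<Longrightarrow> v \<in> T p \<Longrightarrow> w \<in> T p \<Longrightarrow> g p w (u - v) = g p w u - g p w v"
  using g_sym[of w p "u - v"] by (simp add: g_diff_left g_sym[of w] tangent_space_diff)

lemma g_sum_left:
  "(\<And>i. i \<in> I \<Longrightarrow> v i \<in> T p) \<Longrightarrow> w \<in> T p \<Longrightarrow> g p (\<Sum>i\<in>I. c i *\<^sub>R v i) w = (\<Sum>i\<in>I. c i * g p (v i) w)"
  by (induction I rule: infinite_finite_induct)
    (auto simp: g_zero_left g_add_left g_scale_left tangent_space_scaleR tangent_space_sum)

lemma g_sum_right:
  "(\<And>i. i \<in> I \<Longrightarrow> v i \<in> T p) \<Longrightarrow> w \<in> T p \<Longrightarrow> g p w (\<Sum>i\<in>I. c i *\<^sub>R v i) = (\<Sum>i\<in>I. c i * g p w (v i))"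
  by (induction I rule: infinite_finite_induct)
    (auto simp: g_zero_right g_add_right g_scale_right tangent_space_scaleR tangent_space_sum)

lemma g_sum_sum:
  assumes "\<And>i. i \<in> I \<Longrightarrow> v i \<in> T p"
  shows "g p (\<Sum>i\<in>I. c i *\<^sub>R v i) (\<Sum>i\<in>I. c i *\<^sub>R v i) = (\<Sum>i\<in>I. \<Sum>j\<in>I. c i * c j * g p (v i) (v j))"
proof -
  have "(\<Sum>i\<in>I. c i *\<^sub>R v i) \<in> T p" by (intro tangent_space_sum tangent_space_scaleR assms)
  then have "g p (\<Sum>i\<in>I. c i *\<^sub>R v i) (\<Sum>i\<in>I. c i *\<^sub>R v i) = (\<Sum>i\<in>I. c i * g p (v i) (\<Sum>j\<in>I. c j *\<^sub>R v j))"
    by (intro g_sum_left assms)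
  also have "\<dots> = (\<Sum>i\<in>I. \<Sum>j\<in>I. c i * c j * g p (v i) (v j))"
    by (intro sum.cong refl) (simp add: g_sum_right assms sum_distrib_left mult.assoc)
  finally show ?thesis .
qed

text \<open>Smoothness of the metric is postulated on global fields only; near each point local
  fields agree with global ones, and smoothness is a local property.\<close>

lemma g_smooth_on:
  assumes "open W" "X \<in> vector_fields_on A W" "Y \<in> vector_fields_on A W"
  shows "(\<lambda>p. g p (X p) (Y p)) \<in> SFon W"
proof (rule SFon_local)
  fix p assume p: "p \<in> W"
  obtain X' W1 where X': "X' \<in> vector_fields A" "open W1" "p \<in> W1" "W1 \<subseteq> W" "\<And>q. q \<in> W1 \<Longrightarrow> X' q = X q"
    by (rule vf_on_extend[OF assms(1) p assms(2)]) (rule that)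
  obtain Y' W2 where Y': "Y' \<in> vector_fields A" "open W2" "p \<in> W2" "W2 \<subseteq> W" "\<And>q. q \<in> W2 \<Longrightarrow> Y' q = Y q"
    by (rule vf_on_extend[OF assms(1) p assms(3)]) (rule that)
  have "(\<lambda>p. g p (X p) (Y p)) \<in> SFon (W1 \<inter> W2)"
    by (rule SFon_cong[OF _ _ SF_imp_SFon[OF g_smooth[OF X'(1) Y'(1)]]]) (use X' Y' in auto)
  then show "\<exists>W'. open W' \<and> p \<in> W' \<and> W' \<subseteq> W \<and> (\<lambda>p. g p (X p) (Y p)) \<in> SFon W'"
    using X' Y' by (intro exI[of _ "W1 \<inter> W2"]) auto
qed

text \<open>Raising an index. The Gram matrix of the coordinate fields is positive definite since
  these fields are independent, and \<open>posdef_solve\<close> delivers smooth coefficients on the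
  whole chart domain.\<close>

lemma gradient_exists:
  assumes c: "(U, \<phi>) \<in> A" and f: "f \<in> SF"
  obtains Y where "Y \<in> vector_fields_on A U" "\<And>q v. q \<in> U \<Longrightarrow> v \<in> T q \<Longrightarrow> g q (Y q) v = v f"
proof -
  define D where "D b q = chart_vector A U \<phi> q b" for b q
  have D: "D b \<in> vector_fields_on A U" for b
    using chart_vector_field[OF c, of b] by (simp add: D_def[abs_def])
  have DT: "D b q \<in> T q" if "q \<in> U" for b q by (rule vf_on_tangent[OF D that])
  note U = chart_open[OF c]
  have "\<exists>u. (\<forall>i\<in>Basis. u i \<in> SFon U) \<and>
      (\<forall>q\<in>U. \<forall>i\<in>Basis. (\<Sum>j\<in>Basis. g q (D i q) (D j q) * u j q) = D i q f)"
  proof (rule posdef_solve[OF finite_Basis U])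
    show "(\<lambda>q. g q (D i q) (D j q)) \<in> SFon U" for i j by (rule g_smooth_on[OF U D D])
    show "(\<lambda>q. D i q f) \<in> SFon U" for i by (rule vf_on_apply[OF D f])
    fix q and k :: "'e \<Rightarrow> real" assume q: "q \<in> U" and k: "\<exists>i\<in>Basis. k i \<noteq> 0"
    have "(\<Sum>b\<in>Basis. k b *\<^sub>R b) \<noteq> 0"
    proof
      assume *: "(\<Sum>b\<in>Basis. k b *\<^sub>R b) = (0::'e)"
      obtain i :: 'e where i: "i \<in> Basis" "k i \<noteq> 0" using k by blast
      have "k i = (\<Sum>b\<in>Basis. k b *\<^sub>R b) \<bullet> i" using i(1) by (simp add: inner_sum_left_Basis)
      then show False using * i by simp
    qed
    then have "chart_vector A U \<phi> q (\<Sum>b\<in>Basis. k b *\<^sub>R b) \<noteq> 0"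
      using chart_vector_eq_0[OF c q] by blast
    then have "(\<Sum>b\<in>Basis. k b *\<^sub>R D b q) \<noteq> 0"
      by (simp add: chart_vector_sum[OF c q] D_def)
    then have "0 < g q (\<Sum>b\<in>Basis. k b *\<^sub>R D b q) (\<Sum>b\<in>Basis. k b *\<^sub>R D b q)"
      by (intro g_pos tangent_space_sum tangent_space_scaleR DT[OF q])
    also have "\<dots> = (\<Sum>i\<in>Basis. \<Sum>j\<in>Basis. k i * k j * g q (D i q) (D j q))"
      by (rule g_sum_sum[OF DT[OF q]])
    finally show "0 < (\<Sum>i\<in>Basis. \<Sum>j\<in>Basis. k i * k j * g q (D i q) (D j q))" .
  qed
  then obtain u where u: "\<And>i. i \<in> Basis \<Longrightarrow> u i \<in> SFon U"
    "\<And>q i. q \<in> U \<Longrightarrow> i \<in> Basis \<Longrightarrow> (\<Sum>j\<in>Basis. g q (D i q) (D j q) * u j q) = D i q f" by blast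
  show ?thesis
  proof
    show "(\<lambda>q. \<Sum>j\<in>Basis. u j q *\<^sub>R D j q) \<in> vector_fields_on A U"
      by (rule vf_on_sum_scaleR[OF U finite_Basis u(1) D])
    fix q v assume q: "q \<in> U" and v: "v \<in> T q"
    obtain k where k: "v = (\<Sum>b\<in>Basis. k b *\<^sub>R D b q)"
      using chart_frame[OF c q v] unfolding D_def by blast
    have "g q (\<Sum>j\<in>Basis. u j q *\<^sub>R D j q) (D i q) = D i q f" if "i \<in> Basis" for i
      using u(2)[OF q that] g_sym[OF DT[OF q, of i] DT[OF q]]
      by (simp add: g_sum_left DT[OF q] mult.commute)
    then show "g q (\<Sum>j\<in>Basis. u j q *\<^sub>R D j q) v = v f"
      unfolding k by (simp add: g_sum_right DT[OF q] tangent_space_sum tangent_space_scaleR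
          sum_fun_apply scaleR_fun_apply)
  qed
qed

end

locale submersion = riemannian A g + N: manifold B
  for A :: "('a::{t2_space, second_countable_topology}, 'e::euclidean_space) chart set"
    and g :: "'a metric"
    and B :: "('b::{t2_space, second_countable_topology}, 'f::euclidean_space) chart set" +
  fixes h :: "'b metric" and F :: "'a \<Rightarrow> 'b"
  assumes submersion: "riemannian_submersion A g B h F"
begin

section \<open>Vertical and horizontal vectors of a Riemannian submersion, and local frames\<close>

abbreviation "\<V> \<equiv> kernel_distribution A B F"
abbreviation "\<H> \<equiv> orthogonal_distribution A g \<V>"

lemma F_smooth: "smooth_map A B F"
  and F_onto: "differential B F ` T p = N.T (F p)"
  using submersion unfolding riemannian_submersion_def by auto

lemma F_cont: "open W \<Longrightarrow> open (F -` W)"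
  using F_smooth unfolding smooth_map_def by (auto intro: open_vimage)

lemma SF_pullback:
  assumes f: "f \<in> N.SF"
  shows "f \<circ> F \<in> SF"
  unfolding smooth_functions_eq
proof (rule SFon_local)
  fix p
  obtain U \<phi> where c: "(U, \<phi>) \<in> A" "p \<in> U" by (rule chart_exists)
  obtain V \<psi> where d: "(V, \<psi>) \<in> B" "F p \<in> V" by (rule N.chart_exists)
  define W where "W = U \<inter> F -` V"
  have W: "open W" unfolding W_def using chart_open[OF c(1)] N.chart_open[OF d(1)] F_cont by auto
  have op: "open (\<phi> ` W)" unfolding W_def by (intro chart_image_open[OF c(1)] F_cont N.chart_open[OF d(1)])
  have "f \<circ> F \<in> SFon W"
  proof (rule SFon_chartI[OF c(1) W])
    have "smooth_on (\<phi> ` W) (\<lambda>z. (f \<circ> inv_into V \<psi>) ((\<psi> \<circ> F \<circ> inv_into U \<phi>) z))"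
    proof (rule smooth_on_compose[OF op N.chart_open_image[OF d(1)] _ N.SF_chartD[OF f d(1)]])
      show "smooth_on (\<phi> ` W) (\<psi> \<circ> F \<circ> inv_into U \<phi>)"
        using F_smooth c(1) d(1) unfolding smooth_map_def W_def by fast
      show "(\<psi> \<circ> F \<circ> inv_into U \<phi>) ` \<phi> ` W \<subseteq> \<psi> ` V"
        using chart_inv[OF c(1)] by (auto simp: W_def)
    qed
    then show "smooth_on (\<phi> ` W) (f \<circ> F \<circ> inv_into U \<phi>)"
      by (rule smooth_on_cong[OF op, rotated])
        (use chart_inv[OF c(1)] N.chart_inv[OF d(1)] in \<open>auto simp: W_def\<close>)
  qed (auto simp: W_def)
  then show "\<exists>W'. open W' \<and> p \<in> W' \<and> W' \<subseteq> UNIV \<and> f \<circ> F \<in> SFon W'"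
    using W c d by (intro exI[of _ W]) (auto simp: W_def)
qed

lemma differential_apply: "f \<in> N.SF \<Longrightarrow> differential B F v f = v (f \<circ> F)"
  by (simp add: differential_def)

lemma vertical_iff: "v \<in> \<V> p \<longleftrightarrow> v \<in> T p \<and> (\<forall>f\<in>N.SF. v (f \<circ> F) = 0)"
  by (auto simp: kernel_distribution_def differential_def fun_eq_iff)

lemma horizontal_iff: "v \<in> \<H> p \<longleftrightarrow> v \<in> T p \<and> (\<forall>w\<in>\<V> p. g p v w = 0)"
  by (simp add: orthogonal_distribution_def)

lemma V_tangent: "v \<in> \<V> p \<Longrightarrow> v \<in> T p" and H_tangent: "v \<in> \<H> p \<Longrightarrow> v \<in> T p"
  by (simp_all add: vertical_iff horizontal_iff)

lemma HV_orthogonal: "v \<in> \<H> p \<Longrightarrow> w \<in> \<V> p \<Longrightarrow> g p v w = 0"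
  by (simp add: horizontal_iff)

lemma VH_orthogonal: "v \<in> \<V> p \<Longrightarrow> w \<in> \<H> p \<Longrightarrow> g p v w = 0"
  using HV_orthogonal[of w p v] g_sym V_tangent H_tangent by metis

lemma HV_trivial: "v \<in> \<H> p \<Longrightarrow> v \<in> \<V> p \<Longrightarrow> v = 0"
  using g_pos[of v p] HV_orthogonal[of v p v] V_tangent[of v p] by fastforce

lemma V_diff: "v \<in> \<V> p \<Longrightarrow> w \<in> \<V> p \<Longrightarrow> v - w \<in> \<V> p"
  and V_0: "0 \<in> \<V> p"
  by (auto simp: vertical_iff tangent_space_add tangent_space_scaleR tangent_space_0 tangent_space_diff
      scaleR_fun_apply)

lemma H_add: "v \<in> \<H> p \<Longrightarrow> w \<in> \<H> p \<Longrightarrow> v + w \<in> \<H> p"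
  and H_scale: "v \<in> \<H> p \<Longrightarrow> c *\<^sub>R v \<in> \<H> p"
  and H_diff: "v \<in> \<H> p \<Longrightarrow> w \<in> \<H> p \<Longrightarrow> v - w \<in> \<H> p"
  and H_0: "0 \<in> \<H> p"
  by (auto simp: horizontal_iff tangent_space_add tangent_space_scaleR tangent_space_0 tangent_space_diff
      V_tangent g_add_left g_scale_left g_diff_left g_zero_left)

lemma H_sum: "(\<And>i. i \<in> I \<Longrightarrow> v i \<in> \<H> p) \<Longrightarrow> (\<Sum>i\<in>I. v i) \<in> \<H> p"
  by (induction I rule: infinite_finite_induct) (auto intro: H_0 H_add)

text \<open>The functions \<open>y\<close> are coordinates downstairs, and \<open>L\<close> is the horizontal lift of the dual frame.\<close>

definition horizontal_frame :: "'a set \<Rightarrow> ('f \<Rightarrow> 'b \<Rightarrow> real) \<Rightarrow> ('f \<Rightarrow> 'a vfield) \<Rightarrow> bool" where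
  "horizontal_frame W y L \<longleftrightarrow> open W \<and> (\<forall>i. y i \<in> N.SF) \<and>
    (\<forall>i\<in>Basis. L i \<in> vector_fields_on A W) \<and>
    (\<forall>q\<in>W. \<forall>i\<in>Basis. L i q \<in> \<H> q) \<and>
    (\<forall>q\<in>W. \<forall>i\<in>Basis. \<forall>j\<in>Basis. L i q (y j \<circ> F) = (if i = j then 1 else 0)) \<and>
    (\<forall>q\<in>W. \<forall>v\<in>T q. (\<forall>j\<in>Basis. v (y j \<circ> F) = 0) \<longrightarrow> v \<in> \<V> q)"

text \<open>The gradients \<open>X i\<close> of \<open>y i \<circ> F\<close> are horizontal, because
  vertical vectors annihilate functions pulled back from the base. Combining them with the inverse
  of their Gram matrix gives fields dual to the functions \<open>y j \<circ> F\<close>.\<close>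

lemma horizontal_frame_exists:
  obtains W y L where "p \<in> W" "horizontal_frame W y L"
proof -
  obtain U \<phi> where c: "(U, \<phi>) \<in> A" "p \<in> U" by (rule chart_exists)
  obtain V \<psi> where d: "(V, \<psi>) \<in> B" "F p \<in> V" by (rule N.chart_exists)
  obtain y W0 where y: "open W0" "F p \<in> W0" "W0 \<subseteq> V" "\<And>b. y b \<in> N.SF" "\<And>b q. q \<in> W0 \<Longrightarrow> y b q = \<psi> q \<bullet> b"
    by (rule N.chart_coordinates[OF d]) (rule that)
  have "\<exists>X. X \<in> vector_fields_on A U \<and> (\<forall>q\<in>U. \<forall>v\<in>T q. g q (X q) v = v (y i \<circ> F))" for i
    by (rule gradient_exists[OF c(1) SF_pullback[OF y(4), of i]]) blast
  then obtain X where XU: "\<And>i. X i \<in> vector_fields_on A U"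
    and Xg: "\<And>i q v. q \<in> U \<Longrightarrow> v \<in> T q \<Longrightarrow> g q (X i q) v = v (y i \<circ> F)" by metis
  define W where "W = U \<inter> F -` W0"
  have W: "open W" "p \<in> W" "W \<subseteq> U"
    using chart_open[OF c(1)] F_cont[OF y(1)] c y by (auto simp: W_def)
  have FW: "F q \<in> W0" if "q \<in> W" for q using that by (simp add: W_def)
  have X: "X i \<in> vector_fields_on A W" for i by (rule vf_on_subset[OF XU W(3)])
  have XT: "X i q \<in> T q" if "q \<in> W" for i q by (rule vf_on_tangent[OF X that])
  define G where "G i j q = X i q (y j \<circ> F)" for i j q
  have Gg: "G i j q = g q (X i q) (X j q)" if "q \<in> W" for i j q
    using Xg[of q "X i q" j] XT[OF that] W(3) that g_sym by (auto simp: G_def)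
  have Gsym: "G i j q = G j i q" if "q \<in> W" for i j q
    using Gg[OF that] g_sym[OF XT[OF that] XT[OF that]] by simp
  have "\<exists>u. (\<forall>i\<in>Basis. u i \<in> SFon W) \<and>
      (\<forall>q\<in>W. \<forall>i\<in>Basis. (\<Sum>j\<in>Basis. G i j q * u j q) = (if i = k then 1 else 0))" for k :: 'f
  proof (rule posdef_solve[OF finite_Basis W(1)])
    show "G i j \<in> SFon W" for i j
      using vf_on_apply[OF X SF_pullback[OF y(4)]] by (simp add: G_def[abs_def])
    show "(\<lambda>q. if i = k then 1 else 0) \<in> SFon W" for i by (rule SFon_const[OF W(1)])
    fix q and c :: "'f \<Rightarrow> real" assume q: "q \<in> W" and c: "\<exists>i\<in>Basis. c i \<noteq> 0"
    define z where "z = (\<Sum>i\<in>Basis. c i *\<^sub>R X i q)"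
    have z: "z \<in> T q" unfolding z_def by (intro tangent_space_sum tangent_space_scaleR XT q)
    \<comment> \<open>Since the differential of \<open>F\<close> is onto, some \<open>v\<close>
      satisfies \<open>v (y i \<circ> F) = c i\<close> for every \<open>i\<close>; pairing
      \<open>z\<close> with this \<open>v\<close> gives the sum of the squares of the
      \<open>c i\<close>.\<close>
    have "z \<noteq> 0"
    proof
      assume "z = 0"
      have "chart_vector B V \<psi> (F q) (\<Sum>j\<in>Basis. c j *\<^sub>R j) \<in> differential B F ` T q"
        unfolding F_onto using FW[OF q] y(3) by (intro N.chart_vector_tangent[OF d(1)]) auto
      then obtain v where v: "v \<in> T q" "differential B F v = chart_vector B V \<psi> (F q) (\<Sum>j\<in>Basis. c j *\<^sub>R j)"
        by auto
      have vc: "v (y i \<circ> F) = c i" if "i \<in> Basis" for i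
      proof -
        have "v (y i \<circ> F) = chart_vector B V \<psi> (F q) (\<Sum>j\<in>Basis. c j *\<^sub>R j) (y i)"
          by (simp add: differential_apply[OF y(4), symmetric] v(2))
        also have "\<dots> = (\<Sum>j\<in>Basis. c j *\<^sub>R j) \<bullet> i"
          by (rule N.chart_vector_coordinate[OF d(1) FW[OF q] y(1,3,4,5)])
        finally show ?thesis using that by (simp add: inner_sum_left_Basis)
      qed
      have "0 = g q z v" using \<open>z = 0\<close> g_zero_left[OF v(1)] by simp
      also have "\<dots> = (\<Sum>i\<in>Basis. c i * v (y i \<circ> F))"
        unfolding z_def using Xg[OF _ v(1)] q W(3) by (simp add: g_sum_left XT[OF q] v(1) subset_iff)
      also have "\<dots> = (\<Sum>i\<in>Basis. c i * c i)" by (simp add: vc)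
      finally have "\<forall>i\<in>Basis. c i * c i = 0"
        by (subst sum_nonneg_eq_0_iff[symmetric]) auto
      then show False using c by auto
    qed
    then have "0 < g q z z" by (rule g_pos[OF z])
    also have "\<dots> = (\<Sum>i\<in>Basis. \<Sum>j\<in>Basis. c i * c j * G i j q)"
      unfolding Gg[OF q] z_def
      by (rule g_sum_sum[OF XT[OF q]])
    finally show "0 < (\<Sum>i\<in>Basis. \<Sum>j\<in>Basis. c i * c j * G i j q)" .
  qed
  then obtain u where u: "\<And>k i. i \<in> Basis \<Longrightarrow> u k i \<in> SFon W"
    "\<And>k q i. q \<in> W \<Longrightarrow> i \<in> Basis \<Longrightarrow> (\<Sum>j\<in>Basis. G i j q * u k j q) = (if i = k then 1 else 0)"
    by metis
  define L where "L k q = (\<Sum>j\<in>Basis. u k j q *\<^sub>R X j q)" for k q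
  have "L k \<in> vector_fields_on A W" for k
    unfolding L_def[abs_def] by (rule vf_on_sum_scaleR[OF W(1) finite_Basis u(1) X])
  moreover have "L k q \<in> \<H> q" if q: "q \<in> W" for k q
    unfolding L_def
  proof (intro H_sum H_scale)
    fix j show "X j q \<in> \<H> q"
      using XT[OF q] Xg[of q _ j] q W(3) y(4) by (auto simp: horizontal_iff vertical_iff)
  qed
  moreover have "L k q (y i \<circ> F) = (if k = i then 1 else 0)" if q: "q \<in> W" and i: "i \<in> Basis" for k q i
  proof -
    have "L k q (y i \<circ> F) = (\<Sum>j\<in>Basis. u k j q * G j i q)"
      by (simp add: L_def sum_fun_apply scaleR_fun_apply G_def)
    also have "\<dots> = (\<Sum>j\<in>Basis. G i j q * u k j q)"
      by (intro sum.cong refl) (simp add: Gsym[OF q, of _ i])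
    finally show ?thesis using u(2)[OF q i] by simp
  qed
  moreover have "v \<in> \<V> q" if q: "q \<in> W" and v: "v \<in> T q" "\<forall>j\<in>Basis. v (y j \<circ> F) = 0" for v q
  proof -
    \<comment> \<open>A tangent vector of the base is determined by its values on the coordinates
      \<open>y j\<close>, so if these are 0 the vector is 0.\<close>
    have "differential B F v \<in> N.T (F q)" using F_onto v(1) by blast
    from N.tangent_chart_expansion[OF d(1) FW[OF q] y(1,3) this y(4,5)]
    have "differential B F v = chart_vector B V \<psi> (F q) (\<Sum>b\<in>Basis. differential B F v (y b) *\<^sub>R b)" .
    also have "(\<Sum>b\<in>Basis. differential B F v (y b) *\<^sub>R b) = 0"
      using v(2) by (intro sum.neutral) (simp add: differential_apply[OF y(4)])
    also have "chart_vector B V \<psi> (F q) 0 = 0"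
      using FW[OF q] y(3) by (intro linear_0 N.linear_chart_vector[OF d(1)]) auto
    finally show ?thesis using v(1) by (simp add: kernel_distribution_def)
  qed
  ultimately have "horizontal_frame W y L"
    unfolding horizontal_frame_def using W(1) y(4) by blast
  then show ?thesis by (rule that[OF W(2)])
qed

lemma horizontal_frame_decompose:
  assumes "horizontal_frame W y L" "q \<in> W" "v \<in> T q"
  shows "(\<Sum>i\<in>Basis. v (y i \<circ> F) *\<^sub>R L i q) \<in> \<H> q" "v - (\<Sum>i\<in>Basis. v (y i \<circ> F) *\<^sub>R L i q) \<in> \<V> q"
proof -
  have fr: "\<And>i. i \<in> Basis \<Longrightarrow> L i q \<in> \<H> q"
    "\<And>i j. i \<in> Basis \<Longrightarrow> j \<in> Basis \<Longrightarrow> L i q (y j \<circ> F) = (if i = j then 1 else 0)"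
    "\<And>v. v \<in> T q \<Longrightarrow> (\<And>j. j \<in> Basis \<Longrightarrow> v (y j \<circ> F) = 0) \<Longrightarrow> v \<in> \<V> q"
    using assms(1,2) unfolding horizontal_frame_def by auto
  show *: "(\<Sum>i\<in>Basis. v (y i \<circ> F) *\<^sub>R L i q) \<in> \<H> q"
    by (intro H_sum H_scale fr)
  show "v - (\<Sum>i\<in>Basis. v (y i \<circ> F) *\<^sub>R L i q) \<in> \<V> q"
  proof (rule fr(3))
    show "v - (\<Sum>i\<in>Basis. v (y i \<circ> F) *\<^sub>R L i q) \<in> T q"
      by (rule tangent_space_diff[OF assms(3) H_tangent[OF *]])
    fix j :: 'f assume j: "j \<in> Basis"
    have "(\<Sum>i\<in>Basis. v (y i \<circ> F) * L i q (y j \<circ> F)) = (\<Sum>i\<in>Basis. if i = j then v (y j \<circ> F) else 0)"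
      by (intro sum.cong refl) (simp add: fr(2)[OF _ j])
    then show "(v - (\<Sum>i\<in>Basis. v (y i \<circ> F) *\<^sub>R L i q)) (y j \<circ> F) = 0"
      using j by (simp add: sum_fun_apply scaleR_fun_apply)
  qed
qed


subsection \<open>Vertical and horizontal projections\<close>

abbreviation "vert \<equiv> proj A g \<V>"
abbreviation "hor \<equiv> coproj A g \<V>"

text \<open>\<open>proj\<close> is a definite description. Two candidates differ by a vector that is
  both vertical and horizontal, hence zero by positivity of the metric.\<close>

lemma vert_eqI:
  assumes "w \<in> \<V> p" "v - w \<in> \<H> p"
  shows "vert p v = w"
  unfolding proj_def
proof (rule the_equality)
  fix w' assume w': "w' \<in> \<V> p \<and> v - w' \<in> \<H> p"
  have "w' - w = (v - w) - (v - w')" by simp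
  then have "w' - w \<in> \<H> p" using H_diff assms w' by metis
  moreover have "w' - w \<in> \<V> p" using V_diff assms w' by blast
  ultimately have "w' - w = 0" by (rule HV_trivial)
  then show "w' = w" by simp
qed (use assms in blast)

lemma hor_frame:
  assumes "horizontal_frame W y L" "q \<in> W" "v \<in> T q"
  shows "hor q v = (\<Sum>i\<in>Basis. v (y i \<circ> F) *\<^sub>R L i q)"
proof -
  have "vert q v = v - (\<Sum>i\<in>Basis. v (y i \<circ> F) *\<^sub>R L i q)"
    by (rule vert_eqI) (use horizontal_frame_decompose[OF assms] in auto)
  then show ?thesis by (simp add: coproj_def)
qed

lemma vert_hor: "vert p v + hor p v = v"
  by (simp add: coproj_def)

text \<open>Existence of the orthogonal splitting is read off from a horizontal frame; only then
  does the definite description in \<open>proj\<close> have a meaning for every tangent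
  vector.\<close>

lemma hor_in: "v \<in> T p \<Longrightarrow> hor p v \<in> \<H> p"
  and vert_in: "v \<in> T p \<Longrightarrow> vert p v \<in> \<V> p"
proof -
  assume v: "v \<in> T p"
  obtain W y L where fr: "p \<in> W" "horizontal_frame W y L" by (rule horizontal_frame_exists)
  show "hor p v \<in> \<H> p"
    unfolding hor_frame[OF fr(2,1) v] by (rule horizontal_frame_decompose[OF fr(2,1) v])
  have "vert p v = v - hor p v" by (simp add: coproj_def)
  then show "vert p v \<in> \<V> p"
    unfolding hor_frame[OF fr(2,1) v] using horizontal_frame_decompose[OF fr(2,1) v] by simp
qed

lemma vert_V: "v \<in> \<V> p \<Longrightarrow> vert p v = v" and hor_V: "v \<in> \<V> p \<Longrightarrow> hor p v = 0"
  using vert_eqI[of v p v] by (auto simp: H_0 coproj_def)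

lemma hor_H: "v \<in> \<H> p \<Longrightarrow> hor p v = v"
  using vert_eqI[of 0 p v] by (auto simp: V_0 coproj_def)

text \<open>Smoothness of the projection is visible in a frame, where its coefficients
  \<open>X q (y i \<circ> F)\<close> are smooth.\<close>

lemma hor_vf:
  assumes X: "X \<in> vector_fields A"
  shows "hor \<bullet>\<^sub>v X \<in> vector_fields A"
proof (rule vf_local)
  fix p
  obtain W y L where fr: "p \<in> W" "horizontal_frame W y L" by (rule horizontal_frame_exists)
  then have W: "open W" and y: "\<And>i. y i \<in> N.SF" and L: "\<And>i. i \<in> Basis \<Longrightarrow> L i \<in> vector_fields_on A W"
    by (auto simp: horizontal_frame_def)
  have "(\<lambda>q. \<Sum>i\<in>Basis. X q (y i \<circ> F) *\<^sub>R L i q) \<in> vector_fields_on A W"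
    by (intro vf_on_sum_scaleR[OF W finite_Basis _ L] vf_on_apply[OF vf_imp_vf_on[OF X]] SF_pullback y)
  then have "hor \<bullet>\<^sub>v X \<in> vector_fields_on A W"
    by (rule vf_on_cong[OF W]) (simp add: app_def hor_frame[OF fr(2) _ vf_tangent[OF X]])
  then show "\<exists>W'. open W' \<and> p \<in> W' \<and> hor \<bullet>\<^sub>v X \<in> vector_fields_on A W'"
    using W fr by blast
qed

lemma vert_vf:
  assumes X: "X \<in> vector_fields A"
  shows "vert \<bullet>\<^sub>v X \<in> vector_fields A"
proof -
  have "vert \<bullet>\<^sub>v X = X - hor \<bullet>\<^sub>v X" by (simp add: app_def coproj_def fun_eq_iff)
  then show ?thesis using vf_diff[OF X hor_vf[OF X]] by simp
qed

lemma hor_section: "X \<in> vector_fields A \<Longrightarrow> hor \<bullet>\<^sub>v X \<in> sections A \<H>"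
  and vert_section: "X \<in> vector_fields A \<Longrightarrow> vert \<bullet>\<^sub>v X \<in> sections A \<V>"
  unfolding sections_def using hor_vf vert_vf hor_in vert_in vf_tangent by (auto simp: app_def)

lemma V_extend:
  assumes "v \<in> \<V> p"
  obtains X where "X \<in> sections A \<V>" "X p = v"
proof -
  obtain X where X: "X \<in> vector_fields A" "X p = v" by (rule tangent_extend[OF V_tangent[OF assms]])
  show ?thesis
    by (rule that[OF vert_section[OF X(1)]]) (use X(2) vert_V[OF assms] in \<open>simp add: app_def\<close>)
qed

end

section \<open>Involutivity of the horizontal distribution\<close>

context submersion
begin

definition involutive :: bool where
  "involutive \<longleftrightarrow> (\<forall>X\<in>sections A \<H>. \<forall>Y\<in>sections A \<H>. \<forall>p. lie_bracket A X Y p \<in> \<H> p)"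

lemma section_vf: "X \<in> sections A D \<Longrightarrow> X \<in> vector_fields A"
  and section_in: "X \<in> sections A D \<Longrightarrow> X p \<in> D p"
  by (auto simp: sections_def)

section \<open>Levi-Civita calculus and the bracket identity\<close>

context
  fixes nab assumes LC: "levi_civita A g nab"
begin

lemma nab_vf: "X \<in> vector_fields A \<Longrightarrow> Y \<in> vector_fields A \<Longrightarrow> nab X Y \<in> vector_fields A"
  and nab_add: "X \<in> vector_fields A \<Longrightarrow> Y \<in> vector_fields A \<Longrightarrow> Z \<in> vector_fields A \<Longrightarrow>
    nab X (Y + Z) = nab X Y + nab X Z"
  and torsion: "X \<in> vector_fields A \<Longrightarrow> Y \<in> vector_fields A \<Longrightarrow> nab X Y - nab Y X = lie_bracket A X Y"
  and compat: "X \<in> vector_fields A \<Longrightarrow> Y \<in> vector_fields A \<Longrightarrow> Z \<in> vector_fields A \<Longrightarrow>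
    X p (\<lambda>q. g q (Y q) (Z q)) = g p (nab X Y p) (Z p) + g p (Y p) (nab X Z p)"
  using LC unfolding levi_civita_def affine_connection_def by blast+

lemma bracket_vf: "X \<in> vector_fields A \<Longrightarrow> Y \<in> vector_fields A \<Longrightarrow> lie_bracket A X Y \<in> vector_fields A"
  using torsion[of X Y] vf_diff[OF nab_vf nab_vf, of X Y Y X] by simp

lemma nab_0: "X \<in> vector_fields A \<Longrightarrow> nab X 0 = 0"
  using nab_add[OF _ vf_0 vf_0, of X] by simp

lemma oneill_vertical:
  assumes X: "X \<in> sections A \<H>" and W: "W \<in> sections A \<V>"
  shows "oneill_A A g nab \<V> X W p = hor p (nab X W p)"
proof -
  have "hor \<bullet>\<^sub>v X = X" using section_in[OF X] by (simp add: app_def hor_H)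
  moreover have "vert \<bullet>\<^sub>v W = W" using section_in[OF W] by (simp add: app_def vert_V)
  moreover have "hor \<bullet>\<^sub>v W = 0" using section_in[OF W] by (simp add: app_def hor_V zero_fun_def)
  ultimately show ?thesis
    by (simp add: oneill_A_def nab_0[OF section_vf[OF X]]) (simp add: app_def vert_V[OF V_0] fun_eq_iff)
qed

text \<open>The parallel isometry \<open>R\<close> gives
  \<open>g (nab X Y) Z = g (nab X (R Y)) (R Z)\<close>. The vertical and horizontal parts of
  \<open>R Y\<close> yield one O'Neill term each, and antisymmetrizing in \<open>X\<close> and
  \<open>Y\<close> produces the bracket because the torsion vanishes.\<close>

lemma oneill_bracket:
  assumes R: "endomorphism_field A R"
    and Rg: "\<And>p v w. v \<in> T p \<Longrightarrow> w \<in> T p \<Longrightarrow> g p (R p v) (R p w) = g p v w"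
    and par: "parallel_endomorphism A nab R"
    and anti: "\<And>p v. v \<in> \<V> p \<Longrightarrow> R p v \<in> \<H> p"
    and X: "X \<in> sections A \<H>" and Y: "Y \<in> sections A \<H>" and Z: "Z \<in> sections A \<V>"
  defines "\<A> \<equiv> oneill_A A g nab \<V>"
    and "b \<equiv> \<lambda>X. vert \<bullet>\<^sub>v R \<bullet>\<^sub>v X" and "c \<equiv> \<lambda>X. hor \<bullet>\<^sub>v R \<bullet>\<^sub>v X"
  shows "g p ((\<A> X (b Y) - \<A> Y (b X)) p) ((R \<bullet>\<^sub>v Z) p) -
      (g p (c Y p) ((R \<bullet>\<^sub>v \<A> X Z) p) - g p (c X p) ((R \<bullet>\<^sub>v \<A> Y Z) p)) =
    g p (lie_bracket A X Y p) (Z p)"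
proof -
  have Rvf: "R \<bullet>\<^sub>v X \<in> vector_fields A" if "X \<in> vector_fields A" for X
    using R that unfolding endomorphism_field_def app_def by blast
  have RT: "R p v \<in> T p" if "v \<in> T p" for p v
    using R that unfolding endomorphism_field_def by blast
  have Radd: "R p (v + w) = R p v + R p w" if "v \<in> T p" "w \<in> T p" for p v w
    using R that unfolding endomorphism_field_def by blast
  have Rscale: "R p (k *\<^sub>R v) = k *\<^sub>R R p v" if "v \<in> T p" for p v k
    using R that unfolding endomorphism_field_def by blast
  have Rdiff: "R p (v - w) = R p v - R p w" if "v \<in> T p" "w \<in> T p" for p v w
    using Radd[OF that(1) tangent_space_scaleR[OF that(2), of "-1"]] Rscale[OF that(2), of "-1"] by simp
  have nabR: "nab X (R \<bullet>\<^sub>v Y) p = R p (nab X Y p)" if "X \<in> vector_fields A" "Y \<in> vector_fields A" for X Y p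
  proof -
    have "nab X (R \<bullet>\<^sub>v Y) - R \<bullet>\<^sub>v nab X Y = 0"
      using par that unfolding parallel_endomorphism_def by blast
    then have "nab X (R \<bullet>\<^sub>v Y) = R \<bullet>\<^sub>v nab X Y" by simp
    then show ?thesis by (simp add: app_def)
  qed
  have bs: "b Y \<in> sections A \<V>" and cs: "c Y \<in> sections A \<H>" if "Y \<in> sections A \<H>" for Y
    unfolding b_def c_def using vert_section[OF Rvf] hor_section[OF Rvf] section_vf[OF that] by auto
  have bc: "R \<bullet>\<^sub>v Y = b Y + c Y" for Y
    by (simp add: b_def c_def app_def coproj_def fun_eq_iff)
  have RZ: "R \<bullet>\<^sub>v Z \<in> sections A \<H>"
    using Rvf[OF section_vf[OF Z]] anti section_in[OF Z] by (auto simp: sections_def app_def)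
  \<comment> \<open>The isometry reduces \<open>g (R Y) (R v)\<close> to \<open>g Y v = 0\<close>,
    and the part \<open>b Y\<close> contributes nothing because \<open>R v\<close> is
    horizontal.\<close>
  have orth: "g q (c Y q) (R q v) = 0" if Y: "Y \<in> sections A \<H>" and v: "v \<in> \<V> q" for Y q v
  proof -
    have Yq: "Y q \<in> \<H> q" by (rule section_in[OF Y])
    have "R q (Y q) = b Y q + c Y q" using fun_cong[OF bc[of Y], of q] by (simp add: app_def)
    moreover have "b Y q \<in> \<V> q" "c Y q \<in> \<H> q"
      using section_in[OF bs[OF Y]] section_in[OF cs[OF Y]] by auto
    ultimately have "g q (R q (Y q)) (R q v) = g q (b Y q) (R q v) + g q (c Y q) (R q v)"
      using anti[OF v] by (simp add: g_add_left V_tangent H_tangent)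
    moreover have "g q (b Y q) (R q v) = 0"
      by (rule VH_orthogonal[OF _ anti[OF v]]) fact
    moreover have "g q (R q (Y q)) (R q v) = 0"
      by (simp add: Rg[OF H_tangent[OF Yq] V_tangent[OF v]] HV_orthogonal[OF Yq v])
    ultimately show ?thesis by simp
  qed
  have first: "g p (\<A> X (b Y) p) ((R \<bullet>\<^sub>v Z) p) = g p (nab X (b Y) p) ((R \<bullet>\<^sub>v Z) p)"
    and second: "g p (c Y p) ((R \<bullet>\<^sub>v \<A> X Z) p) = - g p (nab X (c Y) p) ((R \<bullet>\<^sub>v Z) p)"
    and tan: "\<A> X (b Y) p \<in> T p"
    if X: "X \<in> sections A \<H>" and Y: "Y \<in> sections A \<H>" for X Y
  proof -
    note vf = section_vf[OF X] section_vf[OF Y] section_vf[OF Z] section_vf[OF bs[OF Y]] section_vf[OF cs[OF Y]]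
    have n: "nab X (b Y) p \<in> T p" by (rule vf_tangent[OF nab_vf[OF vf(1,4)]])
    have A: "\<A> X (b Y) p = hor p (nab X (b Y) p)"
      unfolding \<A>_def by (rule oneill_vertical[OF X bs[OF Y]])
    show "\<A> X (b Y) p \<in> T p" unfolding A by (rule H_tangent[OF hor_in[OF n]])
    have RZp: "(R \<bullet>\<^sub>v Z) p \<in> \<H> p" by (rule section_in[OF RZ])
    have "g p (nab X (b Y) p) ((R \<bullet>\<^sub>v Z) p) =
        g p (vert p (nab X (b Y) p)) ((R \<bullet>\<^sub>v Z) p) + g p (hor p (nab X (b Y) p)) ((R \<bullet>\<^sub>v Z) p)"
      using g_add_left[OF V_tangent[OF vert_in[OF n]] H_tangent[OF hor_in[OF n]] H_tangent[OF RZp]]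
      by (simp add: vert_hor)
    then show "g p (\<A> X (b Y) p) ((R \<bullet>\<^sub>v Z) p) = g p (nab X (b Y) p) ((R \<bullet>\<^sub>v Z) p)"
      unfolding A by (simp add: VH_orthogonal[OF vert_in[OF n] RZp])
    have n': "nab X Z p \<in> T p" by (rule vf_tangent[OF nab_vf[OF vf(1,3)]])
    have A': "\<A> X Z p = nab X Z p - vert p (nab X Z p)"
      unfolding \<A>_def oneill_vertical[OF X Z] by (simp add: coproj_def)
    have cT: "c Y p \<in> T p" by (rule vf_tangent[OF vf(5)])
    \<comment> \<open>The vertical part of \<open>nab X Z\<close> may be restored:
      \<open>orth\<close> applies to it, since \<open>R\<close> of a vertical vector is orthogonal
      to \<open>c Y\<close>.\<close>
    have "g p (c Y p) ((R \<bullet>\<^sub>v \<A> X Z) p) =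
        g p (c Y p) (R p (nab X Z p)) - g p (c Y p) (R p (vert p (nab X Z p)))"
      unfolding app_def A' Rdiff[OF n' V_tangent[OF vert_in[OF n']]]
      by (rule g_diff_right[OF RT[OF n'] RT[OF V_tangent[OF vert_in[OF n']]] cT])
    also have "\<dots> = g p (c Y p) (nab X (R \<bullet>\<^sub>v Z) p)"
      by (simp add: orth[OF Y vert_in[OF n']] nabR[OF vf(1,3)])
    also have "\<dots> = - g p (nab X (c Y) p) ((R \<bullet>\<^sub>v Z) p)"
    proof -
      \<comment> \<open>The pairing of \<open>c Y\<close> with \<open>R Z\<close> is identically
        zero, so metric compatibility moves the derivative across at the cost of a sign.\<close>
      have "(\<lambda>q. g q (c Y q) ((R \<bullet>\<^sub>v Z) q)) = (\<lambda>q. 0)"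
        using orth[OF Y section_in[OF Z]] by (simp add: app_def)
      then show ?thesis
        using compat[OF vf(1,5) section_vf[OF RZ], of p] tangent_const[OF vf_tangent[OF vf(1)], of p 0]
        by simp
    qed
    finally show "g p (c Y p) ((R \<bullet>\<^sub>v \<A> X Z) p) = - g p (nab X (c Y) p) ((R \<bullet>\<^sub>v Z) p)" .
  qed
  have sum: "g p (nab X (b Y) p) ((R \<bullet>\<^sub>v Z) p) + g p (nab X (c Y) p) ((R \<bullet>\<^sub>v Z) p) = g p (nab X Y p) (Z p)"
    if X: "X \<in> sections A \<H>" and Y: "Y \<in> sections A \<H>" for X Y
  proof -
    note vf = section_vf[OF X] section_vf[OF Y] section_vf[OF Z] section_vf[OF bs[OF Y]] section_vf[OF cs[OF Y]]
    have "R p (nab X Y p) = nab X (b Y) p + nab X (c Y) p"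
      unfolding nabR[OF vf(1,2), symmetric] bc[of Y] nab_add[OF vf(1,4,5)] by simp
    then have "g p (nab X (b Y) p) ((R \<bullet>\<^sub>v Z) p) + g p (nab X (c Y) p) ((R \<bullet>\<^sub>v Z) p) = g p (R p (nab X Y p)) (R p (Z p))"
      using g_add_left[OF vf_tangent[OF nab_vf[OF vf(1,4)]] vf_tangent[OF nab_vf[OF vf(1,5)]] vf_tangent[OF section_vf[OF RZ]]]
      by (simp add: app_def)
    then show ?thesis
      by (simp add: Rg[OF vf_tangent[OF nab_vf[OF vf(1,2)]] vf_tangent[OF vf(3)]])
  qed
  have "g p ((\<A> X (b Y) - \<A> Y (b X)) p) ((R \<bullet>\<^sub>v Z) p) =
      g p (\<A> X (b Y) p) ((R \<bullet>\<^sub>v Z) p) - g p (\<A> Y (b X) p) ((R \<bullet>\<^sub>v Z) p)"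
    using g_diff_left[OF tan[OF X Y] tan[OF Y X] vf_tangent[OF section_vf[OF RZ]]] by simp
  moreover have "g p (lie_bracket A X Y p) (Z p) = g p (nab X Y p) (Z p) - g p (nab Y X p) (Z p)"
    using g_diff_left[OF vf_tangent[OF nab_vf] vf_tangent[OF nab_vf] vf_tangent, of X Y Y X Z p]
      section_vf[OF X] section_vf[OF Y] section_vf[OF Z]
    by (simp add: torsion[symmetric])
  ultimately show ?thesis
    using first[OF X Y] first[OF Y X] second[OF X Y] second[OF Y X] sum[OF X Y] sum[OF Y X] by simp
qed

text \<open>Testing against vertical sections is as good as testing against vertical vectors, since
  each such vector extends to a section by \<open>V_extend\<close>.\<close>

lemma involutive_iff:
  "involutive \<longleftrightarrow> (\<forall>Z\<in>sections A \<V>. \<forall>X\<in>sections A \<H>. \<forall>Y\<in>sections A \<H>. \<forall>p.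
    g p (lie_bracket A X Y p) (Z p) = 0)" (is "_ \<longleftrightarrow> ?R")
proof
  assume "involutive"
  then show ?R unfolding involutive_def using HV_orthogonal section_in by blast
next
  assume R: ?R
  show involutive unfolding involutive_def
  proof (intro ballI allI)
    fix X Y p assume X: "X \<in> sections A \<H>" and Y: "Y \<in> sections A \<H>"
    have "g p (lie_bracket A X Y p) v = 0" if v: "v \<in> \<V> p" for v
    proof -
      obtain Z where "Z \<in> sections A \<V>" "Z p = v" by (rule V_extend[OF v])
      then show ?thesis using R X Y by blast
    qed
    then show "lie_bracket A X Y p \<in> \<H> p"
      using vf_tangent[OF bracket_vf] section_vf[OF X] section_vf[OF Y] by (auto simp: horizontal_iff)
  qed
qed


subsection \<open>Integral manifolds\<close>

text \<open>For vertical \<open>Z\<close> the one-form \<open>g(Z, -)\<close> is a combination \<open>\<Sum>b. a b * d (x b)\<close> near \<open>p\<close> and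
  vanishes on an integral manifold. Differentiating its pull-back and antisymmetrizing shows that
  it also kills brackets of horizontal fields.\<close>

lemma integrable_imp_involutive:
  assumes "integrable_distribution TYPE('k::euclidean_space) A \<H>"
  shows involutive
  unfolding involutive_def
proof (intro ballI allI)
  fix X Y p assume X: "X \<in> sections A \<H>" and Y: "Y \<in> sections A \<H>"
  have bT: "lie_bracket A X Y p \<in> T p"
    by (rule vf_tangent[OF bracket_vf[OF section_vf[OF X] section_vf[OF Y]]])
  have "g p (lie_bracket A X Y p) v = 0" if v: "v \<in> \<V> p" for v
  proof -
    obtain Z where Z: "Z \<in> sections A \<V>" "Z p = v" by (rule V_extend[OF v])
    have "\<exists>(U::'k set) s. integral_manifold A \<H> U s \<and> p \<in> s ` U"
      using assms unfolding integrable_distribution_def by blast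
    then obtain U s u where im: "integral_manifold A \<H> U s" and u: "(u::'k) \<in> U" "s u = p" by blast
    have U: "open U" "continuous_on U s"
      and range: "\<And>u. u \<in> U \<Longrightarrow> range (param_differential A s u) = \<H> (s u)"
      using im unfolding integral_manifold_def by auto
    obtain V \<phi> where c: "(V, \<phi>) \<in> A" "p \<in> V" by (rule chart_exists)
    obtain x W1 where x: "open W1" "p \<in> W1" "W1 \<subseteq> V" "\<And>b. x b \<in> SF" "\<And>b q. q \<in> W1 \<Longrightarrow> x b q = \<phi> q \<bullet> b"
      by (rule chart_coordinates[OF c]) (rule that)
    obtain \<eta> W2 where \<eta>: "cutoff p V \<eta> W2" by (rule cutoff_exists[OF chart_open[OF c(1)] c(2)])
    \<comment> \<open>Cutting off the coordinate fields makes the coefficients \<open>a b\<close>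
      global functions, on which tangent vectors can act.\<close>
    define D where "D b q = (if q \<in> V then \<eta> q *\<^sub>R chart_vector A V \<phi> q b else 0)" for b q
    have Dvf: "D b \<in> vector_fields A" for b
      using vf_on_cutoff[OF \<eta> chart_open[OF c(1)] chart_vector_field[OF c(1)], of b] by (simp add: D_def[abs_def])
    define W where "W = W1 \<inter> W2"
    have W: "open W" "p \<in> W" "W \<subseteq> V" "W \<subseteq> W1" "\<And>q. q \<in> W \<Longrightarrow> \<eta> q = 1"
      using \<eta> x by (auto simp: W_def cutoff_def)
    have DW: "D b q = chart_vector A V \<phi> q b" if "q \<in> W" for b q
      using W that by (auto simp: D_def)
    define a where "a b q = g q (Z q) (D b q)" for b q
    have a: "a b \<in> SF" for b
      using g_smooth[OF section_vf[OF Z(1)] Dvf] by (simp add: a_def[abs_def])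
    have form: "g q (Z q) w = (\<Sum>b\<in>Basis. a b q * w (x b))" if q: "q \<in> W" and w: "w \<in> T q" for q w
    proof -
      have qV: "q \<in> V" using q W by auto
      have "w = chart_vector A V \<phi> q (\<Sum>b\<in>Basis. w (x b) *\<^sub>R b)"
        by (rule tangent_chart_expansion[OF c(1) _ x(1,3) w]) (use x W q in auto)
      then have "w = (\<Sum>b\<in>Basis. w (x b) *\<^sub>R D b q)"
        by (simp add: chart_vector_sum[OF c(1) qV] DW[OF q])
      then have "g q (Z q) w = g q (Z q) (\<Sum>b\<in>Basis. w (x b) *\<^sub>R D b q)" by simp
      also have "\<dots> = (\<Sum>b\<in>Basis. w (x b) * a b q)"
        unfolding a_def by (intro g_sum_right vf_tangent[OF Dvf] vf_tangent[OF section_vf[OF Z(1)]])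
      finally show ?thesis by (simp add: mult.commute)
    qed
    \<comment> \<open>For horizontal \<open>Y'\<close> the function \<open>g(Z, Y')\<close> vanishes
      identically; on \<open>W\<close> it has this coordinate expression, which is differentiated
      along \<open>X'\<close>.\<close>
    have along: "(\<Sum>b\<in>Basis. X' p (a b) * Y' p (x b) + a b p * X' p (\<lambda>q. Y' q (x b))) = 0"
      if X': "X' \<in> sections A \<H>" and Y': "Y' \<in> sections A \<H>" for X' Y'
    proof -
      note X'T = vf_tangent[OF section_vf[OF X'], of p]
      have Y'x: "(\<lambda>q. Y' q (x b)) \<in> SF" for b by (rule vf_apply[OF section_vf[OF Y'] x(4)])
      have "X' p (\<lambda>q. \<Sum>b\<in>Basis. a b q * Y' q (x b)) = X' p (\<lambda>q. 0)"
      proof (rule tangent_local[OF X'T _ SF_const W(1,2)])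
        show "(\<lambda>q. \<Sum>b\<in>Basis. a b q * Y' q (x b)) \<in> SF" by (intro SF_sum SF_mult a Y'x) auto
        show "(\<Sum>b\<in>Basis. a b q * Y' q (x b)) = 0" if "q \<in> W" for q
          using form[OF that vf_tangent[OF section_vf[OF Y']]]
            VH_orthogonal[OF section_in[OF Z(1)] section_in[OF Y']] by simp
      qed
      then show ?thesis
        by (simp add: tangent_const[OF X'T] tangent_sum[OF X'T] tangent_mult[OF X'T] SF_mult a Y'x)
    qed
    have par: "param_differential A s u' w f = frechet_derivative (f \<circ> s) (at u') w" if "f \<in> SF" for u' w f
      using that by (simp add: param_differential_def)
    define U' where "U' = U \<inter> s -` W"
    have U': "open U'" "u \<in> U'"
      unfolding U'_def using continuous_open_preimage[OF U(2,1) W(1)] u W(2) by auto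
    have smooth_s: "smooth_on U' (f \<circ> s)" if f: "f \<in> SF" for f
    proof -
      have "smooth_on U' (\<lambda>z. (f \<circ> inv_into V \<phi>) ((\<phi> \<circ> s) z))"
      proof (rule smooth_on_compose[OF U'(1) chart_open_image[OF c(1)] _ SF_chartD[OF f c(1)]])
        show "(\<phi> \<circ> s) ` U' \<subseteq> \<phi> ` V" using W by (auto simp: U'_def)
        have "smooth_on (U \<inter> s -` V) (\<phi> \<circ> s)"
          using im c(1) unfolding integral_manifold_def by fast
        then show "smooth_on U' (\<phi> \<circ> s)"
          by (rule smooth_on_subset) (use W in \<open>auto simp: U'_def\<close>)
      qed
      then show ?thesis
        by (rule smooth_on_cong[OF U'(1), rotated]) (use W chart_inv[OF c(1)] in \<open>auto simp: U'_def\<close>)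
    qed
    define d where "d f \<xi> = frechet_derivative (f \<circ> s) (at u) \<xi>" for f :: "'a \<Rightarrow> real" and \<xi>
    define dd where "dd f \<xi> \<zeta> = frechet_derivative (\<lambda>u. frechet_derivative (f \<circ> s) (at u) \<xi>) (at u) \<zeta>"
      for f :: "'a \<Rightarrow> real" and \<xi> \<zeta>
    \<comment> \<open>The pulled-back form evaluated on the constant vector \<open>\<zeta>\<close>
      vanishes on all of \<open>U'\<close>. Its derivative at \<open>u\<close> in direction
      \<open>\<xi>\<close> is this expression.\<close>
    have closed: "(\<Sum>b\<in>Basis. d (a b) \<xi> * d (x b) \<zeta> + a b p * dd (x b) \<zeta> \<xi>) = 0" for \<xi> \<zeta>
    proof -
      have "((\<lambda>u. \<Sum>b\<in>Basis. (a b \<circ> s) u * frechet_derivative (x b \<circ> s) (at u) \<zeta>) has_derivative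
          (\<lambda>\<xi>. \<Sum>b\<in>Basis. (a b \<circ> s) u * dd (x b) \<zeta> \<xi> + d (a b) \<xi> * d (x b) \<zeta>)) (at u)"
        unfolding d_def dd_def
        by (intro has_derivative_sum has_derivative_mult smooth_on_has_derivative[OF smooth_s U'(2)]
            smooth_on_has_derivative[OF smooth_on_frechet_derivative[OF smooth_s] U'(2)] a x(4))
      moreover have "((\<lambda>u. \<Sum>b\<in>Basis. (a b \<circ> s) u * frechet_derivative (x b \<circ> s) (at u) \<zeta>) has_derivative
          (\<lambda>\<xi>. 0)) (at u)"
      proof (rule has_derivative_transform_within_open[OF has_derivative_const U'])
        fix u' assume u': "u' \<in> U'"
        have "param_differential A s u' \<zeta> \<in> \<H> (s u')"
          using range[of u'] u' by (auto simp: U'_def)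
        then have "g (s u') (Z (s u')) (param_differential A s u' \<zeta>) = 0"
            and "param_differential A s u' \<zeta> \<in> T (s u')"
          using VH_orthogonal[OF section_in[OF Z(1)]] H_tangent by auto
        with form[of "s u'" "param_differential A s u' \<zeta>"] u'
        show "0 = (\<Sum>b\<in>Basis. (a b \<circ> s) u' * frechet_derivative (x b \<circ> s) (at u') \<zeta>)"
          by (simp add: U'_def par[OF x(4)])
      qed
      ultimately have "(\<lambda>\<xi>. \<Sum>b\<in>Basis. (a b \<circ> s) u * dd (x b) \<zeta> \<xi> + d (a b) \<xi> * d (x b) \<zeta>) = (\<lambda>\<xi>. 0)"
        by (rule has_derivative_unique)
      from fun_cong[OF this, of \<xi>] show ?thesis by (simp add: u(2) add.commute)
    qed
    have dd_sym: "dd (x b) \<zeta> \<xi> = dd (x b) \<xi> \<zeta>" for b \<xi> \<zeta>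
      unfolding dd_def using smooth_s[OF x(4)] second_derivative_symmetric[OF U']
      by (auto simp: smooth_on_def)
    \<comment> \<open>Only the values of \<open>X\<close> and \<open>Y\<close> at \<open>p\<close>
      are lifted to the parameter space; no lift of the fields themselves is required.\<close>
    obtain \<xi> where \<xi>: "X p = param_differential A s u \<xi>"
      using range[OF u(1)] section_in[OF X, of p] u(2) by auto
    obtain \<zeta> where \<zeta>: "Y p = param_differential A s u \<zeta>"
      using range[OF u(1)] section_in[OF Y, of p] u(2) by auto
    have Xd: "X p f = d f \<xi>" "Y p f = d f \<zeta>" if "f \<in> SF" for f
      unfolding \<xi> \<zeta> d_def by (simp_all add: par[OF that])
    have "g p (Z p) (lie_bracket A X Y p) = (\<Sum>b\<in>Basis. a b p * (X p (\<lambda>q. Y q (x b)) - Y p (\<lambda>q. X q (x b))))"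
      by (simp add: form[OF W(2) bT]) (simp add: lie_bracket_def x(4))
    \<comment> \<open>\<open>along\<close> trades the iterated derivatives of \<open>x b\<close> for
      first derivatives of \<open>a b\<close>. These depend only on \<open>\<xi>\<close> and
      \<open>\<zeta>\<close>, and \<open>closed\<close> with the symmetry \<open>dd_sym\<close>
      shows that they cancel.\<close>
    also have "\<dots> = (\<Sum>b\<in>Basis. Y p (a b) * X p (x b)) - (\<Sum>b\<in>Basis. X p (a b) * Y p (x b))"
      using along[OF X Y] along[OF Y X] by (simp add: sum.distrib sum_subtractf right_diff_distrib)
    also have "\<dots> = (\<Sum>b\<in>Basis. d (a b) \<zeta> * d (x b) \<xi>) - (\<Sum>b\<in>Basis. d (a b) \<xi> * d (x b) \<zeta>)"
      by (simp add: Xd a x(4))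
    also have "\<dots> = 0"
      using closed[of \<xi> \<zeta>] closed[of \<zeta> \<xi>] by (simp add: sum.distrib dd_sym[of _ \<zeta> \<xi>])
    finally show ?thesis
      using g_sym[OF V_tangent[OF v] bT] Z(2) by simp
  qed
  then show "lie_bracket A X Y p \<in> \<H> p" using bT by (simp add: horizontal_iff)
qed

text \<open>The horizontal lifts of coordinate fields commute, so an integral manifold solves a total
  differential equation.\<close>

lemma involutive_imp_integrable:
  assumes inv: involutive
  shows "integrable_distribution TYPE('f) A \<H>"
  unfolding integrable_distribution_def
proof
  fix p
  obtain W0 y L0 where fr: "p \<in> W0" "horizontal_frame W0 y L0" by (rule horizontal_frame_exists)
  then have W0: "open W0" and y: "\<And>i. y i \<in> N.SF"
    and L0: "\<And>i. i \<in> Basis \<Longrightarrow> L0 i \<in> vector_fields_on A W0"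
    and L0H: "\<And>q i. q \<in> W0 \<Longrightarrow> i \<in> Basis \<Longrightarrow> L0 i q \<in> \<H> q"
    and L0y: "\<And>q i j. q \<in> W0 \<Longrightarrow> i \<in> Basis \<Longrightarrow> j \<in> Basis \<Longrightarrow> L0 i q (y j \<circ> F) = (if i = j then 1 else 0)"
    and vertW0: "\<And>q v. q \<in> W0 \<Longrightarrow> v \<in> T q \<Longrightarrow> (\<And>j. j \<in> Basis \<Longrightarrow> v (y j \<circ> F) = 0) \<Longrightarrow> v \<in> \<V> q"
    by (auto simp: horizontal_frame_def)
  obtain U \<phi> where c: "(U, \<phi>) \<in> A" "p \<in> U" by (rule chart_exists)
  obtain x W1 where x: "open W1" "p \<in> W1" "W1 \<subseteq> U" "\<And>b. x b \<in> SF" "\<And>b q. q \<in> W1 \<Longrightarrow> x b q = \<phi> q \<bullet> b"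
    by (rule chart_coordinates[OF c]) (rule that)
  obtain \<eta> W2 where \<eta>: "cutoff p W0 \<eta> W2" by (rule cutoff_exists[OF W0 fr(1)])
  \<comment> \<open>Involutivity concerns global sections, so the frame is cut off; its identities
    are used on \<open>W\<close> only, where the cut-off function is 1.\<close>
  define L where "L i q = (if q \<in> W0 then \<eta> q *\<^sub>R L0 i q else 0)" for i q
  define W where "W = W1 \<inter> W2"
  have W: "open W" "p \<in> W" "W \<subseteq> U" "W \<subseteq> W0" "W \<subseteq> W1" "\<And>q. q \<in> W \<Longrightarrow> \<eta> q = 1"
    using \<eta> x by (auto simp: W_def cutoff_def)
  have LL0: "L i q = L0 i q" if "q \<in> W" for i q using W that by (auto simp: L_def)
  have Lvf: "L i \<in> vector_fields A" if "i \<in> Basis" for i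
    using vf_on_cutoff[OF \<eta> W0 L0[OF that]] by (simp add: L_def[abs_def])
  have Ls: "L i \<in> sections A \<H>" if "i \<in> Basis" for i
    unfolding sections_def using Lvf[OF that] L0H[OF _ that] by (auto simp: L_def H_0 intro: H_scale)
  have Ly: "L i q (y j \<circ> F) = (if i = j then 1 else 0)" if "q \<in> W" "i \<in> Basis" "j \<in> Basis" for q i j
    using that W by (simp add: LL0 L0y subset_iff)
  have yF: "y j \<circ> F \<in> SF" for j by (rule SF_pullback[OF y])
  have commute: "L i q (\<lambda>q. L j q f) = L j q (\<lambda>q. L i q f)"
    if q: "q \<in> W" and ij: "i \<in> Basis" "j \<in> Basis" and f: "f \<in> SF" for i j q f
  proof -
    have bT: "lie_bracket A (L i) (L j) q \<in> T q"
      by (rule vf_tangent[OF bracket_vf[OF Lvf[OF ij(1)] Lvf[OF ij(2)]]])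
    \<comment> \<open>Locally \<open>L j\<close> applied to \<open>y k \<circ> F\<close> is
      constant, so the bracket kills all the functions \<open>y k \<circ> F\<close> and is
      vertical.\<close>
    have Lk: "L i q (\<lambda>q. L j q (y k \<circ> F)) = 0" if ij: "i \<in> Basis" "j \<in> Basis" and k: "k \<in> Basis" for i j k
    proof -
      have "L i q (\<lambda>q. L j q (y k \<circ> F)) = L i q (\<lambda>q. if j = k then 1 else 0)"
        by (rule tangent_local[OF vf_tangent[OF Lvf[OF ij(1)]] vf_apply[OF Lvf[OF ij(2)] yF] SF_const W(1) q])
          (simp add: Ly[OF _ ij(2) k])
      then show ?thesis by (simp add: tangent_const[OF vf_tangent[OF Lvf[OF ij(1)]]])
    qed
    have "lie_bracket A (L i) (L j) q \<in> \<V> q"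
      by (rule vertW0[OF _ bT]) (use q W in \<open>auto simp: lie_bracket_def yF Lk ij\<close>)
    moreover have "lie_bracket A (L i) (L j) q \<in> \<H> q"
      using inv Ls ij unfolding involutive_def by blast
    ultimately have "lie_bracket A (L i) (L j) q = 0" using HV_trivial by blast
    then have "lie_bracket A (L i) (L j) q f = 0" by simp
    then show ?thesis using f by (simp add: lie_bracket_def)
  qed
  define m where "m i b = (\<lambda>q. L i q (x b)) \<circ> inv_into U \<phi>" for i b
  define Z where "Z = \<phi> ` (U \<inter> W)"
  have Z: "open Z" "\<phi> p \<in> Z" unfolding Z_def using chart_image_open[OF c(1) W(1)] c W by auto
  have LxSF: "(\<lambda>q. L i q (x b)) \<in> SF" if "i \<in> Basis" for i b by (rule vf_apply[OF Lvf[OF that] x(4)])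
  have m_smooth: "smooth_on Z (m i b)" if "i \<in> Basis" for i b
    unfolding m_def Z_def by (rule smooth_on_subset[OF SF_chartD[OF LxSF[OF that] c(1)]]) auto
  \<comment> \<open>Matrix units: \<open>\<Lambda> z\<close> is assembled from them so that it sends
    the basis vector \<open>i\<close> to the coordinate expression of \<open>L i\<close>.\<close>
  define K where "K i b = Blinfun (\<lambda>w. (w \<bullet> i) *\<^sub>R b)" for i :: 'f and b :: 'e
  have K: "K i b w = (w \<bullet> i) *\<^sub>R b" for i b w
    unfolding K_def by (subst bounded_linear_Blinfun_apply) (auto intro: bounded_linear_intros)
  define \<Lambda> where "\<Lambda> z = (\<Sum>i\<in>Basis. \<Sum>b\<in>Basis. m i b z *\<^sub>R K i b)" for z
  define D where "D z = Blinfun (\<lambda>u. \<Sum>i\<in>Basis. \<Sum>b\<in>Basis. frechet_derivative (m i b) (at z) u *\<^sub>R K i b)" for z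
  have blD: "bounded_linear (\<lambda>u. \<Sum>i\<in>Basis. \<Sum>b\<in>Basis. frechet_derivative (m i b) (at z) u *\<^sub>R K i b)"
    if "z \<in> Z" for z
    by (intro bounded_linear_sum bounded_linear_scaleR_const
        has_derivative_bounded_linear[OF smooth_on_has_derivative[OF m_smooth that]])
  have D: "blinfun_apply (D z) = (\<lambda>u. \<Sum>i\<in>Basis. \<Sum>b\<in>Basis. frechet_derivative (m i b) (at z) u *\<^sub>R K i b)"
    if "z \<in> Z" for z
    unfolding D_def by (rule bounded_linear_Blinfun_apply[OF blD[OF that]])
  have \<Lambda>_apply: "\<Lambda> z w = (\<Sum>i\<in>Basis. (w \<bullet> i) *\<^sub>R (\<Sum>b\<in>Basis. m i b z *\<^sub>R b))" for z w
    unfolding \<Lambda>_def by (simp add: blinfun.sum_left blinfun.scaleR_left K scaleR_sum_right mult.commute)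
  have L_chart: "L i q = chart_vector A U \<phi> q (\<Sum>b\<in>Basis. m i b (\<phi> q) *\<^sub>R b)"
    if q: "q \<in> W" and i: "i \<in> Basis" for q i
  proof -
    have "L i q = chart_vector A U \<phi> q (\<Sum>b\<in>Basis. L i q (x b) *\<^sub>R b)"
      by (rule tangent_chart_expansion[OF c(1) _ x(1,3) vf_tangent[OF Lvf[OF i]]]) (use x W q in auto)
    moreover have "m i b (\<phi> q) = L i q (x b)" for b
      using q W by (auto simp: m_def chart_inv[OF c(1)])
    ultimately show ?thesis by simp
  qed
  have \<Lambda>_chart: "chart_vector A U \<phi> q (\<Lambda> (\<phi> q) w) = (\<Sum>i\<in>Basis. (w \<bullet> i) *\<^sub>R L i q)" if q: "q \<in> W" for q w
  proof -
    have lin: "linear (chart_vector A U \<phi> q)" using q W by (intro linear_chart_vector[OF c(1)]) auto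
    show ?thesis unfolding \<Lambda>_apply
      by (simp add: linear_sum[OF lin] linear_cmul[OF lin] L_chart[OF q] cong: sum.cong)
  qed
  have derL: "frechet_derivative (m i b) (at (\<phi> q)) (\<Lambda> (\<phi> q) w) = (\<Sum>j\<in>Basis. (w \<bullet> j) * L j q (\<lambda>q. L i q (x b)))"
    if q: "q \<in> W" and i: "i \<in> Basis" for q i b w
    using fun_cong[OF \<Lambda>_chart[OF q, of w], of "\<lambda>q. L i q (x b)"] LxSF[OF i, of b]
    by (simp add: chart_vector_def m_def sum_fun_apply scaleR_fun_apply)
  \<comment> \<open>Differentiating \<open>\<Lambda>\<close> along its own values gives the iterated
    derivatives \<open>L j (L i (x b))\<close>, so compatibility of the system is exactly that the
    lifts commute on coordinates.\<close>
  have sym: "D z (\<Lambda> z v) w = D z (\<Lambda> z w) v" if z: "z \<in> Z" for z v w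
  proof -
    obtain q where q: "q \<in> W" "z = \<phi> q" using z by (auto simp: Z_def)
    have e: "D z (\<Lambda> z v) w = (\<Sum>i\<in>Basis. \<Sum>b\<in>Basis. \<Sum>j\<in>Basis. ((v \<bullet> j) * (w \<bullet> i) * L j q (\<lambda>q. L i q (x b))) *\<^sub>R b)" for v w
      by (simp add: D[OF z]) (simp add: blinfun.sum_left blinfun.scaleR_left K q(2) derL[OF q(1)]
          sum_distrib_left scaleR_sum_left mult_ac cong: sum.cong)
    have "(\<Sum>i\<in>Basis. \<Sum>b\<in>Basis. \<Sum>j\<in>Basis. ((v \<bullet> j) * (w \<bullet> i) * L j q (\<lambda>q. L i q (x b))) *\<^sub>R b) =
        (\<Sum>b\<in>Basis. \<Sum>i\<in>Basis. \<Sum>j\<in>Basis. ((v \<bullet> j) * (w \<bullet> i) * L j q (\<lambda>q. L i q (x b))) *\<^sub>R b)"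
      by (rule sum.swap)
    also have "\<dots> = (\<Sum>b\<in>Basis. \<Sum>j\<in>Basis. \<Sum>i\<in>Basis. ((v \<bullet> j) * (w \<bullet> i) * L j q (\<lambda>q. L i q (x b))) *\<^sub>R b)"
      by (intro sum.cong refl sum.swap)
    also have "\<dots> = (\<Sum>b\<in>Basis. \<Sum>j\<in>Basis. \<Sum>i\<in>Basis. ((w \<bullet> i) * (v \<bullet> j) * L i q (\<lambda>q. L j q (x b))) *\<^sub>R b)"
      by (intro sum.cong refl) (simp add: commute[OF q(1) _ _ x(4)] mult.commute)
    also have "\<dots> = (\<Sum>j\<in>Basis. \<Sum>b\<in>Basis. \<Sum>i\<in>Basis. ((w \<bullet> i) * (v \<bullet> j) * L i q (\<lambda>q. L j q (x b))) *\<^sub>R b)"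
      by (rule sum.swap)
    finally show ?thesis unfolding e .
  qed
  have der\<Lambda>: "(\<Lambda> has_derivative blinfun_apply (D z)) (at z)" if z: "z \<in> Z" for z
    unfolding D[OF z] \<Lambda>_def[abs_def]
    by (intro has_derivative_sum has_derivative_scaleR_left smooth_on_has_derivative[OF m_smooth z])
  have contD: "continuous_on Z D"
  proof (rule continuous_on_blinfun_componentwise)
    fix u :: 'e
    have "continuous_on Z (\<lambda>z. \<Sum>i\<in>Basis. \<Sum>b\<in>Basis. frechet_derivative (m i b) (at z) u *\<^sub>R K i b)"
      by (intro continuous_on_sum continuous_on_scaleR continuous_on_const
          smooth_on_imp_continuous_on[OF smooth_on_frechet_derivative[OF m_smooth]])
    then show "continuous_on Z (\<lambda>z. D z u)"
      by (rule continuous_on_eq) (simp add: D)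
  qed
  obtain s r where r: "r > 0" and s0: "s 0 = \<phi> p" and sZ: "\<And>u. u \<in> ball 0 r \<Longrightarrow> s u \<in> Z"
    and sd: "\<And>u. u \<in> ball 0 r \<Longrightarrow> (s has_derivative blinfun_apply (\<Lambda> (s u))) (at u)"
    by (rule total_differential_equation[OF Z der\<Lambda> contD sym]) (assumption, assumption, rule that)
  \<comment> \<open>Bootstrapping: the derivative \<open>\<Lambda> (s u)\<close> is as regular as
    \<open>s\<close>, so each step gains one order.\<close>
  have s_smooth: "smooth_on (ball 0 r) s"
    unfolding smooth_on_def
  proof
    fix k show "Ck_on k s (ball 0 r)"
    proof (induction k)
      case 0
      show ?case using sd by (auto intro!: continuous_at_imp_continuous_on has_derivative_continuous)
    next
      case (Suc k)
      have "Ck_on k (\<lambda>u. m i b (s u)) (ball 0 r)" if "i \<in> Basis" for i b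
        using m_smooth[OF that] sZ unfolding smooth_on_def
        by (intro Ck_on_compose[OF open_ball Z(1) _ _ Suc]) auto
      then have "Ck_on k (\<lambda>u. \<Sum>i\<in>Basis. \<Sum>b\<in>Basis. m i b (s u) *\<^sub>R ((v \<bullet> i) *\<^sub>R b)) (ball 0 r)" for v
        by (intro Ck_on_sum Ck_on_bilinear[OF bounded_bilinear_scaleR] Ck_on_const open_ball finite_Basis)
      then show ?case
        by (intro Ck_on_SucI[OF open_ball sd])
          (auto simp: \<Lambda>_def blinfun.sum_left blinfun.scaleR_left K)
    qed
  qed
  define \<sigma> where "\<sigma> u = inv_into U \<phi> (s u)" for u
  have \<sigma>: "\<sigma> u \<in> W" "\<phi> (\<sigma> u) = s u" if "u \<in> ball 0 r" for u
    using sZ[OF that] chart_inv_in[OF c(1)] chart_inv_right[OF c(1)] unfolding \<sigma>_def Z_def by auto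
  have par: "param_differential A \<sigma> u w = (\<Sum>i\<in>Basis. (w \<bullet> i) *\<^sub>R L i (\<sigma> u))" if u: "u \<in> ball 0 r" for u w
  proof -
    have "param_differential A \<sigma> u w = chart_vector A U \<phi> (\<sigma> u) (\<Lambda> (\<phi> (\<sigma> u)) w)"
    proof
      fix f
      have "frechet_derivative (f \<circ> \<sigma>) (at u) w = frechet_derivative (f \<circ> inv_into U \<phi>) (at (s u)) (\<Lambda> (s u) w)"
        if f: "f \<in> SF"
      proof -
        have "frechet_derivative (\<lambda>u. (f \<circ> inv_into U \<phi>) (s u)) (at u) w =
            frechet_derivative (f \<circ> inv_into U \<phi>) (at (s u)) (\<Lambda> (s u) w)"
          using sZ[OF u] by (intro frechet_derivative_compose_smooth[OF SF_chartD[OF f c(1)] _ sd[OF u]])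
            (auto simp: Z_def)
        then show ?thesis by (simp add: \<sigma>_def[abs_def] o_def)
      qed
      then show "param_differential A \<sigma> u w f = chart_vector A U \<phi> (\<sigma> u) (\<Lambda> (\<phi> (\<sigma> u)) w) f"
        by (simp add: param_differential_def chart_vector_def \<sigma>(2)[OF u])
    qed
    then show ?thesis by (simp add: \<Lambda>_chart[OF \<sigma>(1)[OF u]])
  qed
  \<comment> \<open>In the coordinates \<open>y j\<close> of the base,
    \<open>F \<circ> \<sigma>\<close> has the identity as its derivative. This gives injectivity of
    both \<open>\<sigma>\<close> and its differentials.\<close>
  have pary: "param_differential A \<sigma> u w (y j \<circ> F) = w \<bullet> j" if u: "u \<in> ball 0 r" and j: "j \<in> Basis" for u w j
  proof -
    have "(\<Sum>i\<in>Basis. (w \<bullet> i) * L i (\<sigma> u) (y j \<circ> F)) = (\<Sum>i\<in>Basis. if i = j then w \<bullet> j else 0)"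
      by (intro sum.cong refl) (simp add: Ly[OF \<sigma>(1)[OF u] _ j])
    then show ?thesis using j by (simp add: par[OF u] sum_fun_apply scaleR_fun_apply)
  qed
  have "inj_on \<sigma> (ball 0 r)"
  proof (rule inj_onI)
    fix u u' assume u: "u \<in> ball 0 r" "u' \<in> ball 0 r" and eq: "\<sigma> u = \<sigma> u'"
    show "u = u'"
    proof (rule euclidean_eqI)
      fix j :: 'f assume j: "j \<in> Basis"
      \<comment> \<open>This difference has zero derivative on the convex ball and is therefore
        constant, so equal values of \<open>\<sigma>\<close> force equal components.\<close>
      define k where "k u = ((y j \<circ> F) \<circ> \<sigma>) u - u \<bullet> j" for u
      have "(k has_derivative (\<lambda>w. 0)) (at v within ball 0 r)" if v: "v \<in> ball 0 r" for v
      proof -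
        have "((\<lambda>u. ((y j \<circ> F) \<circ> inv_into U \<phi>) (s u)) has_derivative
            (\<lambda>w. frechet_derivative ((y j \<circ> F) \<circ> inv_into U \<phi>) (at (s v)) (\<Lambda> (s v) w))) (at v)"
          using sZ[OF v] by (intro has_derivative_compose[OF sd[OF v]]
              smooth_on_has_derivative[OF SF_chartD[OF yF c(1)]]) (auto simp: Z_def)
        then have d: "((y j \<circ> F) \<circ> \<sigma> has_derivative
            (\<lambda>w. frechet_derivative ((y j \<circ> F) \<circ> inv_into U \<phi>) (at (s v)) (\<Lambda> (s v) w))) (at v)"
          by (simp add: \<sigma>_def[abs_def] o_def)
        have "(\<lambda>w. frechet_derivative ((y j \<circ> F) \<circ> inv_into U \<phi>) (at (s v)) (\<Lambda> (s v) w)) = (\<lambda>w. w \<bullet> j)"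
          using frechet_derivative_at[OF d] pary[OF v j] by (simp add: param_differential_def yF fun_eq_iff)
        with d have "((y j \<circ> F) \<circ> \<sigma> has_derivative (\<lambda>w. w \<bullet> j)) (at v)" by simp
        from has_derivative_diff[OF this, of "\<lambda>u. u \<bullet> j" "\<lambda>w. w \<bullet> j"]
        have "(k has_derivative (\<lambda>w. 0)) (at v)"
          by (simp add: k_def[abs_def] bounded_linear_imp_has_derivative bounded_linear_inner_left)
        then show ?thesis by (rule has_derivative_at_withinI)
      qed
      from has_derivative_zero_unique[OF convex_ball this u(2) u(1)]
      have "k u = k u'" by simp
      then show "u \<bullet> j = u' \<bullet> j" using eq by (simp add: k_def)
    qed
  qed
  moreover have \<sigma>_cont: "continuous_on (ball 0 r) \<sigma>"
    unfolding \<sigma>_def[abs_def]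
  proof (rule continuous_on_compose2[OF chart_inv_cont[OF c(1)] smooth_on_imp_continuous_on[OF s_smooth]])
    have "Z \<subseteq> \<phi> ` U" by (auto simp: Z_def)
    then show "s ` ball 0 r \<subseteq> \<phi> ` U" using sZ by blast
  qed
  moreover have "smooth_on (ball 0 r \<inter> \<sigma> -` V) (\<psi> \<circ> \<sigma>)" if d: "(V, \<psi>) \<in> A" for V \<psi>
  proof -
    have "open (ball 0 r \<inter> \<sigma> -` V)"
      by (rule continuous_open_preimage[OF \<sigma>_cont open_ball chart_open[OF d]])
    moreover have "s ` (ball 0 r \<inter> \<sigma> -` V) \<subseteq> \<phi> ` (U \<inter> V)"
    proof
      fix z assume "z \<in> s ` (ball 0 r \<inter> \<sigma> -` V)"
      then obtain u where u: "u \<in> ball 0 r" "\<sigma> u \<in> V" "z = s u" by auto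
      then have "\<phi> (\<sigma> u) = z" "\<sigma> u \<in> U \<inter> V" using \<sigma>[OF u(1)] W by auto
      then show "z \<in> \<phi> ` (U \<inter> V)" by blast
    qed
    ultimately have "smooth_on (ball 0 r \<inter> \<sigma> -` V) (\<lambda>u. (\<psi> \<circ> inv_into U \<phi>) (s u))"
      by (rule smooth_on_compose[OF _ chart_image_open[OF c(1) chart_open[OF d]] _ chart_transition[OF c(1) d]
            smooth_on_subset[OF s_smooth]]) auto
    then show ?thesis by (simp add: \<sigma>_def[abs_def] o_def)
  qed
  moreover have "inj (param_differential A \<sigma> u)" if u: "u \<in> ball 0 r" for u
  proof (rule injI)
    fix w w' assume "param_differential A \<sigma> u w = param_differential A \<sigma> u w'"
    then have "w \<bullet> j = w' \<bullet> j" if "j \<in> Basis" for j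
      using pary[OF u that, of w] pary[OF u that, of w'] by simp
    then show "w = w'" by (rule euclidean_eqI)
  qed
  moreover have "range (param_differential A \<sigma> u) = \<H> (\<sigma> u)" if u: "u \<in> ball 0 r" for u
  proof
    show "range (param_differential A \<sigma> u) \<subseteq> \<H> (\<sigma> u)"
      unfolding par[OF u, abs_def] using section_in[OF Ls] by (auto intro!: H_sum H_scale)
    show "\<H> (\<sigma> u) \<subseteq> range (param_differential A \<sigma> u)"
    proof
      fix v assume v: "v \<in> \<H> (\<sigma> u)"
      \<comment> \<open>The differential of \<open>\<sigma>\<close> sends the basis vector
        \<open>i\<close> to \<open>L i\<close>, and these are the coefficients of a horizontal
        vector in the frame.\<close>
      define w where "w = (\<Sum>i\<in>Basis. v (y i \<circ> F) *\<^sub>R i)"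
      have "v = (\<Sum>i\<in>Basis. v (y i \<circ> F) *\<^sub>R L0 i (\<sigma> u))"
        using hor_frame[OF fr(2) _ H_tangent[OF v]] hor_H[OF v] \<sigma>(1)[OF u] W by auto
      also have "\<dots> = param_differential A \<sigma> u w"
        unfolding par[OF u] w_def by (intro sum.cong refl) (simp add: LL0[OF \<sigma>(1)[OF u]] inner_sum_left_Basis)
      finally show "v \<in> range (param_differential A \<sigma> u)" by blast
    qed
  qed
  ultimately have "integral_manifold A \<H> (ball 0 r) \<sigma>"
    unfolding integral_manifold_def by auto
  moreover have "p \<in> \<sigma> ` ball 0 r"
    using r by (intro image_eqI[of _ _ 0]) (auto simp: \<sigma>_def s0 chart_inv[OF c(1,2)])
  ultimately show "\<exists>(U::'f set) s. integral_manifold A \<H> U s \<and> p \<in> s ` U" by blast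
qed

text \<open>By \<open>oneill_bracket\<close> the two sides of the condition differ by
  \<open>g([X,Y], Z)\<close>, so the condition is \<open>involutive_iff\<close> in disguise.
  Integral manifolds are parametrized by \<open>'f\<close>, the model space of the base, because
  horizontal vectors correspond to tangent vectors of the base.\<close>

lemma anti_invariant_iff:
  assumes R: "endomorphism_field A R"
    and RR: "\<And>p v w. v \<in> T p \<Longrightarrow> w \<in> T p \<Longrightarrow> g p (R p v) (R p w) = g p v w"
    and par: "parallel_endomorphism A nab R"
    and anti: "\<And>p v. v \<in> \<V> p \<Longrightarrow> R p v \<in> \<H> p"
  defines "\<A> \<equiv> oneill_A A g nab \<V>"
    and "b \<equiv> \<lambda>X. vert \<bullet>\<^sub>v R \<bullet>\<^sub>v X" and "c \<equiv> \<lambda>X. hor \<bullet>\<^sub>v R \<bullet>\<^sub>v X"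
  shows "integrable_distribution TYPE('f) A \<H> \<longleftrightarrow>
    (\<forall>Z\<in>sections A \<V>. \<forall>X\<in>sections A \<H>. \<forall>Y\<in>sections A \<H>. \<forall>p.
      g p ((\<A> X (b Y) - \<A> Y (b X)) p) ((R \<bullet>\<^sub>v Z) p) =
      g p (c Y p) ((R \<bullet>\<^sub>v \<A> X Z) p) - g p (c X p) ((R \<bullet>\<^sub>v \<A> Y Z) p))"
proof -
  have "integrable_distribution TYPE('f) A \<H> \<longleftrightarrow> involutive"
    using integrable_imp_involutive involutive_imp_integrable by blast
  also have "\<dots> \<longleftrightarrow> (\<forall>Z\<in>sections A \<V>. \<forall>X\<in>sections A \<H>. \<forall>Y\<in>sections A \<H>. \<forall>p.
      g p ((\<A> X (b Y) - \<A> Y (b X)) p) ((R \<bullet>\<^sub>v Z) p) -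
      (g p (c Y p) ((R \<bullet>\<^sub>v \<A> X Z) p) - g p (c X p) ((R \<bullet>\<^sub>v \<A> Y Z) p)) = 0)"
    unfolding involutive_iff \<A>_def b_def c_def
    by (intro ball_cong all_cong1 refl) (subst oneill_bracket[OF R RR par anti], auto)
  finally show ?thesis by simp
qed

end

end

section \<open>Specialization of the equivalence to each of the three complex structures\<close>

theorem theorem3p9:
  fixes M :: "('a::{t2_space, second_countable_topology}, 'e::euclidean_space) chart set"
    and N :: "('b::{t2_space, second_countable_topology}, 'f::euclidean_space) chart set"
    and g\<^sub>M :: "'a metric" and g\<^sub>N :: "'b metric"
    and nab :: "'a connection"
    and I J K :: "'a \<Rightarrow> 'a tvec \<Rightarrow> 'a tvec"
    and F :: "'a \<Rightarrow> 'b"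
  assumes "hyperkaehler_manifold M g\<^sub>M nab I J K"
    and "riemannian_manifold N g\<^sub>N"
    and "h_anti_invariant_submersion M g\<^sub>M N g\<^sub>N I J K F"
  shows
    "let \<V> = kernel_distribution M N F;
         \<H> = orthogonal_distribution M g\<^sub>M \<V>;
         \<A> = oneill_A M g\<^sub>M nab \<V>;
         B = (\<lambda>R X. proj M g\<^sub>M \<V> \<bullet>\<^sub>v R \<bullet>\<^sub>v X);
         C = (\<lambda>R X. coproj M g\<^sub>M \<V> \<bullet>\<^sub>v R \<bullet>\<^sub>v X);
         a = integrable_distribution TYPE('f) M \<H>;
         b = (\<forall>V\<in>sections M \<V>. \<forall>X\<in>sections M \<H>. \<forall>Y\<in>sections M \<H>. \<forall>p.
               g\<^sub>M p ((\<A> X (B I Y) - \<A> Y (B I X)) p) ((I \<bullet>\<^sub>v V) p) =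
               g\<^sub>M p (C I Y p) ((I \<bullet>\<^sub>v \<A> X V) p) - g\<^sub>M p (C I X p) ((I \<bullet>\<^sub>v \<A> Y V) p));
         c = (\<forall>V\<in>sections M \<V>. \<forall>X\<in>sections M \<H>. \<forall>Y\<in>sections M \<H>. \<forall>p.
               g\<^sub>M p ((\<A> X (B J Y) - \<A> Y (B J X)) p) ((J \<bullet>\<^sub>v V) p) =
               g\<^sub>M p (C J Y p) ((J \<bullet>\<^sub>v \<A> X V) p) - g\<^sub>M p (C J X p) ((J \<bullet>\<^sub>v \<A> Y V) p));
         d = (\<forall>V\<in>sections M \<V>. \<forall>X\<in>sections M \<H>. \<forall>Y\<in>sections M \<H>. \<forall>p.
               g\<^sub>M p ((\<A> X (B K Y) - \<A> Y (B K X)) p) ((K \<bullet>\<^sub>v V) p) =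
               g\<^sub>M p (C K Y p) ((K \<bullet>\<^sub>v \<A> X V) p) - g\<^sub>M p (C K X p) ((K \<bullet>\<^sub>v \<A> Y V) p))
     in (a \<longleftrightarrow> b) \<and> (a \<longleftrightarrow> c) \<and> (a \<longleftrightarrow> d)"
proof -
  note hk = assms(1)[unfolded hyperkaehler_manifold_def riemannian_manifold_def]
  interpret submersion M g\<^sub>M N g\<^sub>N F
  proof
    show "smooth_manifold M" "riemannian_metric M g\<^sub>M" using hk by blast+
    show "smooth_manifold N" using assms(2) unfolding riemannian_manifold_def by blast
    show "riemannian_submersion M g\<^sub>M N g\<^sub>N F"
      using assms(3) unfolding h_anti_invariant_submersion_def by blast
  qed
  have LC: "levi_civita M g\<^sub>M nab" using hk by blast
  note hkR = hk[THEN conjunct2, THEN conjunct2, THEN conjunct2]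
  have R: "endomorphism_field M R" "parallel_endomorphism M nab R"
    "\<And>p v w. v \<in> T p \<Longrightarrow> w \<in> T p \<Longrightarrow> g\<^sub>M p (R p v) (R p w) = g\<^sub>M p v w"
    "\<And>p v. v \<in> \<V> p \<Longrightarrow> R p v \<in> \<H> p" if R: "R \<in> {I, J, K}" for R
  proof -
    show "endomorphism_field M R" "parallel_endomorphism M nab R"
      by (rule bspec[OF hkR[THEN conjunct1] R],
          rule bspec[OF hkR[THEN conjunct2, THEN conjunct2, THEN conjunct2, THEN conjunct2] R])
    show "g\<^sub>M p (R p v) (R p w) = g\<^sub>M p v w" if "v \<in> T p" "w \<in> T p" for p v w
      using bspec[OF hkR[THEN conjunct2, THEN conjunct2, THEN conjunct2, THEN conjunct1] R] that by blast
    show "R p v \<in> \<H> p" if "v \<in> \<V> p" for p v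
      using bspec[OF assms(3)[unfolded h_anti_invariant_submersion_def, THEN conjunct2] R] that by blast
  qed
  have *: "integrable_distribution TYPE('f) M \<H> \<longleftrightarrow>
    (\<forall>V\<in>sections M \<V>. \<forall>X\<in>sections M \<H>. \<forall>Y\<in>sections M \<H>. \<forall>p.
      g\<^sub>M p ((oneill_A M g\<^sub>M nab \<V> X (vert \<bullet>\<^sub>v R \<bullet>\<^sub>v Y) - oneill_A M g\<^sub>M nab \<V> Y (vert \<bullet>\<^sub>v R \<bullet>\<^sub>v X)) p) ((R \<bullet>\<^sub>v V) p) =
      g\<^sub>M p ((hor \<bullet>\<^sub>v R \<bullet>\<^sub>v Y) p) ((R \<bullet>\<^sub>v oneill_A M g\<^sub>M nab \<V> X V) p) -
      g\<^sub>M p ((hor \<bullet>\<^sub>v R \<bullet>\<^sub>v X) p) ((R \<bullet>\<^sub>v oneill_A M g\<^sub>M nab \<V> Y V) p))" if "R \<in> {I, J, K}" for R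
    by (rule anti_invariant_iff[OF LC R(1)[OF that] R(3)[OF that] R(2)[OF that] R(4)[OF that]])
  show ?thesis
    unfolding Let_def using *[of I] *[of J] *[of K] by (intro conjI) simp_all
qed

end
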